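(* Let $\mathcal A$ be an abelian category of finite length and let $X\in\mathcal A$ have nonisomorphic simple factors $\{S^i:i\in I\}$, with associated partial order $\preceq$ on $I$ (as defined in the context). Then there exists an $(I,\preceq)$-configuration $(\sigma,\iota,\pi)$ in $\mathcal A$ with $\sigma(I)=X$ and $\sigma(\{i\})\cong S^i$ for $i\in I$, such that for each s-set $J\subseteq I$ the morphism $\iota(J,I):\sigma(J)\to X$ represents the unique subobject of $X$ whose simple factors are isomorphic to $S^i$ for $i\in J$. This $(\sigma,\iota,\pi)$ is unique up to canonical isomorphism in $\mathcal A$.
   Context: An abelian category is of finite length if it is artinian and noetherian. A composition series for $X$ is a filtration by subobjects $0=A_0\subset A_1\subset\cdots\subset A_n=X$ whose factors $S_k=A_k/A_{k-1}$ are all simple; the $S_k$ are independent of choices up to isomorphism and permutation. $X$ has nonisomorphic simple factors if $S_k\not\cong S_l$ for $1\le k<l\le n$. In that case let $I$ be an indexing set with $|I|=n$ and write $\{S_1,\ldots,S_n\}=\{S^i:i\in I\}$. For every composition series $0=B_0\subset\cdots\subset B_n=X$ with $T_k=B_k/B_{k-1}$ there is a unique bijection $\phi:I\to\{1,\ldots,n\}$ with $S^i\cong T_{\phi(i)}$ for all $i$. The partial order $\preceq$ on $I$ is: $i\preceq j$ if and only if $\phi(i)\le\phi(j)$ for all bijections $\phi$ arising from composition series of $X$. For each s-set $J\subseteq I$ (defined below) there is a unique subobject $S\subset X$ such that the simple factors of any composition series of $S$ are, up to isomorphism and order, the $S^i$ for $i\in J$, each once; this is a bijection between s-sets and subobjects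 of $X$. Let $(I,\preceq)$ be a finite poset. A subset $J\subseteq I$ is an s-set if $i\in I$, $j\in J$, $i\preceq j$ imply $i\in J$; it is an f-set if $i\in I$, $h,j\in J$, $h\preceq i\preceq j$ imply $i\in J$. $\mathcal F_{(I,\preceq)}$ is the set of f-sets of $I$; $\mathcal G_{(I,\preceq)}$ is the set of pairs $(J,K)$ of f-sets with $J\subseteq K$ such that $j\in J$, $k\in K$, $k\preceq j$ imply $k\in J$; $\mathcal H_{(I,\preceq)}$ is the set of pairs $(J,K)$ of f-sets with $K\subseteq J$ such that $j\in J$, $k\in K$, $k\preceq j$ imply $j\in K$. An $(I,\preceq)$-configuration $(\sigma,\iota,\pi)$ in $\mathcal A$ consists of objects $\sigma(J)$ for $J\in\mathcal F_{(I,\preceq)}$ with $\sigma(\emptyset)=0$; injective morphisms $\iota(J,K):\sigma(J)\to\sigma(K)$ for $(J,K)\in\mathcal G_{(I,\preceq)}$ with $\iota(J,J)=\mathrm{id}_{\sigma(J)}$; and surjective morphisms $\pi(J,K):\sigma(J)\to\sigma(K)$ for $(J,K)\in\mathcal H_{(I,\preceq)}$ with $\pi(J,J)=\mathrm{id}_{\sigma(J)}$, such that: (A) if $(J,K)\in\mathcal G_{(I,\preceq)}$ and $L=K\setminus J$ then $0\to\sigma(J)\xrightarrow{\iota(J,K)}\sigma(K)\xrightarrow{\pi(K,L)}\sigma(L)\to0$ is exact; (B) if $(J,K),(K,L)\in\mathcal G_{(I,\preceq)}$ then $\iota(J,L)=\iota(K,L)\circ\iota(J,K)$; (C) if $(J,K),(K,L)\in\mathcal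 H_{(I,\preceq)}$ then $\pi(J,L)=\pi(K,L)\circ\pi(J,K)$; (D) if $(J,K)\in\mathcal G_{(I,\preceq)}$ and $(K,L)\in\mathcal H_{(I,\preceq)}$ then $\pi(K,L)\circ\iota(J,K)=\iota(J\cap L,L)\circ\pi(J,J\cap L)$. A morphism $\alpha:(\sigma,\iota,\pi)\to(\sigma',\iota',\pi')$ is a collection of morphisms $\alpha(J):\sigma(J)\to\sigma'(J)$, $J\in\mathcal F_{(I,\preceq)}$, commuting with all $\iota$'s and $\pi$'s; it is an isomorphism if all $\alpha(J)$ are. "Unique up to canonical isomorphism" means: for any two such configurations there is a unique isomorphism $\alpha$ between them with $\alpha(I)=\mathrm{id}_X$. *)

theory Defs
  imports "HOL-Algebra.Group"
begin

record ('o, 'm) cat_data =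
  Obj :: "'o set"
  Mor :: "'m set"
  src :: "'m \<Rightarrow> 'o"
  tgt :: "'m \<Rightarrow> 'o"
  ident :: "'o \<Rightarrow> 'm"
  cmp :: "'m \<Rightarrow> 'm \<Rightarrow> 'm"  (infixr \<open>\<odot>\<index>\<close> 75)

definition Hom :: "('o, 'm, 'x) cat_data_scheme \<Rightarrow> 'o \<Rightarrow> 'o \<Rightarrow> 'm set" where
  "Hom C X Y = {f \<in> Mor C. src C f = X \<and> tgt C f = Y}"

locale cat =
  fixes C :: "('o, 'm, 'x) cat_data_scheme" (structure)
  assumes src_Obj: "f \<in> Mor C \<Longrightarrow> src C f \<in> Obj C"
    and tgt_Obj: "f \<in> Mor C \<Longrightarrow> tgt C f \<in> Obj C"
    and ident_Hom: "X \<in> Obj C \<Longrightarrow> ident C X \<in> Hom C X X"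
    and cmp_Hom: "f \<in> Hom C X Y \<Longrightarrow> g \<in> Hom C Y Z \<Longrightarrow> g \<odot> f \<in> Hom C X Z"
    and cmp_assoc: "f \<in> Hom C W X \<Longrightarrow> g \<in> Hom C X Y \<Longrightarrow> h \<in> Hom C Y Z \<Longrightarrow>
      (h \<odot> g) \<odot> f = h \<odot> (g \<odot> f)"
    and cmp_ident_right: "f \<in> Hom C X Y \<Longrightarrow> f \<odot> ident C X = f"
    and cmp_ident_left: "f \<in> Hom C X Y \<Longrightarrow> ident C Y \<odot> f = f"

definition monic :: "('o, 'm, 'x) cat_data_scheme \<Rightarrow> 'm \<Rightarrow> bool" where
  "monic C f \<longleftrightarrow> f \<in> Mor C \<and>
    (\<forall>W. \<forall>g \<in> Hom C W (src C f). \<forall>h \<in> Hom C W (src C f). f \<odot>\<^bsub>C\<^esub> g = f \<odot>\<^bsub>C\<^esub> h \<longrightarrow> g = h)"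

definition epic :: "('o, 'm, 'x) cat_data_scheme \<Rightarrow> 'm \<Rightarrow> bool" where
  "epic C f \<longleftrightarrow> f \<in> Mor C \<and>
    (\<forall>W. \<forall>g \<in> Hom C (tgt C f) W. \<forall>h \<in> Hom C (tgt C f) W. g \<odot>\<^bsub>C\<^esub> f = h \<odot>\<^bsub>C\<^esub> f \<longrightarrow> g = h)"

definition is_iso :: "('o, 'm, 'x) cat_data_scheme \<Rightarrow> 'm \<Rightarrow> bool" where
  "is_iso C f \<longleftrightarrow> f \<in> Mor C \<and>
    (\<exists>g \<in> Hom C (tgt C f) (src C f).
      g \<odot>\<^bsub>C\<^esub> f = ident C (src C f) \<and> f \<odot>\<^bsub>C\<^esub> g = ident C (tgt C f))"

definition isomorphic :: "('o, 'm, 'x) cat_data_scheme \<Rightarrow> 'o \<Rightarrow> 'o \<Rightarrow> bool" where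
  "isomorphic C X Y \<longleftrightarrow> (\<exists>f \<in> Hom C X Y. is_iso C f)"

definition zero_object :: "('o, 'm, 'x) cat_data_scheme \<Rightarrow> 'o \<Rightarrow> bool" where
  "zero_object C Z \<longleftrightarrow> Z \<in> Obj C \<and>
    (\<forall>X \<in> Obj C. (\<exists>!f. f \<in> Hom C X Z) \<and> (\<exists>!f. f \<in> Hom C Z X))"

record ('o, 'm) preadd_data = "('o, 'm) cat_data" +
  add_mor :: "'m \<Rightarrow> 'm \<Rightarrow> 'm"  (infixl \<open>\<boxplus>\<index>\<close> 65)
  zero_mor :: "'o \<Rightarrow> 'o \<Rightarrow> 'm"

definition hom_group :: "('o, 'm, 'x) preadd_data_scheme \<Rightarrow> 'o \<Rightarrow> 'o \<Rightarrow> 'm monoid" where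
  "hom_group C X Y = \<lparr>carrier = Hom C X Y, mult = add_mor C, one = zero_mor C X Y\<rparr>"

definition is_kernel :: "('o, 'm, 'x) preadd_data_scheme \<Rightarrow> 'm \<Rightarrow> 'm \<Rightarrow> bool" where
  "is_kernel C f k \<longleftrightarrow> f \<in> Mor C \<and> k \<in> Mor C \<and> tgt C k = src C f \<and>
    f \<odot>\<^bsub>C\<^esub> k = zero_mor C (src C k) (tgt C f) \<and>
    (\<forall>W. \<forall>h \<in> Hom C W (src C f). f \<odot>\<^bsub>C\<^esub> h = zero_mor C W (tgt C f) \<longrightarrow>
      (\<exists>!u. u \<in> Hom C W (src C k) \<and> k \<odot>\<^bsub>C\<^esub> u = h))"

definition is_cokernel :: "('o, 'm, 'x) preadd_data_scheme \<Rightarrow> 'm \<Rightarrow> 'm \<Rightarrow> bool" where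
  "is_cokernel C f c \<longleftrightarrow> f \<in> Mor C \<and> c \<in> Mor C \<and> src C c = tgt C f \<and>
    c \<odot>\<^bsub>C\<^esub> f = zero_mor C (src C f) (tgt C c) \<and>
    (\<forall>W. \<forall>h \<in> Hom C (tgt C f) W. h \<odot>\<^bsub>C\<^esub> f = zero_mor C (src C f) W \<longrightarrow>
      (\<exists>!u. u \<in> Hom C (tgt C c) W \<and> u \<odot>\<^bsub>C\<^esub> c = h))"

locale abelian_category = cat C
  for C :: "('o, 'm, 'x) preadd_data_scheme" (structure) +
  assumes hom_comm_group: "X \<in> Obj C \<Longrightarrow> Y \<in> Obj C \<Longrightarrow> comm_group (hom_group C X Y)"
    and cmp_add_right: "f \<in> Hom C X Y \<Longrightarrow> f' \<in> Hom C X Y \<Longrightarrow> g \<in> Hom C Y Z \<Longrightarrow>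
      g \<odot> (f \<boxplus> f') = (g \<odot> f) \<boxplus> (g \<odot> f')"
    and cmp_add_left: "f \<in> Hom C X Y \<Longrightarrow> g \<in> Hom C Y Z \<Longrightarrow> g' \<in> Hom C Y Z \<Longrightarrow>
      (g \<boxplus> g') \<odot> f = (g \<odot> f) \<boxplus> (g' \<odot> f)"
    and ex_zero_object: "\<exists>Z. zero_object C Z"
    and ex_biproduct: "X \<in> Obj C \<Longrightarrow> Y \<in> Obj C \<Longrightarrow>
      \<exists>Z \<in> Obj C. \<exists>i \<in> Hom C X Z. \<exists>j \<in> Hom C Y Z. \<exists>p \<in> Hom C Z X. \<exists>q \<in> Hom C Z Y.
        p \<odot> i = ident C X \<and> q \<odot> j = ident C Y \<and>
        q \<odot> i = zero_mor C X Y \<and> p \<odot> j = zero_mor C Y X \<and>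
        (i \<odot> p) \<boxplus> (j \<odot> q) = ident C Z"
    and ex_kernel: "f \<in> Mor C \<Longrightarrow> \<exists>k. is_kernel C f k"
    and ex_cokernel: "f \<in> Mor C \<Longrightarrow> \<exists>c. is_cokernel C f c"
    and monic_normal: "monic C f \<Longrightarrow> \<exists>g. is_kernel C g f"
    and epic_normal: "epic C f \<Longrightarrow> \<exists>g. is_cokernel C g f"

text \<open>An image of \<open>f\<close> is a kernel of a cokernel of \<open>f\<close>; \<open>short_exact C f g\<close> is exactness of
  \<open>0 \<rightarrow> src f \<rightarrow> tgt f \<rightarrow> tgt g \<rightarrow> 0\<close> at each of the three inner places.\<close>

definition is_image :: "('o, 'm, 'x) preadd_data_scheme \<Rightarrow> 'm \<Rightarrow> 'm \<Rightarrow> bool" where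
  "is_image C f j \<longleftrightarrow> (\<exists>c. is_cokernel C f c \<and> is_kernel C c j)"

definition exact_at :: "('o, 'm, 'x) preadd_data_scheme \<Rightarrow> 'm \<Rightarrow> 'm \<Rightarrow> bool" where
  "exact_at C f g \<longleftrightarrow> (\<exists>j. is_image C f j \<and> is_kernel C g j)"

definition short_exact :: "('o, 'm, 'x) preadd_data_scheme \<Rightarrow> 'm \<Rightarrow> 'm \<Rightarrow> bool" where
  "short_exact C f g \<longleftrightarrow> (\<exists>Z. zero_object C Z \<and>
    exact_at C (zero_mor C Z (src C f)) f \<and> exact_at C f g \<and>
    exact_at C g (zero_mor C (tgt C g) Z))"

text \<open>A subobject is an equivalence class of monomorphisms, represented as the set of its members.\<close>

definition subobject :: "('o, 'm, 'x) cat_data_scheme \<Rightarrow> 'm \<Rightarrow> 'm set" where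
  "subobject C i = {j. monic C j \<and> tgt C j = tgt C i \<and>
    (\<exists>h \<in> Hom C (src C i) (src C j). is_iso C h \<and> i = j \<odot>\<^bsub>C\<^esub> h)}"

definition subobjects :: "('o, 'm, 'x) cat_data_scheme \<Rightarrow> 'o \<Rightarrow> 'm set set" where
  "subobjects C X = {subobject C i | i. monic C i \<and> tgt C i = X}"

definition sub_le :: "('o, 'm, 'x) cat_data_scheme \<Rightarrow> 'm set \<Rightarrow> 'm set \<Rightarrow> bool" where
  "sub_le C U V \<longleftrightarrow>
    (\<exists>i \<in> U. \<exists>j \<in> V. \<exists>h \<in> Hom C (src C i) (src C j). i = j \<odot>\<^bsub>C\<^esub> h)"

definition zero_sub :: "('o, 'm, 'x) cat_data_scheme \<Rightarrow> 'm set \<Rightarrow> bool" where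
  "zero_sub C U \<longleftrightarrow> (\<exists>i \<in> U. zero_object C (src C i))"

definition full_sub :: "('o, 'm, 'x) cat_data_scheme \<Rightarrow> 'o \<Rightarrow> 'm set" where
  "full_sub C X = subobject C (ident C X)"

definition artinian :: "('o, 'm, 'x) cat_data_scheme \<Rightarrow> bool" where
  "artinian C \<longleftrightarrow> (\<forall>X \<in> Obj C. \<forall>A :: nat \<Rightarrow> 'm set.
    (\<forall>n. A n \<in> subobjects C X \<and> sub_le C (A (Suc n)) (A n)) \<longrightarrow> (\<exists>N. \<forall>n\<ge>N. A n = A N))"

definition noetherian :: "('o, 'm, 'x) cat_data_scheme \<Rightarrow> bool" where
  "noetherian C \<longleftrightarrow> (\<forall>X \<in> Obj C. \<forall>A :: nat \<Rightarrow> 'm set.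
    (\<forall>n. A n \<in> subobjects C X \<and> sub_le C (A n) (A (Suc n))) \<longrightarrow> (\<exists>N. \<forall>n\<ge>N. A n = A N))"

definition finite_length :: "('o, 'm, 'x) cat_data_scheme \<Rightarrow> bool" where
  "finite_length C \<longleftrightarrow> artinian C \<and> noetherian C"

definition simple_object :: "('o, 'm, 'x) cat_data_scheme \<Rightarrow> 'o \<Rightarrow> bool" where
  "simple_object C X \<longleftrightarrow> X \<in> Obj C \<and> \<not> zero_object C X \<and>
    (\<forall>U \<in> subobjects C X. zero_sub C U \<or> U = full_sub C X)"

text \<open>Factor objects are determined only up to isomorphism: \<open>is_factor C U V Q\<close> says that
  \<open>U\<close> is contained in \<open>V\<close> and that \<open>Q\<close> is one of the objects \<open>V/U\<close>.\<close>

definition is_factor :: "('o, 'm, 'x) preadd_data_scheme \<Rightarrow> 'm set \<Rightarrow> 'm set \<Rightarrow> 'o \<Rightarrow> bool" where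
  "is_factor C U V Q \<longleftrightarrow>
    (\<exists>i \<in> U. \<exists>j \<in> V. \<exists>h \<in> Hom C (src C i) (src C j). i = j \<odot>\<^bsub>C\<^esub> h \<and>
      (\<exists>p. is_cokernel C h p \<and> tgt C p = Q))"

text \<open>Only the values of \<open>A\<close> on \<open>{0..n}\<close> and of \<open>T\<close> on \<open>{1..n}\<close> matter; \<open>T k\<close> is a factor
  \<open>A k / A (k - 1)\<close>.\<close>

definition composition_series ::
  "('o, 'm, 'x) preadd_data_scheme \<Rightarrow> 'o \<Rightarrow> nat \<Rightarrow> (nat \<Rightarrow> 'm set) \<Rightarrow> (nat \<Rightarrow> 'o) \<Rightarrow> bool" where
  "composition_series C X n A T \<longleftrightarrow>
    (\<forall>k\<le>n. A k \<in> subobjects C X) \<and> zero_sub C (A 0) \<and> A n = full_sub C X \<and>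
    (\<forall>k<n. is_factor C (A k) (A (Suc k)) (T (Suc k)) \<and> simple_object C (T (Suc k)))"

text \<open>The indexed family \<open>S\<close> on \<open>I\<close> lists the simple factors of \<open>X\<close>, which are pairwise
  nonisomorphic; the cardinality condition makes the listing repetition-free.\<close>

definition nonisomorphic_simple_factors ::
  "('o, 'm, 'x) preadd_data_scheme \<Rightarrow> 'o \<Rightarrow> 'i set \<Rightarrow> ('i \<Rightarrow> 'o) \<Rightarrow> bool" where
  "nonisomorphic_simple_factors C X I S \<longleftrightarrow>
    (\<exists>n A T. composition_series C X n A T \<and>
      (\<forall>k l. 1 \<le> k \<and> k < l \<and> l \<le> n \<longrightarrow> \<not> isomorphic C (T k) (T l)) \<and>
      finite I \<and> card I = n \<and> T ` {1..n} = S ` I)"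

definition factor_bij ::
  "('o, 'm, 'x) cat_data_scheme \<Rightarrow> 'i set \<Rightarrow> ('i \<Rightarrow> 'o) \<Rightarrow> nat \<Rightarrow> (nat \<Rightarrow> 'o) \<Rightarrow> ('i \<Rightarrow> nat) \<Rightarrow> bool"
  where
  "factor_bij C J S n T \<phi> \<longleftrightarrow>
    bij_betw \<phi> J {1..n} \<and> (\<forall>i \<in> J. isomorphic C (S i) (T (\<phi> i)))"

definition factor_order ::
  "('o, 'm, 'x) preadd_data_scheme \<Rightarrow> 'o \<Rightarrow> 'i set \<Rightarrow> ('i \<Rightarrow> 'o) \<Rightarrow> 'i rel" where
  "factor_order C X I S = {(i, j). i \<in> I \<and> j \<in> I \<and>
    (\<forall>n A T \<phi>. composition_series C X n A T \<and> factor_bij C I S n T \<phi> \<longrightarrow> \<phi> i \<le> \<phi> j)}"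

text \<open>The simple factors of the underlying object of the subobject \<open>U\<close> are the \<open>S i\<close> for
  \<open>i \<in> J\<close>, each once.\<close>

definition has_simple_factors ::
  "('o, 'm, 'x) preadd_data_scheme \<Rightarrow> 'i set \<Rightarrow> ('i \<Rightarrow> 'o) \<Rightarrow> 'm set \<Rightarrow> bool" where
  "has_simple_factors C J S U \<longleftrightarrow>
    (\<forall>u \<in> U. \<forall>n A T. composition_series C (src C u) n A T \<longrightarrow> (\<exists>\<phi>. factor_bij C J S n T \<phi>))"

definition s_sets :: "'i set \<Rightarrow> 'i rel \<Rightarrow> 'i set set" where
  "s_sets I r = {J. J \<subseteq> I \<and> (\<forall>i \<in> I. \<forall>j \<in> J. (i, j) \<in> r \<longrightarrow> i \<in> J)}"

definition f_sets :: "'i set \<Rightarrow> 'i rel \<Rightarrow> 'i set set" where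
  "f_sets I r = {J. J \<subseteq> I \<and>
    (\<forall>i \<in> I. \<forall>h \<in> J. \<forall>j \<in> J. (h, i) \<in> r \<and> (i, j) \<in> r \<longrightarrow> i \<in> J)}"

definition G_pairs :: "'i set \<Rightarrow> 'i rel \<Rightarrow> ('i set \<times> 'i set) set" where
  "G_pairs I r = {(J, K). J \<in> f_sets I r \<and> K \<in> f_sets I r \<and> J \<subseteq> K \<and>
    (\<forall>j \<in> J. \<forall>k \<in> K. (k, j) \<in> r \<longrightarrow> k \<in> J)}"

definition H_pairs :: "'i set \<Rightarrow> 'i rel \<Rightarrow> ('i set \<times> 'i set) set" where
  "H_pairs I r = {(J, K). J \<in> f_sets I r \<and> K \<in> f_sets I r \<and> K \<subseteq> J \<and>
    (\<forall>j \<in> J. \<forall>k \<in> K. (k, j) \<in> r \<longrightarrow> j \<in> K)}"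

text \<open>The equation \<open>\<sigma>(\<emptyset>) = 0\<close> is read as ``is a zero object'', as no zero object is singled out.
  Values of \<open>\<sigma>\<close>, \<open>\<iota>\<close>, \<open>\<pi>\<close> outside the f-sets, \<open>G_pairs\<close> and \<open>H_pairs\<close> are irrelevant.\<close>

definition configuration ::
  "('o, 'm, 'x) preadd_data_scheme \<Rightarrow> 'i set \<Rightarrow> 'i rel \<Rightarrow>
   ('i set \<Rightarrow> 'o) \<Rightarrow> ('i set \<Rightarrow> 'i set \<Rightarrow> 'm) \<Rightarrow> ('i set \<Rightarrow> 'i set \<Rightarrow> 'm) \<Rightarrow> bool" where
  "configuration C I r \<sigma> \<iota> \<pi> \<longleftrightarrow>
    finite I \<and> partial_order_on I r \<and>
    (\<forall>J \<in> f_sets I r. \<sigma> J \<in> Obj C) \<and> zero_object C (\<sigma> {}) \<and>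
    (\<forall>(J, K) \<in> G_pairs I r. \<iota> J K \<in> Hom C (\<sigma> J) (\<sigma> K) \<and> monic C (\<iota> J K)) \<and>
    (\<forall>J \<in> f_sets I r. \<iota> J J = ident C (\<sigma> J)) \<and>
    (\<forall>(J, K) \<in> H_pairs I r. \<pi> J K \<in> Hom C (\<sigma> J) (\<sigma> K) \<and> epic C (\<pi> J K)) \<and>
    (\<forall>J \<in> f_sets I r. \<pi> J J = ident C (\<sigma> J)) \<and>
    (\<forall>(J, K) \<in> G_pairs I r. short_exact C (\<iota> J K) (\<pi> K (K - J))) \<and>
    (\<forall>J K L. (J, K) \<in> G_pairs I r \<and> (K, L) \<in> G_pairs I r \<longrightarrow>
      \<iota> J L = \<iota> K L \<odot>\<^bsub>C\<^esub> \<iota> J K) \<and>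
    (\<forall>J K L. (J, K) \<in> H_pairs I r \<and> (K, L) \<in> H_pairs I r \<longrightarrow>
      \<pi> J L = \<pi> K L \<odot>\<^bsub>C\<^esub> \<pi> J K) \<and>
    (\<forall>J K L. (J, K) \<in> G_pairs I r \<and> (K, L) \<in> H_pairs I r \<longrightarrow>
      \<pi> K L \<odot>\<^bsub>C\<^esub> \<iota> J K = \<iota> (J \<inter> L) L \<odot>\<^bsub>C\<^esub> \<pi> J (J \<inter> L))"

definition configuration_morphism ::
  "('o, 'm, 'x) preadd_data_scheme \<Rightarrow> 'i set \<Rightarrow> 'i rel \<Rightarrow>
   ('i set \<Rightarrow> 'o) \<Rightarrow> ('i set \<Rightarrow> 'i set \<Rightarrow> 'm) \<Rightarrow> ('i set \<Rightarrow> 'i set \<Rightarrow> 'm) \<Rightarrow>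
   ('i set \<Rightarrow> 'o) \<Rightarrow> ('i set \<Rightarrow> 'i set \<Rightarrow> 'm) \<Rightarrow> ('i set \<Rightarrow> 'i set \<Rightarrow> 'm) \<Rightarrow>
   ('i set \<Rightarrow> 'm) \<Rightarrow> bool" where
  "configuration_morphism C I r \<sigma> \<iota> \<pi> \<sigma>' \<iota>' \<pi>' \<alpha> \<longleftrightarrow>
    (\<forall>J \<in> f_sets I r. \<alpha> J \<in> Hom C (\<sigma> J) (\<sigma>' J)) \<and>
    (\<forall>(J, K) \<in> G_pairs I r. \<alpha> K \<odot>\<^bsub>C\<^esub> \<iota> J K = \<iota>' J K \<odot>\<^bsub>C\<^esub> \<alpha> J) \<and>
    (\<forall>(J, K) \<in> H_pairs I r. \<alpha> K \<odot>\<^bsub>C\<^esub> \<pi> J K = \<pi>' J K \<odot>\<^bsub>C\<^esub> \<alpha> J)"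

definition configuration_isomorphism ::
  "('o, 'm, 'x) preadd_data_scheme \<Rightarrow> 'i set \<Rightarrow> 'i rel \<Rightarrow>
   ('i set \<Rightarrow> 'o) \<Rightarrow> ('i set \<Rightarrow> 'i set \<Rightarrow> 'm) \<Rightarrow> ('i set \<Rightarrow> 'i set \<Rightarrow> 'm) \<Rightarrow>
   ('i set \<Rightarrow> 'o) \<Rightarrow> ('i set \<Rightarrow> 'i set \<Rightarrow> 'm) \<Rightarrow> ('i set \<Rightarrow> 'i set \<Rightarrow> 'm) \<Rightarrow>
   ('i set \<Rightarrow> 'm) \<Rightarrow> bool" where
  "configuration_isomorphism C I r \<sigma> \<iota> \<pi> \<sigma>' \<iota>' \<pi>' \<alpha> \<longleftrightarrow>
    configuration_morphism C I r \<sigma> \<iota> \<pi> \<sigma>' \<iota>' \<pi>' \<alpha> \<and> (\<forall>J \<in> f_sets I r. is_iso C (\<alpha> J))"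

text \<open>The singleton equation says that exactly one subobject of \<open>X\<close> has the simple factors
  \<open>S i\<close>, \<open>i \<in> J\<close>, and that \<open>\<iota> J I\<close> represents it.\<close>

definition factor_configuration ::
  "('o, 'm, 'x) preadd_data_scheme \<Rightarrow> 'o \<Rightarrow> 'i set \<Rightarrow> ('i \<Rightarrow> 'o) \<Rightarrow>
   ('i set \<Rightarrow> 'o) \<Rightarrow> ('i set \<Rightarrow> 'i set \<Rightarrow> 'm) \<Rightarrow> ('i set \<Rightarrow> 'i set \<Rightarrow> 'm) \<Rightarrow> bool" where
  "factor_configuration C X I S \<sigma> \<iota> \<pi> \<longleftrightarrow>
    configuration C I (factor_order C X I S) \<sigma> \<iota> \<pi> \<and>
    \<sigma> I = X \<and> (\<forall>i \<in> I. isomorphic C (\<sigma> {i}) (S i)) \<and>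
    (\<forall>J \<in> s_sets I (factor_order C X I S).
      {U \<in> subobjects C X. has_simple_factors C J S U} = {subobject C (\<iota> J I)})"

end

theory Submission
  imports Defs
begin

text \<open>The subobjects of \<open>X\<close> form a modular lattice, and to an inclusion \<open>U \<le> V\<close> belongs the set of
  those \<open>i \<in> I\<close> for which \<open>S i\<close> is a subquotient of \<open>V / U\<close>.  The second isomorphism theorem makes this
  set additive along chains and invariant under passing from \<open>[U \<inter> V, U]\<close> to \<open>[V, U + V]\<close>.  Because
  the simple factors are pairwise nonisomorphic, consecutive intervals have disjoint sets
  (\<open>facs_disjoint\<close>), and then the map \<open>F\<close> from subobjects to subsets of \<open>I\<close> sends
  intersections to intersections, sums to unions, and is injective (\<open>F_meet_join\<close>, \<open>F_inj\<close>).  So the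
  subobject lattice is a lattice of subsets of \<open>I\<close> whose maximal chains are the composition series;
  the factor order is the preorder attached to this lattice of sets, and by Birkhoff's argument
  the lattice consists of all s-sets (\<open>s_sets_eq\<close>).  This proves that every s-set \<open>J\<close> is the set of
  factors of a unique subobject.  Multiplicities never have to be counted: a full
  Jordan-Hoelder theorem is replaced by the disjointness statement, which is proved by induction
  along the one composition series given.

  A configuration is then built from the subobjects \<open>s J\<close> alone.  An f-set \<open>J\<close> is the difference
  of the s-sets \<open>down J\<close> and \<open>down J - J\<close>, and the object at \<open>J\<close> is the quotient of the corresponding
  subobjects.  Whenever \<open>J\<close> is also the difference \<open>Q - (Q - J)\<close> for a larger s-set \<open>Q\<close>, the second
  isomorphism theorem yields a map from \<open>s Q\<close> onto this same object, compatible with the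
  inclusions (\<open>ex_proj\<close>, \<open>proj_restrict\<close>).  All \<open>\<iota>\<close> and \<open>\<pi>\<close> are induced by inclusions between the
  \<open>s Q\<close>, and every identity between them can be checked after composing with an epimorphism from
  some \<open>s Q\<close>, where it becomes an identity between inclusions.

  For uniqueness, an isomorphism \<open>\<alpha>\<close> with \<open>\<alpha> I = id\<close> is forced on s-sets, since \<open>\<iota>' J I\<close> is monic, and
  then on f-sets, since \<open>\<pi> (down J) J\<close> is epic; it exists on s-sets because \<open>\<iota> J I\<close> and \<open>\<iota>' J I\<close>
  represent the same subobject, and descends to f-sets because \<open>\<pi> (down J) J\<close> is a cokernel.\<close>

section \<open>Morphisms and subobjects in a category\<close>

text \<open>For monomorphisms with a common target this preorder is inclusion, and its equivalence classes
  are the subobjects.  With an arbitrary morphism on the left it says that the morphism takes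
  its values in a subobject, which is how universal properties of intersections are stated below.\<close>

definition factors_through :: "('o, 'm, 'x) cat_data_scheme \<Rightarrow> 'm \<Rightarrow> 'm \<Rightarrow> bool" where
  "factors_through C i j \<longleftrightarrow> (\<exists>h \<in> Hom C (src C i) (src C j). i = j \<odot>\<^bsub>C\<^esub> h)"

context cat
begin

lemma in_Hom: "f \<in> Hom C X Y \<longleftrightarrow> f \<in> Mor C \<and> src C f = X \<and> tgt C f = Y"
  by (simp add: Hom_def)

lemma src_tgt_Obj [simp]: "f \<in> Mor C \<Longrightarrow> src C f \<in> Obj C" "f \<in> Mor C \<Longrightarrow> tgt C f \<in> Obj C"
  by (simp_all add: src_Obj tgt_Obj)

lemma ident_Mor [simp]:
  assumes "X \<in> Obj C"
  shows "ident C X \<in> Mor C" "src C (ident C X) = X" "tgt C (ident C X) = X"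
  using ident_Hom[OF assms] by (simp_all add: in_Hom)

lemma cmp_Mor [simp]:
  assumes "f \<in> Mor C" "g \<in> Mor C" "tgt C f = src C g"
  shows "g \<odot> f \<in> Mor C" "src C (g \<odot> f) = src C f" "tgt C (g \<odot> f) = tgt C g"
  using cmp_Hom[of f "src C f" "src C g" g "tgt C g"] assms by (simp_all add: in_Hom)

lemma assoc:
  "\<lbrakk>f \<in> Mor C; g \<in> Mor C; h \<in> Mor C; tgt C f = src C g; tgt C g = src C h\<rbrakk> \<Longrightarrow>
    (h \<odot> g) \<odot> f = h \<odot> g \<odot> f"
  by (rule cmp_assoc[of f "src C f" "src C g" g "src C h" h "tgt C h"]) (simp_all add: in_Hom)

lemma ident_cmp [simp]:
  "\<lbrakk>f \<in> Mor C; tgt C f = X\<rbrakk> \<Longrightarrow> ident C X \<odot> f = f"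
  "\<lbrakk>f \<in> Mor C; src C f = X\<rbrakk> \<Longrightarrow> f \<odot> ident C X = f"
  using cmp_ident_left cmp_ident_right by (auto simp add: in_Hom)

lemma monic_Mor [simp]: "monic C f \<Longrightarrow> f \<in> Mor C"
  by (simp add: monic_def)

lemma epic_Mor [simp]: "epic C f \<Longrightarrow> f \<in> Mor C"
  by (simp add: epic_def)

lemma monic_cancel:
  "\<lbrakk>monic C f; f \<odot> g = f \<odot> h; g \<in> Mor C; h \<in> Mor C; src C g = src C h; tgt C g = src C f;
    tgt C h = src C f\<rbrakk> \<Longrightarrow> g = h"
  unfolding monic_def by (metis in_Hom)

lemma epic_cancel:
  "\<lbrakk>epic C f; g \<odot> f = h \<odot> f; g \<in> Mor C; h \<in> Mor C; tgt C g = tgt C h; src C g = tgt C f;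
    src C h = tgt C f\<rbrakk> \<Longrightarrow> g = h"
  unfolding epic_def by (metis in_Hom)

lemma monic_cmp:
  assumes "monic C f" "monic C g" "tgt C f = src C g"
  shows "monic C (g \<odot> f)"
  unfolding monic_def
proof (intro conjI allI ballI impI)
  fix W a b
  assume a: "a \<in> Hom C W (src C (g \<odot> f))" "b \<in> Hom C W (src C (g \<odot> f))"
    and eq: "(g \<odot> f) \<odot> a = (g \<odot> f) \<odot> b"
  have t: "a \<in> Mor C" "b \<in> Mor C" "src C a = W" "src C b = W" "tgt C a = src C f" "tgt C b = src C f"
    using a assms by (simp_all add: in_Hom)
  have "g \<odot> f \<odot> a = g \<odot> f \<odot> b" using eq assms t by (simp add: assoc)
  then have "f \<odot> a = f \<odot> b"
    by (rule monic_cancel[OF assms(2)]) (use assms t in simp_all)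
  then show "a = b"
    by (rule monic_cancel[OF assms(1)]) (use assms t in simp_all)
qed (use assms in simp)

lemma epic_cmp:
  assumes "epic C f" "epic C g" "tgt C f = src C g"
  shows "epic C (g \<odot> f)"
  unfolding epic_def
proof (intro conjI allI ballI impI)
  fix W a b
  assume a: "a \<in> Hom C (tgt C (g \<odot> f)) W" "b \<in> Hom C (tgt C (g \<odot> f)) W"
    and eq: "a \<odot> g \<odot> f = b \<odot> g \<odot> f"
  have t: "a \<in> Mor C" "b \<in> Mor C" "tgt C a = W" "tgt C b = W" "src C a = tgt C g" "src C b = tgt C g"
    using a assms by (simp_all add: in_Hom)
  have "(a \<odot> g) \<odot> f = (b \<odot> g) \<odot> f" using eq assms t by (simp add: assoc)
  then have "a \<odot> g = b \<odot> g"
    by (rule epic_cancel[OF assms(1)]) (use assms t in simp_all)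
  then show "a = b"
    by (rule epic_cancel[OF assms(2)]) (use assms t in simp_all)
qed (use assms in simp)

lemma monic_cmp_cancel:
  assumes "monic C (g \<odot> f)" "f \<in> Mor C" "g \<in> Mor C" "tgt C f = src C g"
  shows "monic C f"
  unfolding monic_def
proof (intro conjI allI ballI impI)
  fix W a b
  assume a: "a \<in> Hom C W (src C f)" "b \<in> Hom C W (src C f)" and "f \<odot> a = f \<odot> b"
  then have "(g \<odot> f) \<odot> a = (g \<odot> f) \<odot> b"
    using assms by (simp add: in_Hom assoc)
  then show "a = b"
    by (rule monic_cancel[OF assms(1)]) (use a assms in \<open>auto simp: in_Hom\<close>)
qed (use assms in simp)

lemma epic_cmp_cancel:
  assumes "epic C (g \<odot> f)" "f \<in> Mor C" "g \<in> Mor C" "tgt C f = src C g"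
  shows "epic C g"
  unfolding epic_def
proof (intro conjI allI ballI impI)
  fix W a b
  assume a: "a \<in> Hom C (tgt C g) W" "b \<in> Hom C (tgt C g) W" and "a \<odot> g = b \<odot> g"
  then have "a \<odot> (g \<odot> f) = b \<odot> (g \<odot> f)"
    using assms by (simp add: in_Hom assoc[symmetric])
  then show "a = b"
    by (rule epic_cancel[OF assms(1)]) (use a assms in \<open>auto simp: in_Hom\<close>)
qed (use assms in simp)

lemma isoE:
  assumes "is_iso C f"
  obtains g where "f \<in> Mor C" "g \<in> Mor C" "src C g = tgt C f" "tgt C g = src C f"
    "g \<odot> f = ident C (src C f)" "f \<odot> g = ident C (tgt C f)"
  using assms unfolding is_iso_def Hom_def by blast

lemma isoI:
  assumes "f \<in> Mor C" "g \<in> Mor C" "src C g = tgt C f" "tgt C g = src C f"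
    "g \<odot> f = ident C (src C f)" "f \<odot> g = ident C (tgt C f)"
  shows "is_iso C f"
proof -
  have "g \<in> Hom C (tgt C f) (src C f)" using assms by (simp add: in_Hom)
  then show ?thesis using assms unfolding is_iso_def by blast
qed

lemma ident_monic: "X \<in> Obj C \<Longrightarrow> monic C (ident C X)"
  unfolding monic_def by (auto simp: in_Hom)

lemma ident_epic: "X \<in> Obj C \<Longrightarrow> epic C (ident C X)"
  unfolding epic_def by (auto simp: in_Hom)

lemma iso_monic: assumes "is_iso C f" shows "monic C f"
proof -
  from assms obtain g where "f \<in> Mor C" "g \<in> Mor C" "src C g = tgt C f" "g \<odot> f = ident C (src C f)"
    by (rule isoE)
  then show ?thesis using monic_cmp_cancel[of g f] ident_monic by simp
qed

lemma iso_epic: assumes "is_iso C f" shows "epic C f"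
proof -
  from assms obtain g where "f \<in> Mor C" "g \<in> Mor C" "tgt C g = src C f" "f \<odot> g = ident C (tgt C f)"
    by (rule isoE)
  then show ?thesis using epic_cmp_cancel[of f g] ident_epic by simp
qed

lemma iso_cmp:
  assumes "is_iso C f" "is_iso C g" "tgt C f = src C g"
  shows "is_iso C (g \<odot> f)"
proof -
  from assms(1) obtain f' where f: "f \<in> Mor C" "f' \<in> Mor C" "src C f' = tgt C f" "tgt C f' = src C f"
    "f' \<odot> f = ident C (src C f)" "f \<odot> f' = ident C (tgt C f)" by (rule isoE)
  from assms(2) obtain g' where g: "g \<in> Mor C" "g' \<in> Mor C" "src C g' = tgt C g" "tgt C g' = src C g"
    "g' \<odot> g = ident C (src C g)" "g \<odot> g' = ident C (tgt C g)" by (rule isoE)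
  have "g' \<odot> g \<odot> f = f" "f \<odot> f' \<odot> g' = g'"
    using f g assms(3) by (simp_all flip: assoc)
  then show ?thesis
    by (intro isoI[of _ "f' \<odot> g'"]) (use f g assms(3) in \<open>simp_all add: assoc\<close>)
qed

lemma isomorphic_sym: assumes "isomorphic C X Y" shows "isomorphic C Y X"
proof -
  from assms obtain f where f: "f \<in> Hom C X Y" "is_iso C f" unfolding isomorphic_def by blast
  from f(2) obtain g where "f \<in> Mor C" "g \<in> Mor C" "src C g = tgt C f" "tgt C g = src C f"
    "g \<odot> f = ident C (src C f)" "f \<odot> g = ident C (tgt C f)" by (rule isoE)
  then show ?thesis unfolding isomorphic_def
    using f by (intro bexI[of _ g] isoI[of g f]) (auto simp: in_Hom)
qed

lemma isomorphic_trans: "isomorphic C X Y \<Longrightarrow> isomorphic C Y Z \<Longrightarrow> isomorphic C X Z"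
  unfolding isomorphic_def Bex_def in_Hom by (metis iso_cmp cmp_Mor)

lemma factors_throughI:
  assumes "h \<in> Mor C" "src C h = src C i" "tgt C h = src C j" "j \<odot> h = i"
  shows "factors_through C i j"
proof -
  have "h \<in> Hom C (src C i) (src C j)" using assms by (simp add: in_Hom)
  then show ?thesis using assms unfolding factors_through_def by blast
qed

lemma factors_throughE:
  assumes "factors_through C i j"
  obtains h where "h \<in> Mor C" "src C h = src C i" "tgt C h = src C j" "j \<odot> h = i"
  using assms unfolding factors_through_def Hom_def by blast

lemma factors_through_refl: "i \<in> Mor C \<Longrightarrow> factors_through C i i"
  by (rule factors_throughI[of "ident C (src C i)"]) simp_all

lemma factors_through_trans:
  assumes "factors_through C i j" "factors_through C j k" "k \<in> Mor C"
  shows "factors_through C i k"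
proof -
  from assms(1) obtain h where h: "h \<in> Mor C" "src C h = src C i" "tgt C h = src C j" "j \<odot> h = i"
    by (rule factors_throughE)
  from assms(2) obtain g where g: "g \<in> Mor C" "src C g = src C j" "tgt C g = src C k" "k \<odot> g = j"
    by (rule factors_throughE)
  have "k \<odot> (g \<odot> h) = i"
    using assoc[of h g k] h g assms(3) by simp
  then show ?thesis
    by (intro factors_throughI[of "g \<odot> h"]) (use h(1,2,3) g(1,2,3) in simp_all)
qed

lemma mutual_factor_iso:
  assumes "monic C i" "monic C j" "factors_through C j i"
    "h \<in> Mor C" "src C h = src C i" "tgt C h = src C j" "j \<odot> h = i"
  shows "is_iso C h"
proof -
  from assms(3) obtain g where g: "g \<in> Mor C" "src C g = src C j" "tgt C g = src C i" "i \<odot> g = j"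
    by (rule factors_throughE)
  have "i \<odot> (g \<odot> h) = i \<odot> ident C (src C i)"
    using assms g assoc[of h g i] by simp
  then have 1: "g \<odot> h = ident C (src C i)"
    by (rule monic_cancel[OF assms(1)]) (use assms(1,2,4,5,6) g(1,2,3) in simp_all)
  have "j \<odot> (h \<odot> g) = j \<odot> ident C (src C j)"
    using assms g assoc[of g h j] by simp
  then have "h \<odot> g = ident C (src C j)"
    by (rule monic_cancel[OF assms(2)]) (use assms(1,2,4,5,6) g(1,2,3) in simp_all)
  with 1 show ?thesis
    by (intro isoI[of h g]) (use assms(4-6) g in simp_all)
qed

text \<open>Two monomorphisms that factor through each other do so by mutually inverse isomorphisms, so
  membership in a subobject needs no mention of isomorphisms.\<close>

lemma mem_subobject:
  assumes "monic C i"
  shows "j \<in> subobject C i \<longleftrightarrow>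
    monic C j \<and> tgt C j = tgt C i \<and> factors_through C i j \<and> factors_through C j i"
proof
  assume "j \<in> subobject C i"
  then obtain h where j: "monic C j" "tgt C j = tgt C i" and h: "h \<in> Hom C (src C i) (src C j)"
    "is_iso C h" "j \<odot> h = i" unfolding subobject_def by blast
  from h(2) obtain g where g: "h \<in> Mor C" "g \<in> Mor C" "src C g = tgt C h" "tgt C g = src C h"
    "g \<odot> h = ident C (src C h)" "h \<odot> g = ident C (tgt C h)" by (rule isoE)
  have "i \<odot> g = j"
    using h g j assoc[of g h j] by (simp add: in_Hom)
  then have "factors_through C j i"
    by (intro factors_throughI[of g]) (use g h in \<open>simp_all add: in_Hom\<close>)
  moreover have "factors_through C i j" using h unfolding factors_through_def by blast
  ultimately show "monic C j \<and> tgt C j = tgt C i \<and> factors_through C i j \<and> factors_through C j i"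
    using j by blast
next
  assume j: "monic C j \<and> tgt C j = tgt C i \<and> factors_through C i j \<and> factors_through C j i"
  then obtain h where h: "h \<in> Mor C" "src C h = src C i" "tgt C h = src C j" "j \<odot> h = i"
    by (meson factors_throughE)
  have "is_iso C h" by (rule mutual_factor_iso[of i j]) (use j h assms in simp_all)
  moreover have "h \<in> Hom C (src C i) (src C j)" using h by (simp add: in_Hom)
  ultimately show "j \<in> subobject C i" unfolding subobject_def using j h by blast
qed

lemma subobject_self: "monic C i \<Longrightarrow> i \<in> subobject C i"
  by (simp add: mem_subobject factors_through_refl)

lemma subobject_eq_iff:
  assumes "monic C i" "monic C j" "tgt C i = tgt C j"
  shows "subobject C i = subobject C j \<longleftrightarrow> factors_through C i j \<and> factors_through C j i"
  by (rule iffI)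
    (use assms mem_subobject subobject_self in blast,
     use assms in \<open>auto simp: mem_subobject intro: factors_through_trans[OF _ _ monic_Mor]\<close>)

lemma subobjects_member:
  assumes "U \<in> subobjects C X" "i \<in> U"
  shows "monic C i" "tgt C i = X" "subobject C i = U"
proof -
  from assms obtain j where j: "monic C j" "tgt C j = X" "U = subobject C j" "i \<in> subobject C j"
    unfolding subobjects_def by blast
  then show "monic C i" "tgt C i = X" using mem_subobject[of j] by auto
  then show "subobject C i = U" using j mem_subobject[of j i] subobject_eq_iff[of i j] by auto
qed

lemma sub_le_iff:
  assumes "U \<in> subobjects C X" "V \<in> subobjects C X" "i \<in> U" "j \<in> V"
  shows "sub_le C U V \<longleftrightarrow> factors_through C i j"
proof
  assume "sub_le C U V"
  then obtain i' j' where ij: "i' \<in> U" "j' \<in> V" "factors_through C i' j'"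
    unfolding sub_le_def factors_through_def by blast
  have "factors_through C i i'" "factors_through C j' j"
    using assms ij subobjects_member mem_subobject by metis+
  then show "factors_through C i j"
    using assms ij subobjects_member factors_through_trans monic_Mor by meson
next
  assume "factors_through C i j"
  then show "sub_le C U V"
    unfolding sub_le_def factors_through_def using assms by blast
qed

end

section \<open>Kernels, cokernels and exactness\<close>

context abelian_category
begin

lemma zero_Mor [simp]:
  assumes "X \<in> Obj C" "Y \<in> Obj C"
  shows "zero_mor C X Y \<in> Mor C" "src C (zero_mor C X Y) = X" "tgt C (zero_mor C X Y) = Y"
proof -
  interpret comm_group "hom_group C X Y" by (rule hom_comm_group[OF assms])
  have "zero_mor C X Y \<in> Hom C X Y" using one_closed by (simp add: hom_group_def)
  then show "zero_mor C X Y \<in> Mor C" "src C (zero_mor C X Y) = X" "tgt C (zero_mor C X Y) = Y"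
    by (simp_all add: in_Hom)
qed

lemma add_zero_zero:
  assumes "X \<in> Obj C" "Y \<in> Obj C"
  shows "zero_mor C X Y \<boxplus> zero_mor C X Y = zero_mor C X Y"
proof -
  interpret comm_group "hom_group C X Y" by (rule hom_comm_group[OF assms])
  show ?thesis using l_one[OF one_closed] by (simp add: hom_group_def)
qed

lemma add_idem_zero:
  assumes "f \<in> Mor C" "f \<boxplus> f = f"
  shows "f = zero_mor C (src C f) (tgt C f)"
proof -
  interpret comm_group "hom_group C (src C f) (tgt C f)" by (rule hom_comm_group) (use assms in simp_all)
  have "f \<in> carrier (hom_group C (src C f) (tgt C f))"
    using assms by (simp add: hom_group_def in_Hom)
  then show ?thesis using l_cancel_one[of f f] assms(2) by (simp add: hom_group_def)
qed

lemma cmp_zero_right [simp]: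
  assumes "f \<in> Mor C" "src C f = Y" "X \<in> Obj C"
  shows "f \<odot> zero_mor C X Y = zero_mor C X (tgt C f)"
proof -
  have Y: "Y \<in> Obj C" using assms by auto
  let ?z = "f \<odot> zero_mor C X Y"
  have "?z \<boxplus> ?z = f \<odot> (zero_mor C X Y \<boxplus> zero_mor C X Y)"
    by (rule cmp_add_right[symmetric, of _ X Y]) (use assms Y in \<open>simp_all add: in_Hom\<close>)
  then have "?z \<boxplus> ?z = ?z" using add_zero_zero[OF assms(3) Y] by simp
  from add_idem_zero[OF _ this] show ?thesis using assms Y by simp
qed

lemma cmp_zero_left [simp]:
  assumes "f \<in> Mor C" "tgt C f = X" "Y \<in> Obj C"
  shows "zero_mor C X Y \<odot> f = zero_mor C (src C f) Y"
proof -
  have X: "X \<in> Obj C" using assms by auto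
  let ?z = "zero_mor C X Y \<odot> f"
  have "?z \<boxplus> ?z = (zero_mor C X Y \<boxplus> zero_mor C X Y) \<odot> f"
    by (rule cmp_add_left[symmetric, of _ "src C f" X _ Y]) (use assms X in \<open>simp_all add: in_Hom\<close>)
  then have "?z \<boxplus> ?z = ?z" using add_zero_zero[OF X assms(3)] by simp
  from add_idem_zero[OF _ this] show ?thesis using assms X by simp
qed

text \<open>Subtraction in the form needed for cancelling: a morphism equals \<open>h\<close> if adding \<open>- h\<close> to it gives zero.\<close>

lemma ex_negative:
  assumes "h \<in> Mor C"
  obtains h' where "h' \<in> Mor C" "src C h' = src C h" "tgt C h' = tgt C h"
    "\<And>g. \<lbrakk>g \<in> Mor C; src C g = src C h; tgt C g = tgt C h\<rbrakk> \<Longrightarrow>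
      g \<boxplus> h' = zero_mor C (src C h) (tgt C h) \<longleftrightarrow> g = h"
proof -
  let ?G = "hom_group C (src C h) (tgt C h)"
  interpret comm_group ?G by (rule hom_comm_group) (use assms in simp_all)
  have h: "h \<in> carrier ?G" using assms by (simp add: hom_group_def in_Hom)
  define h' where "h' = inv\<^bsub>?G\<^esub> h"
  have h': "h' \<in> carrier ?G" using h by (simp add: h'_def)
  show thesis
  proof (rule that[of h'])
    show "h' \<in> Mor C" "src C h' = src C h" "tgt C h' = tgt C h"
      using h' by (simp_all add: hom_group_def in_Hom)
    fix g assume "g \<in> Mor C" "src C g = src C h" "tgt C g = tgt C h"
    then have g: "g \<in> carrier ?G" by (simp add: hom_group_def in_Hom)
    have "g \<otimes>\<^bsub>?G\<^esub> h' = \<one>\<^bsub>?G\<^esub> \<longleftrightarrow> g = h"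
      unfolding h'_def using g h by (metis inv_closed inv_equality inv_inv r_inv)
    then show "g \<boxplus> h' = zero_mor C (src C h) (tgt C h) \<longleftrightarrow> g = h"
      by (simp add: hom_group_def)
  qed
qed

text \<open>\<open>f \<odot> g = f \<odot> h\<close> means \<open>f \<odot> (g - h) = 0\<close>; subtraction of morphisms is used only here
  and in the dual statement.\<close>

lemma monicI:
  assumes f: "f \<in> Mor C"
    and z: "\<And>g. \<lbrakk>g \<in> Mor C; tgt C g = src C f; f \<odot> g = zero_mor C (src C g) (tgt C f)\<rbrakk> \<Longrightarrow>
      g = zero_mor C (src C g) (src C f)"
  shows "monic C f"
  unfolding monic_def
proof (intro conjI allI ballI impI f)
  fix W g h
  assume gh: "g \<in> Hom C W (src C f)" "h \<in> Hom C W (src C f)" and eq: "f \<odot> g = f \<odot> h"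
  then have h: "h \<in> Mor C" by (simp add: in_Hom)
  from ex_negative[OF this] obtain h' where h': "h' \<in> Mor C" "src C h' = src C h" "tgt C h' = tgt C h"
    "\<And>g. \<lbrakk>g \<in> Mor C; src C g = src C h; tgt C g = tgt C h\<rbrakk> \<Longrightarrow>
      g \<boxplus> h' = zero_mor C (src C h) (tgt C h) \<longleftrightarrow> g = h" by blast
  have h'H: "h' \<in> Hom C W (src C f)" using h' gh by (simp add: in_Hom)
  have W: "W \<in> Obj C" using gh by (auto simp: in_Hom)
  have fH: "f \<in> Hom C (src C f) (tgt C f)" using f by (simp add: in_Hom)
  interpret comm_group "hom_group C W (src C f)" by (rule hom_comm_group) (use f W in simp_all)
  have sH: "g \<boxplus> h' \<in> Hom C W (src C f)"
    using m_closed[of g h'] gh h'H by (simp add: hom_group_def)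
  have "f \<odot> (g \<boxplus> h') = f \<odot> (h \<boxplus> h')"
    using cmp_add_right[OF gh(1) h'H fH] cmp_add_right[OF gh(2) h'H fH] eq by simp
  also have "h \<boxplus> h' = zero_mor C W (src C f)" using h'(4)[of h] gh h by (simp add: in_Hom)
  finally have "f \<odot> (g \<boxplus> h') = zero_mor C W (tgt C f)" using f W by simp
  then have "g \<boxplus> h' = zero_mor C W (src C f)"
    using z[of "g \<boxplus> h'"] sH by (simp add: in_Hom)
  then show "g = h" using h'(4)[of g] gh by (simp add: in_Hom)
qed

lemma epicI:
  assumes f: "f \<in> Mor C"
    and z: "\<And>g. \<lbrakk>g \<in> Mor C; src C g = tgt C f; g \<odot> f = zero_mor C (src C f) (tgt C g)\<rbrakk> \<Longrightarrow>
      g = zero_mor C (tgt C f) (tgt C g)"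
  shows "epic C f"
  unfolding epic_def
proof (intro conjI allI ballI impI f)
  fix W g h
  assume gh: "g \<in> Hom C (tgt C f) W" "h \<in> Hom C (tgt C f) W" and eq: "g \<odot> f = h \<odot> f"
  then have h: "h \<in> Mor C" by (simp add: in_Hom)
  from ex_negative[OF this] obtain h' where h': "h' \<in> Mor C" "src C h' = src C h" "tgt C h' = tgt C h"
    "\<And>g. \<lbrakk>g \<in> Mor C; src C g = src C h; tgt C g = tgt C h\<rbrakk> \<Longrightarrow>
      g \<boxplus> h' = zero_mor C (src C h) (tgt C h) \<longleftrightarrow> g = h" by blast
  have h'H: "h' \<in> Hom C (tgt C f) W" using h' gh by (simp add: in_Hom)
  have W: "W \<in> Obj C" using gh by (auto simp: in_Hom)
  have fH: "f \<in> Hom C (src C f) (tgt C f)" using f by (simp add: in_Hom)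
  interpret comm_group "hom_group C (tgt C f) W" by (rule hom_comm_group) (use f W in simp_all)
  have sH: "g \<boxplus> h' \<in> Hom C (tgt C f) W"
    using m_closed[of g h'] gh h'H by (simp add: hom_group_def)
  have "(g \<boxplus> h') \<odot> f = (h \<boxplus> h') \<odot> f"
    using cmp_add_left[OF fH gh(1) h'H] cmp_add_left[OF fH gh(2) h'H] eq by simp
  also have "h \<boxplus> h' = zero_mor C (tgt C f) W" using h'(4)[of h] gh h by (simp add: in_Hom)
  finally have "(g \<boxplus> h') \<odot> f = zero_mor C (src C f) W" using f W by simp
  then have "g \<boxplus> h' = zero_mor C (tgt C f) W"
    using z[of "g \<boxplus> h'"] sH by (simp add: in_Hom)
  then show "g = h" using h'(4)[of g] gh by (simp add: in_Hom)
qed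

lemma monic_zero:
  "\<lbrakk>monic C f; f \<odot> g = zero_mor C (src C g) (tgt C f); g \<in> Mor C; tgt C g = src C f\<rbrakk> \<Longrightarrow>
    g = zero_mor C (src C g) (src C f)"
  by (rule monic_cancel[of f]) simp_all

lemma epic_zero:
  "\<lbrakk>epic C f; g \<odot> f = zero_mor C (src C f) (tgt C g); g \<in> Mor C; src C g = tgt C f\<rbrakk> \<Longrightarrow>
    g = zero_mor C (tgt C f) (tgt C g)"
  by (rule epic_cancel[of f]) simp_all

lemma zero_objectI:
  assumes "Z \<in> Obj C" "ident C Z = zero_mor C Z Z"
  shows "zero_object C Z"
  unfolding zero_object_def
proof (intro conjI ballI assms(1))
  fix X assume X: "X \<in> Obj C"
  have "f = zero_mor C X Z" if "f \<in> Hom C X Z" for f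
    using ident_cmp(1)[of f Z] cmp_zero_left[of f Z Z] that assms by (simp add: in_Hom)
  then show "\<exists>!f. f \<in> Hom C X Z"
    using assms X by (intro ex1I[of _ "zero_mor C X Z"]) (simp_all add: in_Hom)
  have "f = zero_mor C Z X" if "f \<in> Hom C Z X" for f
    using ident_cmp(2)[of f Z] cmp_zero_right[of f Z Z] that assms by (simp add: in_Hom)
  then show "\<exists>!f. f \<in> Hom C Z X"
    using assms X by (intro ex1I[of _ "zero_mor C Z X"]) (simp_all add: in_Hom)
qed

lemma zero_object_Obj: "zero_object C Z \<Longrightarrow> Z \<in> Obj C"
  by (simp add: zero_object_def)

lemma to_zero_object:
  assumes "zero_object C Z" "f \<in> Mor C" "tgt C f = Z"
  shows "f = zero_mor C (src C f) Z"
proof -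
  have "\<exists>!g. g \<in> Hom C (src C f) Z" using assms unfolding zero_object_def by simp
  moreover have "f \<in> Hom C (src C f) Z" "zero_mor C (src C f) Z \<in> Hom C (src C f) Z"
    using assms zero_object_Obj by (simp_all add: in_Hom)
  ultimately show ?thesis by blast
qed

lemma from_zero_object:
  assumes "zero_object C Z" "f \<in> Mor C" "src C f = Z"
  shows "f = zero_mor C Z (tgt C f)"
proof -
  have "\<exists>!g. g \<in> Hom C Z (tgt C f)" using assms unfolding zero_object_def by simp
  moreover have "f \<in> Hom C Z (tgt C f)" "zero_mor C Z (tgt C f) \<in> Hom C Z (tgt C f)"
    using assms zero_object_Obj by (simp_all add: in_Hom)
  ultimately show ?thesis by blast
qed

lemma zero_object_monic: "\<lbrakk>zero_object C Z; f \<in> Mor C; src C f = Z\<rbrakk> \<Longrightarrow> monic C f"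
  by (rule monicI) (auto dest: to_zero_object)

lemma monic_zero_object:
  assumes "monic C f" "f = zero_mor C (src C f) (tgt C f)"
  shows "zero_object C (src C f)"
proof (rule zero_objectI)
  show "ident C (src C f) = zero_mor C (src C f) (src C f)"
    by (rule monic_zero[of f "ident C (src C f)", simplified]) (use assms in simp_all)
qed (use assms in simp)

lemma kernelD:
  assumes "is_kernel C f k"
  shows "f \<in> Mor C" "k \<in> Mor C" "tgt C k = src C f" "f \<odot> k = zero_mor C (src C k) (tgt C f)" "monic C k"
proof -
  show f: "f \<in> Mor C" "k \<in> Mor C" "tgt C k = src C f" "f \<odot> k = zero_mor C (src C k) (tgt C f)"
    using assms unfolding is_kernel_def by auto
  show "monic C k"
  proof (rule monicI[OF f(2)])
    fix g assume g: "g \<in> Mor C" "tgt C g = src C k" "k \<odot> g = zero_mor C (src C g) (tgt C k)"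
    have "\<exists>!u. u \<in> Hom C (src C g) (src C k) \<and> k \<odot> u = zero_mor C (src C g) (src C f)"
      using assms f g unfolding is_kernel_def by (simp add: in_Hom)
    moreover have "k \<odot> zero_mor C (src C g) (src C k) = zero_mor C (src C g) (src C f)"
      using f g by simp
    ultimately show "g = zero_mor C (src C g) (src C k)"
      using f g by (metis in_Hom src_tgt_Obj(1) zero_Mor)
  qed
qed

lemma kernel_factor:
  assumes "is_kernel C f k" "h \<in> Mor C" "tgt C h = src C f" "f \<odot> h = zero_mor C (src C h) (tgt C f)"
  obtains u where "u \<in> Mor C" "src C u = src C h" "tgt C u = src C k" "k \<odot> u = h"
  using assms unfolding is_kernel_def Hom_def by blast

lemma kernelI:
  assumes "f \<in> Mor C" "monic C k" "tgt C k = src C f" "f \<odot> k = zero_mor C (src C k) (tgt C f)"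
    and "\<And>h. \<lbrakk>h \<in> Mor C; tgt C h = src C f; f \<odot> h = zero_mor C (src C h) (tgt C f)\<rbrakk> \<Longrightarrow>
      factors_through C h k"
  shows "is_kernel C f k"
  unfolding is_kernel_def
proof (intro conjI allI ballI impI)
  fix W h assume h: "h \<in> Hom C W (src C f)" "f \<odot> h = zero_mor C W (tgt C f)"
  then have "factors_through C h k" using assms(5)[of h] by (auto simp: in_Hom)
  then obtain u where "u \<in> Mor C" "src C u = src C h" "tgt C u = src C k" "k \<odot> u = h"
    by (rule factors_throughE)
  then show "\<exists>!u. u \<in> Hom C W (src C k) \<and> k \<odot> u = h"
    using h assms(2) by (intro ex1I[of _ u]) (auto simp: in_Hom intro: monic_cancel[of k])
qed (use assms in simp_all)

lemma cokernelD:
  assumes "is_cokernel C f c"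
  shows "f \<in> Mor C" "c \<in> Mor C" "src C c = tgt C f" "c \<odot> f = zero_mor C (src C f) (tgt C c)" "epic C c"
proof -
  show f: "f \<in> Mor C" "c \<in> Mor C" "src C c = tgt C f" "c \<odot> f = zero_mor C (src C f) (tgt C c)"
    using assms unfolding is_cokernel_def by auto
  show "epic C c"
  proof (rule epicI[OF f(2)])
    fix g assume g: "g \<in> Mor C" "src C g = tgt C c" "g \<odot> c = zero_mor C (src C c) (tgt C g)"
    have "\<exists>!u. u \<in> Hom C (tgt C c) (tgt C g) \<and> u \<odot> c = zero_mor C (tgt C f) (tgt C g)"
      using assms f g unfolding is_cokernel_def by (simp add: in_Hom)
    moreover have "zero_mor C (tgt C c) (tgt C g) \<odot> c = zero_mor C (tgt C f) (tgt C g)"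
      using f g by simp
    ultimately show "g = zero_mor C (tgt C c) (tgt C g)"
      using f g by (metis in_Hom src_tgt_Obj(2) zero_Mor)
  qed
qed

lemma cokernel_factor:
  assumes "is_cokernel C f c" "h \<in> Mor C" "src C h = tgt C f" "h \<odot> f = zero_mor C (src C f) (tgt C h)"
  obtains u where "u \<in> Mor C" "src C u = tgt C c" "tgt C u = tgt C h" "u \<odot> c = h"
  using assms unfolding is_cokernel_def Hom_def by blast

lemma cokernelI:
  assumes "f \<in> Mor C" "epic C c" "src C c = tgt C f" "c \<odot> f = zero_mor C (src C f) (tgt C c)"
    and "\<And>h. \<lbrakk>h \<in> Mor C; src C h = tgt C f; h \<odot> f = zero_mor C (src C f) (tgt C h)\<rbrakk> \<Longrightarrow>
      \<exists>u \<in> Mor C. src C u = tgt C c \<and> tgt C u = tgt C h \<and> u \<odot> c = h"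
  shows "is_cokernel C f c"
  unfolding is_cokernel_def
proof (intro conjI allI ballI impI)
  fix W h assume h: "h \<in> Hom C (tgt C f) W" "h \<odot> f = zero_mor C (src C f) W"
  then obtain u where "u \<in> Mor C" "src C u = tgt C c" "tgt C u = tgt C h" "u \<odot> c = h"
    using assms(5)[of h] by (auto simp: in_Hom)
  then show "\<exists>!u. u \<in> Hom C (tgt C c) W \<and> u \<odot> c = h"
    using h assms(2) by (intro ex1I[of _ u]) (auto simp: in_Hom intro: epic_cancel[of c])
qed (use assms in simp_all)

text \<open>Normality presents \<open>m\<close> as a kernel of some \<open>g\<close>.  As \<open>g\<close> kills \<open>m\<close> it factors through the cokernel, so
  whatever the cokernel kills is killed by \<open>g\<close> and factors through \<open>m\<close>.\<close>

lemma monic_is_kernel_of_cokernel: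
  assumes "monic C m" "is_cokernel C m c"
  shows "is_kernel C c m"
proof -
  from monic_normal[OF assms(1)] obtain g where g: "is_kernel C g m" ..
  note G = kernelD[OF g] and K = cokernelD[OF assms(2)]
  obtain g' where g': "g' \<in> Mor C" "src C g' = tgt C c" "tgt C g' = tgt C g" "g' \<odot> c = g"
    by (rule cokernel_factor[OF assms(2), of g]) (use G in simp_all)
  show ?thesis
  proof (rule kernelI)
    fix h assume h: "h \<in> Mor C" "tgt C h = src C c" "c \<odot> h = zero_mor C (src C h) (tgt C c)"
    have "g \<odot> h = zero_mor C (src C h) (tgt C g)"
      using assoc[of h c g'] g' h K by simp
    then obtain u where "u \<in> Mor C" "src C u = src C h" "tgt C u = src C m" "m \<odot> u = h"
      by (rule kernel_factor[OF g, rotated 2]) (use h G K in simp_all)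
    then show "factors_through C h m" by (intro factors_throughI[of u]) simp_all
  qed (use K G in simp_all)
qed

lemma epic_is_cokernel_of_kernel:
  assumes "epic C e" "is_kernel C e k"
  shows "is_cokernel C k e"
proof -
  from epic_normal[OF assms(1)] obtain g where g: "is_cokernel C g e" ..
  note G = cokernelD[OF g] and K = kernelD[OF assms(2)]
  obtain g' where g': "g' \<in> Mor C" "src C g' = src C g" "tgt C g' = src C k" "k \<odot> g' = g"
    by (rule kernel_factor[OF assms(2), of g]) (use G in simp_all)
  show ?thesis
  proof (rule cokernelI)
    fix h assume h: "h \<in> Mor C" "src C h = tgt C k" "h \<odot> k = zero_mor C (src C k) (tgt C h)"
    have "h \<odot> g = zero_mor C (src C g) (tgt C h)"
      using assoc[of g' k h] g' h K by simp
    then obtain u where "u \<in> Mor C" "src C u = tgt C e" "tgt C u = tgt C h" "u \<odot> e = h"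
      by (rule cokernel_factor[OF g, rotated 2]) (use h G K in simp_all)
    then show "\<exists>u \<in> Mor C. src C u = tgt C e \<and> tgt C u = tgt C h \<and> u \<odot> e = h" by blast
  qed (use K G in simp_all)
qed

lemma epic_if_zero_cokernel:
  assumes "is_cokernel C f c" "c = zero_mor C (src C c) (tgt C c)"
  shows "epic C f"
proof (rule epicI)
  note K = cokernelD[OF assms(1)]
  fix g assume g: "g \<in> Mor C" "src C g = tgt C f" "g \<odot> f = zero_mor C (src C f) (tgt C g)"
  obtain u where "u \<in> Mor C" "src C u = tgt C c" "tgt C u = tgt C g" "u \<odot> c = g"
    by (rule cokernel_factor[OF assms(1), of g]) (use g in simp_all)
  then show "g = zero_mor C (tgt C f) (tgt C g)"
    using K assms(2) by (metis cmp_zero_right src_tgt_Obj(2))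
qed (use cokernelD[OF assms(1)] in simp)

lemma monic_epic_iso:
  assumes "monic C f" "epic C f"
  shows "is_iso C f"
proof -
  obtain c where c: "is_cokernel C f c" using ex_cokernel assms(1) by fastforce
  note K = cokernelD[OF c]
  have c0: "c = zero_mor C (tgt C f) (tgt C c)" by (rule epic_zero[of f]) (use assms K in simp_all)
  have "is_kernel C c f" by (rule monic_is_kernel_of_cokernel[OF assms(1) c])
  then obtain g where g: "g \<in> Mor C" "src C g = tgt C f" "tgt C g = src C f" "f \<odot> g = ident C (tgt C f)"
    by (rule kernel_factor[of c f "ident C (tgt C f)"]) (use K c0 in auto)
  show ?thesis
    by (rule mutual_factor_iso[of f "ident C (tgt C f)"])
      (use assms g in \<open>auto simp: ident_monic intro: factors_throughI[of g]\<close>)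
qed

text \<open>The first isomorphism theorem: a morphism induced on the quotient by its whole kernel is
  monic.  The image factorisation \<open>i \<odot> e\<close> has \<open>e\<close> epic with the same kernel \<open>k\<close>, so \<open>e\<close> is another
  cokernel of \<open>k\<close>, and \<open>m\<close> differs from the monomorphism \<open>i\<close> by an isomorphism only.\<close>

lemma coimage_monic:
  assumes c: "is_cokernel C k c" and m: "m \<in> Mor C" "src C m = tgt C c"
    and k: "is_kernel C (m \<odot> c) k"
  shows "monic C m"
proof -
  note Cc = cokernelD[OF c] and Kk = kernelD[OF k]
  let ?f = "m \<odot> c"
  obtain p where p: "is_cokernel C ?f p" using ex_cokernel Kk by blast
  note P = cokernelD[OF p]
  obtain i where i: "is_kernel C p i" using ex_kernel P by blast
  note Ki = kernelD[OF i]
  have ft: "src C ?f = src C c" "tgt C ?f = tgt C m" using m Cc by simp_all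
  obtain e where e: "e \<in> Mor C" "src C e = src C c" "tgt C e = src C i" "i \<odot> e = ?f"
    using kernel_factor[OF i, of ?f] P ft by (metis (no_types))
  \<comment> \<open>If \<open>g\<close> kills \<open>e\<close>, its kernel \<open>l\<close> makes the image smaller, unless \<open>g = 0\<close>.\<close>
  have "epic C e"
  proof (rule epicI[OF e(1)])
    fix g assume g: "g \<in> Mor C" "src C g = tgt C e" "g \<odot> e = zero_mor C (src C e) (tgt C g)"
    obtain l where l: "is_kernel C g l" using ex_kernel g by blast
    note Kl = kernelD[OF l]
    obtain e' where e': "e' \<in> Mor C" "src C e' = src C e" "tgt C e' = src C l" "l \<odot> e' = e"
      by (rule kernel_factor[OF l, of e]) (use g e in simp_all)
    \<comment> \<open>\<open>m \<odot> c\<close> factors through the smaller monomorphism \<open>i \<odot> l\<close>, hence so does its image \<open>i\<close>, and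
        \<open>l\<close> is split\<close>
    have il: "monic C (i \<odot> l)" by (rule monic_cmp) (use Ki Kl g e in simp_all)
    then obtain d where d: "is_cokernel C (i \<odot> l) d" using ex_cokernel by fastforce
    note D = cokernelD[OF d]
    have dk: "is_kernel C d (i \<odot> l)" by (rule monic_is_kernel_of_cokernel[OF il d])
    have ty: "tgt C l = src C i" "src C d = tgt C i" using Kl g e D Ki by simp_all
    have "d \<odot> ?f = (d \<odot> (i \<odot> l)) \<odot> e'"
      using e e' ty Ki Kl D(1-3) by (simp add: assoc)
    also have "\<dots> = zero_mor C (src C ?f) (tgt C d)"
      using D(1-4) e'(1-3) e(1-3) ty Kl Ki ft by simp
    finally have "d \<odot> ?f = zero_mor C (src C ?f) (tgt C d)" .
    then obtain d' where d': "d' \<in> Mor C" "src C d' = tgt C p" "tgt C d' = tgt C d" "d' \<odot> p = d"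
      by (rule cokernel_factor[OF p, of d, rotated 2]) (use D ty Ki P in simp_all)
    have "d \<odot> i = zero_mor C (src C i) (tgt C d)"
      using d' Ki P assoc[of i p d'] by simp
    then obtain u where u: "u \<in> Mor C" "src C u = src C i" "tgt C u = src C (i \<odot> l)" "(i \<odot> l) \<odot> u = i"
      by (rule kernel_factor[OF dk, of i, rotated 2]) (use ty Ki in simp_all)
    have "i \<odot> (l \<odot> u) = i \<odot> ident C (src C i)"
      using u ty Ki Kl by (simp add: assoc[symmetric])
    then have "l \<odot> u = ident C (src C i)"
      by (rule monic_cancel[OF Ki(5)]) (use u ty Ki Kl in simp_all)
    then have "g = g \<odot> (l \<odot> u)" using g e by simp
    also have "\<dots> = (g \<odot> l) \<odot> u"
      by (rule assoc[symmetric]) (use g u ty Ki Kl in simp_all)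
    also have "\<dots> = zero_mor C (tgt C e) (tgt C g)" using Kl g u e ty Ki by simp
    finally show "g = zero_mor C (tgt C e) (tgt C g)" .
  qed
  moreover have "is_kernel C e k"
  proof (rule kernelI[OF e(1) Kk(5)])
    have "i \<odot> (e \<odot> k) = zero_mor C (src C (e \<odot> k)) (tgt C i)"
      using e Kk ft Ki P by (simp add: assoc[symmetric])
    then have "e \<odot> k = zero_mor C (src C (e \<odot> k)) (src C i)"
      by (rule monic_zero[OF Ki(5)]) (use e Kk ft Ki in simp_all)
    then show "e \<odot> k = zero_mor C (src C k) (tgt C e)" using e Kk ft by simp
  next
    fix h assume h: "h \<in> Mor C" "tgt C h = src C e" "e \<odot> h = zero_mor C (src C h) (tgt C e)"
    have "?f \<odot> h = i \<odot> (e \<odot> h)" using e(4)[symmetric] e(1-3) h Ki by (simp add: assoc)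
    also have "\<dots> = zero_mor C (src C h) (tgt C ?f)"
      using h e Ki P ft by simp
    finally obtain u where "u \<in> Mor C" "src C u = src C h" "tgt C u = src C k" "k \<odot> u = h"
      by (rule kernel_factor[OF k, of h, rotated 2]) (use h e ft in simp_all)
    then show "factors_through C h k" by (intro factors_throughI[of u]) simp_all
  qed (use e Kk ft in simp)
  ultimately have ek: "is_cokernel C k e" by (rule epic_is_cokernel_of_kernel)
  note E = cokernelD[OF ek]
  \<comment> \<open>so \<open>m\<close> is \<open>i\<close> after the comparison of two cokernels of \<open>k\<close>\<close>
  obtain t where t: "t \<in> Mor C" "src C t = tgt C c" "tgt C t = tgt C e" "t \<odot> c = e"
    by (rule cokernel_factor[OF c, of e]) (use E in simp_all)
  obtain s where s: "s \<in> Mor C" "src C s = tgt C e" "tgt C s = tgt C c" "s \<odot> e = c"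
    by (rule cokernel_factor[OF ek, of c]) (use Cc in simp_all)
  have "(s \<odot> t) \<odot> c = ident C (tgt C c) \<odot> c" using s t Cc by (simp add: assoc)
  then have "s \<odot> t = ident C (tgt C c)"
    by (rule epic_cancel[OF Cc(5)]) (use s t Cc in simp_all)
  then have tm: "monic C t" using monic_cmp_cancel[of s t] s t Cc by (simp add: ident_monic)
  have "m \<odot> c = (i \<odot> t) \<odot> c" using e t Cc Ki by (simp add: assoc)
  then have "m = i \<odot> t"
    by (rule epic_cancel[OF Cc(5)]) (use m t e Cc Ki P ft in simp_all)
  then show ?thesis using monic_cmp[OF tm Ki(5)] t e by simp
qed

lemma cokernels_isomorphic:
  assumes "is_cokernel C f c" "is_cokernel C f d"
  obtains t where "t \<in> Mor C" "src C t = tgt C c" "tgt C t = tgt C d" "t \<odot> c = d" "is_iso C t"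
proof -
  note Cc = cokernelD[OF assms(1)] and D = cokernelD[OF assms(2)]
  obtain t where t: "t \<in> Mor C" "src C t = tgt C c" "tgt C t = tgt C d" "t \<odot> c = d"
    by (rule cokernel_factor[OF assms(1), of d]) (use D in simp_all)
  obtain s where s: "s \<in> Mor C" "src C s = tgt C d" "tgt C s = tgt C c" "s \<odot> d = c"
    by (rule cokernel_factor[OF assms(2), of c]) (use Cc in simp_all)
  have "(s \<odot> t) \<odot> c = ident C (tgt C c) \<odot> c" using s t Cc by (simp add: assoc)
  then have 1: "s \<odot> t = ident C (tgt C c)"
    by (rule epic_cancel[OF Cc(5)]) (use s t Cc in simp_all)
  have "(t \<odot> s) \<odot> d = ident C (tgt C d) \<odot> d" using s t D by (simp add: assoc)
  then have 2: "t \<odot> s = ident C (tgt C d)"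
    by (rule epic_cancel[OF D(5)]) (use s t D in simp_all)
  show thesis by (rule that[OF t]) (rule isoI[of t s], use s t 1 2 in simp_all)
qed

lemma cokernel_transport:
  assumes c: "is_cokernel C f' c"
    and a: "is_iso C a" "src C a = src C f" "tgt C a = src C f'"
    and b: "is_iso C b" "src C b = tgt C f" "tgt C b = tgt C f'"
    and f: "f \<in> Mor C" "b \<odot> f = f' \<odot> a"
  shows "is_cokernel C f (c \<odot> b)"
proof -
  note K = cokernelD[OF c]
  have aM: "a \<in> Mor C" using iso_monic[OF a(1)] by simp
  from b(1) obtain b' where b': "b \<in> Mor C" "b' \<in> Mor C" "src C b' = tgt C b" "tgt C b' = src C b"
    "b' \<odot> b = ident C (src C b)" "b \<odot> b' = ident C (tgt C b)" by (rule isoE)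
  show ?thesis
  proof (rule cokernelI)
    show "epic C (c \<odot> b)" by (rule epic_cmp) (use K b iso_epic in simp_all)
    have "(c \<odot> b) \<odot> f = (c \<odot> f') \<odot> a"
      using f K(1-3) a(2,3) aM b(2,3) b'(1) by (simp add: assoc)
    then show "(c \<odot> b) \<odot> f = zero_mor C (src C f) (tgt C (c \<odot> b))"
      using K a(2,3) aM b(3) b'(1) by simp
    fix h assume h: "h \<in> Mor C" "src C h = tgt C f" "h \<odot> f = zero_mor C (src C f) (tgt C h)"
    have "((h \<odot> b') \<odot> f') \<odot> a = (h \<odot> b') \<odot> b \<odot> f"
      using h(1,2) f a(2,3) aM b(2,3) b'(1-4) K(1) by (simp add: assoc)
    also have "\<dots> = h \<odot> (b' \<odot> b) \<odot> f"
      using h(1,2) f(1) b(2,3) b'(1-4) by (simp add: assoc)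
    also have "\<dots> = zero_mor C (src C a) (tgt C ((h \<odot> b') \<odot> f'))"
      using h f(1) a(2) b(2,3) b' K(1) by simp
    finally have "(h \<odot> b') \<odot> f' = zero_mor C (src C f') (tgt C (h \<odot> b'))"
      using epic_zero[OF iso_epic[OF a(1)], of "(h \<odot> b') \<odot> f'"] h(1,2) a(3) b(2,3) b'(1-4) K(1) by simp
    then obtain u where u: "u \<in> Mor C" "src C u = tgt C c" "tgt C u = tgt C (h \<odot> b')" "u \<odot> c = h \<odot> b'"
      by (rule cokernel_factor[OF c, rotated 2]) (use h(1,2) b(2,3) b'(1-4) in simp_all)
    have "u \<odot> (c \<odot> b) = (u \<odot> c) \<odot> b" by (rule assoc[symmetric]) (use u K b(3) b'(1) in simp_all)
    also have "\<dots> = h \<odot> (b' \<odot> b)" unfolding u(4) by (rule assoc) (use h(1,2) b(2,3) b'(1-4) in simp_all)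
    also have "\<dots> = h" using h(1,2) b(2,3) b' by simp
    finally show "\<exists>u \<in> Mor C. src C u = tgt C (c \<odot> b) \<and> tgt C u = tgt C h \<and> u \<odot> (c \<odot> b) = h"
      using u h(1,2) b(2,3) b'(1-4) K(2,3) by (intro bexI[of _ u]) simp_all
  qed (use f K b b' in simp_all)
qed

lemma cokernel_cmp_iso:
  assumes "is_cokernel C f c" "is_iso C t" "src C t = tgt C c"
  shows "is_cokernel C f (t \<odot> c)"
proof -
  note K = cokernelD[OF assms(1)]
  from assms(2) obtain s where s: "t \<in> Mor C" "s \<in> Mor C" "src C s = tgt C t" "tgt C s = src C t"
    "s \<odot> t = ident C (src C t)" "t \<odot> s = ident C (tgt C t)" by (rule isoE)
  have eq: "s \<odot> (t \<odot> c) = c" using s K assms(3) by (simp add: assoc[symmetric])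
  show ?thesis
  proof (rule cokernelI)
    show "epic C (t \<odot> c)" by (rule epic_cmp) (use K iso_epic assms in simp_all)
    fix h assume h: "h \<in> Mor C" "src C h = tgt C f" "h \<odot> f = zero_mor C (src C f) (tgt C h)"
    then obtain u where u: "u \<in> Mor C" "src C u = tgt C c" "tgt C u = tgt C h" "u \<odot> c = h"
      by (rule cokernel_factor[OF assms(1)])
    have "(u \<odot> s) \<odot> (t \<odot> c) = u \<odot> (s \<odot> (t \<odot> c))" using u s K assms(3) by (intro assoc) simp_all
    then have "(u \<odot> s) \<odot> (t \<odot> c) = h" using eq u by simp
    then show "\<exists>u \<in> Mor C. src C u = tgt C (t \<odot> c) \<and> tgt C u = tgt C h \<and> u \<odot> t \<odot> c = h"
      using u s K assms(3) by (intro bexI[of _ "u \<odot> s"]) simp_all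
  qed (use s K assms(3) in \<open>simp_all add: assoc\<close>)
qed

lemma zero_kernel:
  assumes "monic C f" "zero_object C Z"
  shows "is_kernel C f (zero_mor C Z (src C f))"
proof (rule kernelI)
  note Z = zero_object_Obj[OF assms(2)]
  show "monic C (zero_mor C Z (src C f))" using zero_object_monic[OF assms(2)] Z assms(1) by simp
  fix h assume h: "h \<in> Mor C" "tgt C h = src C f" "f \<odot> h = zero_mor C (src C h) (tgt C f)"
  then have "h = zero_mor C (src C h) (src C f)" using monic_zero assms(1) by blast
  then have "zero_mor C Z (src C f) \<odot> zero_mor C (src C h) Z = h" using h Z assms(1) by simp
  then show "factors_through C h (zero_mor C Z (src C f))"
    by (intro factors_throughI[of "zero_mor C (src C h) Z"]) (use h Z assms(1) in simp_all)
qed (use assms zero_object_Obj in simp_all)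

lemma zero_cokernel:
  assumes "epic C f" "zero_object C Z"
  shows "is_cokernel C f (zero_mor C (tgt C f) Z)"
proof (rule cokernelI)
  note Z = zero_object_Obj[OF assms(2)]
  show "epic C (zero_mor C (tgt C f) Z)"
    by (rule epicI) (use Z assms in \<open>auto dest: from_zero_object[OF assms(2)]\<close>)
  fix h assume h: "h \<in> Mor C" "src C h = tgt C f" "h \<odot> f = zero_mor C (src C f) (tgt C h)"
  then have "h = zero_mor C (tgt C f) (tgt C h)" using epic_zero assms(1) by blast
  then show "\<exists>u \<in> Mor C. src C u = tgt C (zero_mor C (tgt C f) Z) \<and> tgt C u = tgt C h \<and>
      u \<odot> zero_mor C (tgt C f) Z = h"
    by (intro bexI[of _ "zero_mor C Z (tgt C h)"]) (use h Z assms(1) in simp_all)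
qed (use assms zero_object_Obj in simp_all)

lemma kernel_of_zero:
  assumes "X \<in> Obj C" "Y \<in> Obj C"
  shows "is_kernel C (zero_mor C X Y) (ident C X)"
  by (rule kernelI) (use assms ident_monic in \<open>auto intro: factors_throughI\<close>)

lemma cokernel_of_zero:
  assumes "X \<in> Obj C" "Y \<in> Obj C"
  shows "is_cokernel C (zero_mor C X Y) (ident C Y)"
  by (rule cokernelI) (use assms ident_epic in auto)

text \<open>Exactness at the outer places says that \<open>f\<close> is monic and \<open>g\<close> is epic, exactness in the middle that \<open>f\<close> is
  a kernel of \<open>g\<close>; for a monic \<open>f\<close> and its cokernel all three hold.\<close>

lemma short_exactI:
  assumes "monic C f" "is_cokernel C f g"
  shows "short_exact C f g"
proof -
  note K = cokernelD[OF assms(2)]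
  obtain Z where Z: "zero_object C Z" using ex_zero_object by blast
  note ZO = zero_object_Obj[OF Z]
  have "exact_at C (zero_mor C Z (src C f)) f"
    unfolding exact_at_def is_image_def
    using zero_kernel[OF assms(1) Z] zero_kernel[OF ident_monic Z, of "src C f"] cokernel_of_zero[OF ZO, of "src C f"] K(1)
    by (intro exI[of _ "zero_mor C Z (src C f)"] conjI exI[of _ "ident C (src C f)"]) simp_all
  moreover have "is_kernel C g f" by (rule monic_is_kernel_of_cokernel[OF assms])
  then have "exact_at C f g" unfolding exact_at_def is_image_def using assms(2) by blast
  moreover have "exact_at C g (zero_mor C (tgt C g) Z)"
    unfolding exact_at_def is_image_def
    using zero_cokernel[OF K(5) Z] kernel_of_zero[OF _ ZO, of "tgt C g"] K(2) by auto
  ultimately show ?thesis unfolding short_exact_def using Z by blast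
qed

lemma short_exact_cokernel:
  assumes "short_exact C f g" "epic C g"
  shows "is_cokernel C f g"
proof -
  from assms(1) obtain j c where c: "is_cokernel C f c" "is_kernel C c j" "is_kernel C g j"
    unfolding short_exact_def exact_at_def is_image_def by blast
  have "is_cokernel C j c" "is_cokernel C j g"
    using epic_is_cokernel_of_kernel cokernelD(5)[OF c(1)] c assms(2) by blast+
  from cokernels_isomorphic[OF this] obtain t where t: "src C t = tgt C c" "t \<odot> c = g" "is_iso C t"
    by metis
  then show ?thesis using cokernel_cmp_iso[OF c(1) t(3,1)] by simp
qed

end

section \<open>The lattice of subobjects of a fixed object\<close>

text \<open>Choosing a representative \<open>rep U\<close> of each subobject turns the inclusion order into a functor: the
  morphism \<open>inc U V\<close> is unique, so composites of inclusions are inclusions.\<close>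

locale ambient_object = abelian_category C
  for C :: "('o, 'm, 'x) preadd_data_scheme" (structure) +
  fixes X :: 'o
  assumes X_Obj [simp]: "X \<in> Obj C"
begin

abbreviation L where "L \<equiv> subobjects C X"

abbreviation le (infix \<open>\<preceq>\<close> 50) where "U \<preceq> V \<equiv> sub_le C U V"

definition rep :: "'m set \<Rightarrow> 'm" where
  "rep U = (SOME i. i \<in> U)"

definition inc :: "'m set \<Rightarrow> 'm set \<Rightarrow> 'm" where
  "inc U V = (SOME h. h \<in> Mor C \<and> src C h = src C (rep U) \<and> tgt C h = src C (rep V) \<and> rep V \<odot> h = rep U)"

lemma subobject_in_L: "\<lbrakk>monic C i; tgt C i = X\<rbrakk> \<Longrightarrow> subobject C i \<in> L"
  unfolding subobjects_def by blast

lemma rep_in: assumes "U \<in> L" shows "rep U \<in> U"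
proof -
  from assms obtain i where "monic C i" "U = subobject C i" unfolding subobjects_def by blast
  then have "i \<in> U" by (simp add: subobject_self)
  then show ?thesis unfolding rep_def by (rule someI)
qed

lemma rep [simp]:
  assumes "U \<in> L"
  shows "monic C (rep U)" "rep U \<in> Mor C" "tgt C (rep U) = X"
  using subobjects_member(1,2)[OF assms rep_in[OF assms]] by simp_all

lemma member_factors:
  assumes "U \<in> L" "i \<in> U"
  shows "factors_through C i (rep U)" "factors_through C (rep U) i"
proof -
  note m = subobjects_member[OF assms] and r = rep_in[OF assms(1)]
  show "factors_through C i (rep U)" "factors_through C (rep U) i"
    using mem_subobject[OF m(1), of "rep U"] m r by simp_all
qed

lemma le_iff: "\<lbrakk>U \<in> L; V \<in> L\<rbrakk> \<Longrightarrow> U \<preceq> V \<longleftrightarrow> factors_through C (rep U) (rep V)"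
  by (intro sub_le_iff[of _ X] rep_in)

lemma le_refl [simp]: "U \<in> L \<Longrightarrow> U \<preceq> U"
  by (simp add: le_iff factors_through_refl)

lemma le_trans:
  assumes "U \<preceq> V" "V \<preceq> W" "U \<in> L" "V \<in> L" "W \<in> L"
  shows "U \<preceq> W"
proof -
  have "factors_through C (rep U) (rep V)" "factors_through C (rep V) (rep W)"
    using assms by (simp_all add: le_iff)
  then have "factors_through C (rep U) (rep W)"
    by (rule factors_through_trans) (rule rep(2)[OF assms(5)])
  then show ?thesis using assms by (simp add: le_iff)
qed

lemma le_antisym: assumes "U \<preceq> V" "V \<preceq> U" "U \<in> L" "V \<in> L" shows "U = V"
proof -
  have "subobject C (rep U) = subobject C (rep V)"
    by (subst subobject_eq_iff) (use assms in \<open>simp_all add: le_iff\<close>)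
  then show ?thesis using subobjects_member(3)[OF _ rep_in] assms by simp
qed

lemma inc [simp]:
  assumes "U \<in> L" "V \<in> L" "U \<preceq> V"
  shows "inc U V \<in> Mor C" "src C (inc U V) = src C (rep U)" "tgt C (inc U V) = src C (rep V)"
    "rep V \<odot> inc U V = rep U" "monic C (inc U V)"
proof -
  from assms have "factors_through C (rep U) (rep V)" by (simp add: le_iff)
  then obtain h where "h \<in> Mor C \<and> src C h = src C (rep U) \<and> tgt C h = src C (rep V) \<and> rep V \<odot> h = rep U"
    by (metis factors_throughE)
  from someI[of "\<lambda>h. h \<in> Mor C \<and> src C h = src C (rep U) \<and> tgt C h = src C (rep V) \<and> rep V \<odot> h = rep U", OF this]
  show i: "inc U V \<in> Mor C" "src C (inc U V) = src C (rep U)" "tgt C (inc U V) = src C (rep V)"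
    "rep V \<odot> inc U V = rep U" unfolding inc_def by simp_all
  show "monic C (inc U V)"
    by (rule monic_cmp_cancel[of "rep V"]) (use i assms in simp_all)
qed

lemma inc_unique:
  assumes "U \<in> L" "V \<in> L" "h \<in> Mor C" "src C h = src C (rep U)" "tgt C h = src C (rep V)"
    "rep V \<odot> h = rep U"
  shows "h = inc U V"
proof -
  have "factors_through C (rep U) (rep V)"
    by (rule factors_throughI[of h]) (use assms in simp_all)
  then have "U \<preceq> V" using assms(1,2) by (simp add: le_iff)
  from inc[OF assms(1,2) this] show ?thesis
    using assms(3-6) monic_cancel[OF rep(1)[OF assms(2)], of h "inc U V"] by presburger
qed

lemma inc_self: "U \<in> L \<Longrightarrow> inc U U = ident C (src C (rep U))"
  by (rule inc_unique[symmetric]) simp_all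

lemma inc_inc:
  assumes "U \<in> L" "V \<in> L" "W \<in> L" "U \<preceq> V" "V \<preceq> W"
  shows "inc V W \<odot> inc U V = inc U W"
proof (rule inc_unique)
  show "rep W \<odot> inc V W \<odot> inc U V = rep U"
    using assoc[of "inc U V" "inc V W" "rep W"] assms by simp
qed (use assms in simp_all)

lemma rep_subobject:
  assumes "monic C i" "tgt C i = X"
  shows "factors_through C h (rep (subobject C i)) \<longleftrightarrow> factors_through C h i"
proof -
  have i: "subobject C i \<in> L" by (rule subobject_in_L[OF assms])
  note f = member_factors[OF i subobject_self[OF assms(1)]]
  show ?thesis
    using factors_through_trans[OF _ f(1)] factors_through_trans[OF _ f(2)] i assms(1) by auto
qed

lemma le_if_factors: 
  "\<lbrakk>U \<in> L; V \<in> L; h \<in> Mor C; src C h = src C (rep U); tgt C h = src C (rep V); rep V \<odot> h = rep U\<rbrakk>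
    \<Longrightarrow> U \<preceq> V"
  using factors_throughI[of h "rep U" "rep V"] by (simp add: le_iff)

text \<open>An inclusion is monic, so if it is also epic it is invertible.\<close>

lemma epic_inc_eq:
  assumes "U \<in> L" "V \<in> L" "U \<preceq> V" "epic C (inc U V)"
  shows "U = V"
proof -
  have "is_iso C (inc U V)" by (rule monic_epic_iso) (use assms in simp_all)
  then obtain g where g: "g \<in> Mor C" "src C g = tgt C (inc U V)" "tgt C g = src C (inc U V)"
    "inc U V \<odot> g = ident C (tgt C (inc U V))" by (rule isoE)
  have "rep U \<odot> g = (rep V \<odot> inc U V) \<odot> g" using assms by simp
  also have "\<dots> = rep V \<odot> (inc U V \<odot> g)"
    by (rule assoc) (use g assms in simp_all)
  also have "\<dots> = rep V" using g assms by simp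
  finally have "rep U \<odot> g = rep V" .
  then have "V \<preceq> U" by (intro le_if_factors[of V U g]) (use g assms in simp_all)
  then show ?thesis using assms le_antisym by blast
qed

text \<open>Kernels of morphisms out of \<open>X\<close>, as subobjects; joins are obtained this way.\<close>

lemma ex_zero_locus:
  assumes "f \<in> Mor C" "src C f = X"
  shows "\<exists>W \<in> L. \<forall>h \<in> Mor C. tgt C h = X \<longrightarrow>
    (factors_through C h (rep W) \<longleftrightarrow> f \<odot> h = zero_mor C (src C h) (tgt C f))"
proof -
  obtain k where k: "is_kernel C f k" using ex_kernel assms by blast
  note K = kernelD[OF k]
  have kX: "tgt C k = X" using K assms by simp
  show ?thesis
  proof (intro bexI[of _ "subobject C k"] ballI impI)
    fix h assume h: "h \<in> Mor C" "tgt C h = X"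
    have "factors_through C h k \<longleftrightarrow> f \<odot> h = zero_mor C (src C h) (tgt C f)"
    proof
      assume "factors_through C h k"
      then obtain u where u: "u \<in> Mor C" "src C u = src C h" "tgt C u = src C k" "k \<odot> u = h"
        by (rule factors_throughE)
      then show "f \<odot> h = zero_mor C (src C h) (tgt C f)" using assoc[of u k f] K by simp
    next
      assume "f \<odot> h = zero_mor C (src C h) (tgt C f)"
      then obtain u where "u \<in> Mor C" "src C u = src C h" "tgt C u = src C k" "k \<odot> u = h"
        by (rule kernel_factor[OF k, rotated 2]) (use h assms in simp_all)
      then show "factors_through C h k" by (intro factors_throughI[of u]) simp_all
    qed
    then show "factors_through C h (rep (subobject C k)) \<longleftrightarrow> f \<odot> h = zero_mor C (src C h) (tgt C f)"
      by (simp add: rep_subobject[OF K(5) kX])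
  qed (use K kX subobject_in_L in blast)
qed

lemma cokernel_locus:
  assumes "W \<in> L" "is_cokernel C (rep W) c" "h \<in> Mor C" "tgt C h = X"
  shows "factors_through C h (rep W) \<longleftrightarrow> c \<odot> h = zero_mor C (src C h) (tgt C c)"
proof
  note K = cokernelD[OF assms(2)]
  assume "factors_through C h (rep W)"
  then obtain u where u: "u \<in> Mor C" "src C u = src C h" "tgt C u = src C (rep W)" "rep W \<odot> u = h"
    by (rule factors_throughE)
  then show "c \<odot> h = zero_mor C (src C h) (tgt C c)" using assoc[of u "rep W" c] K assms(1) by simp
next
  note K = cokernelD[OF assms(2)]
  have k: "is_kernel C c (rep W)" by (rule monic_is_kernel_of_cokernel) (use assms in simp_all)
  assume "c \<odot> h = zero_mor C (src C h) (tgt C c)"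
  then obtain u where "u \<in> Mor C" "src C u = src C h" "tgt C u = src C (rep W)" "rep W \<odot> u = h"
    by (rule kernel_factor[OF k, rotated 2]) (use assms K in simp_all)
  then show "factors_through C h (rep W)" by (intro factors_throughI[of u]) simp_all
qed

text \<open>The universal property of the intersection refers to all morphisms into \<open>X\<close> and not only to
  subobjects; the second isomorphism theorem applies it to an arbitrary morphism killed by
  \<open>U \<rightarrow> (U + V) / V\<close>.\<close>

definition meet :: "'m set \<Rightarrow> 'm set \<Rightarrow> 'm set"  (infixl \<open>\<curlywedge>\<close> 70) where
  "U \<curlywedge> V = (SOME W. W \<in> L \<and> (\<forall>h \<in> Mor C. tgt C h = X \<longrightarrow>
    (factors_through C h (rep W) \<longleftrightarrow> factors_through C h (rep U) \<and> factors_through C h (rep V))))"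

definition join :: "'m set \<Rightarrow> 'm set \<Rightarrow> 'm set"  (infixl \<open>\<curlyvee>\<close> 65) where
  "U \<curlyvee> V = (SOME W. W \<in> L \<and> U \<preceq> W \<and> V \<preceq> W \<and> (\<forall>N \<in> L. U \<preceq> N \<longrightarrow> V \<preceq> N \<longrightarrow> W \<preceq> N))"

lemma meet_factors:
  assumes "U \<in> L" "V \<in> L"
  shows "U \<curlywedge> V \<in> L"
    and "\<lbrakk>h \<in> Mor C; tgt C h = X\<rbrakk> \<Longrightarrow>
      factors_through C h (rep (U \<curlywedge> V)) \<longleftrightarrow> factors_through C h (rep U) \<and> factors_through C h (rep V)"
proof -
  obtain c where c: "is_cokernel C (rep V) c" using ex_cokernel assms by fastforce
  note K = cokernelD[OF c]
  have f: "c \<odot> rep U \<in> Mor C" "src C (c \<odot> rep U) = src C (rep U)" "tgt C (c \<odot> rep U) = tgt C c"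
    using K assms by simp_all
  \<comment> \<open>the intersection is the kernel of \<open>U \<rightarrow> X \<rightarrow> X / V\<close>\<close>
  obtain k where k: "is_kernel C (c \<odot> rep U) k" using ex_kernel f by blast
  note Kk = kernelD[OF k]
  have m: "monic C (rep U \<odot> k)" "tgt C (rep U \<odot> k) = X" "tgt C k = src C (rep U)"
    using monic_cmp[of k "rep U"] Kk f assms by simp_all
  have "factors_through C h (rep U \<odot> k) \<longleftrightarrow> factors_through C h (rep U) \<and> factors_through C h (rep V)"
    if h: "h \<in> Mor C" "tgt C h = X" for h
  proof
    assume "factors_through C h (rep U \<odot> k)"
    then obtain u where u: "u \<in> Mor C" "src C u = src C h" "tgt C u = src C (rep U \<odot> k)" "(rep U \<odot> k) \<odot> u = h"
      by (rule factors_throughE)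
    have eq: "rep U \<odot> (k \<odot> u) = h" using u assoc[of u k "rep U"] m Kk assms by simp
    then have 1: "factors_through C h (rep U)"
      by (intro factors_throughI[of "k \<odot> u"]) (use u Kk m assms in simp_all)
    have "c \<odot> h = ((c \<odot> rep U) \<odot> k) \<odot> u"
      unfolding eq[symmetric] using u Kk(1-3) m K assms by (simp add: assoc)
    also have "\<dots> = zero_mor C (src C h) (tgt C c)"
      using Kk f u m assms K by simp
    finally have "factors_through C h (rep V)" using cokernel_locus[OF assms(2) c h] by simp
    with 1 show "factors_through C h (rep U) \<and> factors_through C h (rep V)" ..
  next
    assume uv: "factors_through C h (rep U) \<and> factors_through C h (rep V)"
    then obtain u where u: "u \<in> Mor C" "src C u = src C h" "tgt C u = src C (rep U)" "rep U \<odot> u = h"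
      by (meson factors_throughE)
    have "(c \<odot> rep U) \<odot> u = zero_mor C (src C u) (tgt C (c \<odot> rep U))"
      using uv cokernel_locus[OF assms(2) c h] u K assms f assoc[of u "rep U" c] by simp
    then obtain w where w: "w \<in> Mor C" "src C w = src C u" "tgt C w = src C k" "k \<odot> w = u"
      by (rule kernel_factor[OF k, rotated 2]) (use u f in simp_all)
    have "(rep U \<odot> k) \<odot> w = h" using u w assoc[of w k "rep U"] m Kk assms by simp
    then show "factors_through C h (rep U \<odot> k)"
      by (intro factors_throughI[of w]) (use w u Kk m assms in simp_all)
  qed
  then have "\<exists>W. W \<in> L \<and> (\<forall>h \<in> Mor C. tgt C h = X \<longrightarrow>
    (factors_through C h (rep W) \<longleftrightarrow> factors_through C h (rep U) \<and> factors_through C h (rep V)))"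
    using rep_subobject[OF m(1,2)] subobject_in_L[OF m(1,2)]
    by (intro exI[of _ "subobject C (rep U \<odot> k)"]) simp
  from someI_ex[OF this]
  show "U \<curlywedge> V \<in> L"
    and "\<lbrakk>h \<in> Mor C; tgt C h = X\<rbrakk> \<Longrightarrow>
      factors_through C h (rep (U \<curlywedge> V)) \<longleftrightarrow> factors_through C h (rep U) \<and> factors_through C h (rep V)"
    unfolding meet_def by blast+
qed

lemma le_meet_iff: "\<lbrakk>U \<in> L; V \<in> L; W \<in> L\<rbrakk> \<Longrightarrow> W \<preceq> U \<curlywedge> V \<longleftrightarrow> W \<preceq> U \<and> W \<preceq> V"
  using meet_factors[of U V] by (simp add: le_iff)

lemma join_exists:
  assumes "U \<in> L" "V \<in> L"
  shows "U \<curlyvee> V \<in> L" "U \<preceq> U \<curlyvee> V" "V \<preceq> U \<curlyvee> V"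
    "\<And>N. \<lbrakk>N \<in> L; U \<preceq> N; V \<preceq> N\<rbrakk> \<Longrightarrow> U \<curlyvee> V \<preceq> N"
proof -
  obtain c where c: "is_cokernel C (rep U) c" using ex_cokernel assms by fastforce
  note Kc = cokernelD[OF c]
  have f: "c \<odot> rep V \<in> Mor C" "tgt C (c \<odot> rep V) = tgt C c" "src C (c \<odot> rep V) = src C (rep V)"
    using Kc assms by simp_all
  \<comment> \<open>the sum is the kernel of \<open>X \<rightarrow> X / U \<rightarrow> D\<close>, where \<open>D\<close> is the cokernel of \<open>V \<rightarrow> X / U\<close>\<close>
  obtain d where d: "is_cokernel C (c \<odot> rep V) d" using ex_cokernel f by blast
  note Kd = cokernelD[OF d]
  have dc: "d \<odot> c \<in> Mor C" "src C (d \<odot> c) = X" "tgt C (d \<odot> c) = tgt C d"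
    using Kd Kc f assms by simp_all
  obtain W where W: "W \<in> L" and Wl: "\<forall>h \<in> Mor C. tgt C h = X \<longrightarrow>
    (factors_through C h (rep W) \<longleftrightarrow> (d \<odot> c) \<odot> h = zero_mor C (src C h) (tgt C (d \<odot> c)))"
    using ex_zero_locus[OF dc(1,2)] by blast
  have "(d \<odot> c) \<odot> rep U = d \<odot> c \<odot> rep U" by (rule assoc) (use Kc Kd f assms in simp_all)
  then have 1: "U \<preceq> W" using Wl W Kc Kd f assms by (simp add: le_iff)
  have "(d \<odot> c) \<odot> rep V = d \<odot> c \<odot> rep V" by (rule assoc) (use Kc Kd f assms in simp_all)
  then have 2: "V \<preceq> W" using Wl W Kc Kd f assms by (simp add: le_iff)
  have 3: "W \<preceq> N" if N: "N \<in> L" "U \<preceq> N" "V \<preceq> N" for N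
  proof -
    obtain e where e: "is_cokernel C (rep N) e" using ex_cokernel N by fastforce
    note Ke = cokernelD[OF e]
    have eU: "e \<odot> rep U = zero_mor C (src C (rep U)) (tgt C e)"
      and eV: "e \<odot> rep V = zero_mor C (src C (rep V)) (tgt C e)"
      using cokernel_locus[OF N(1) e] N assms by (simp_all add: le_iff)
    obtain e' where e': "e' \<in> Mor C" "src C e' = tgt C c" "tgt C e' = tgt C e" "e' \<odot> c = e"
      by (rule cokernel_factor[OF c, of e]) (use Ke N assms eU in simp_all)
    have "e' \<odot> (c \<odot> rep V) = zero_mor C (src C (c \<odot> rep V)) (tgt C e')"
      using assoc[of "rep V" c e'] e' Kc f assms eV by simp
    then obtain e'' where e'': "e'' \<in> Mor C" "src C e'' = tgt C d" "tgt C e'' = tgt C e'" "e'' \<odot> d = e'"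
      by (rule cokernel_factor[OF d, rotated 2]) (use e' f in simp_all)
    have eq: "e = e'' \<odot> d \<odot> c" using assoc[of c d e''] e' e'' Kc Kd f by simp
    have "e \<odot> rep W = e'' \<odot> ((d \<odot> c) \<odot> rep W)"
      unfolding eq by (rule assoc) (use W dc e'' in simp_all)
    also have "(d \<odot> c) \<odot> rep W = zero_mor C (src C (rep W)) (tgt C d)"
      using Wl[rule_format, of "rep W"] W dc factors_through_refl[of "rep W"] by simp
    finally have "e \<odot> rep W = zero_mor C (src C (rep W)) (tgt C e)"
      using e'' e' W by simp
    then show ?thesis using cokernel_locus[OF N(1) e, of "rep W"] W N by (simp add: le_iff)
  qed
  from 1 2 3 W have "\<exists>W. W \<in> L \<and> U \<preceq> W \<and> V \<preceq> W \<and> (\<forall>N \<in> L. U \<preceq> N \<longrightarrow> V \<preceq> N \<longrightarrow> W \<preceq> N)"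
    by blast
  from someI_ex[OF this]
  show "U \<curlyvee> V \<in> L" "U \<preceq> U \<curlyvee> V" "V \<preceq> U \<curlyvee> V"
    "\<And>N. \<lbrakk>N \<in> L; U \<preceq> N; V \<preceq> N\<rbrakk> \<Longrightarrow> U \<curlyvee> V \<preceq> N"
    unfolding join_def by blast+
qed

lemma join_le_iff:
  assumes "U \<in> L" "V \<in> L" "W \<in> L"
  shows "U \<curlyvee> V \<preceq> W \<longleftrightarrow> U \<preceq> W \<and> V \<preceq> W"
  using join_exists[OF assms(1,2)] assms le_trans by blast

lemma meet_join_closed [simp]: "\<lbrakk>U \<in> L; V \<in> L\<rbrakk> \<Longrightarrow> U \<curlywedge> V \<in> L" "\<lbrakk>U \<in> L; V \<in> L\<rbrakk> \<Longrightarrow> U \<curlyvee> V \<in> L"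
  using meet_factors(1) join_exists(1) by auto

lemma meet_le [simp]: "\<lbrakk>U \<in> L; V \<in> L\<rbrakk> \<Longrightarrow> U \<curlywedge> V \<preceq> U" "\<lbrakk>U \<in> L; V \<in> L\<rbrakk> \<Longrightarrow> U \<curlywedge> V \<preceq> V"
  using le_meet_iff[of U V "U \<curlywedge> V"] by simp_all

lemma le_join [simp]: "\<lbrakk>U \<in> L; V \<in> L\<rbrakk> \<Longrightarrow> U \<preceq> U \<curlyvee> V" "\<lbrakk>U \<in> L; V \<in> L\<rbrakk> \<Longrightarrow> V \<preceq> U \<curlyvee> V"
  using join_exists by auto

text \<open>\<open>U\<close> and \<open>V\<close> are jointly epic in their join, because the kernel of \<open>f\<close> is a subobject above both.\<close>

lemma zero_on_join:
  assumes "U \<in> L" "V \<in> L" "f \<in> Mor C" "src C f = src C (rep (U \<curlyvee> V))"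
    and zU: "f \<odot> inc U (U \<curlyvee> V) = zero_mor C (src C (rep U)) (tgt C f)"
    and zV: "f \<odot> inc V (U \<curlyvee> V) = zero_mor C (src C (rep V)) (tgt C f)"
  shows "f = zero_mor C (src C f) (tgt C f)"
proof -
  let ?W = "U \<curlyvee> V"
  have W: "?W \<in> L" using assms by simp
  obtain k where k: "is_kernel C f k" using ex_kernel assms by blast
  note K = kernelD[OF k]
  have m: "monic C (rep ?W \<odot> k)" "tgt C (rep ?W \<odot> k) = X" "src C (rep ?W \<odot> k) = src C k"
    using monic_cmp[of k "rep ?W"] K assms W by simp_all
  let ?N = "subobject C (rep ?W \<odot> k)"
  have N: "?N \<in> L" by (rule subobject_in_L[OF m(1,2)])
  have le: "A \<preceq> ?N" if A: "A \<in> L" "A \<preceq> ?W"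
    "f \<odot> inc A ?W = zero_mor C (src C (rep A)) (tgt C f)" for A
  proof -
    obtain u where u: "u \<in> Mor C" "src C u = src C (inc A ?W)" "tgt C u = src C k" "k \<odot> u = inc A ?W"
      by (rule kernel_factor[OF k, of "inc A ?W"]) (use A assms W in simp_all)
    have "(rep ?W \<odot> k) \<odot> u = rep A"
      using assoc[of u k "rep ?W"] u K A W assms by simp
    then have "factors_through C (rep A) (rep ?W \<odot> k)"
      by (intro factors_throughI[of u]) (use u A W m in simp_all)
    then show ?thesis using A N rep_subobject[OF m(1,2)] by (simp add: le_iff)
  qed
  have "?W \<preceq> ?N" using le[of U] le[of V] assms N join_exists(4) by simp
  then have "factors_through C (rep ?W) (rep ?W \<odot> k)"
    using W N rep_subobject[OF m(1,2)] by (simp add: le_iff)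
  then obtain u where u: "u \<in> Mor C" "src C u = src C (rep ?W)" "tgt C u = src C (rep ?W \<odot> k)"
    "(rep ?W \<odot> k) \<odot> u = rep ?W" by (rule factors_throughE)
  have "rep ?W \<odot> (k \<odot> u) = rep ?W \<odot> ident C (src C (rep ?W))"
    using u assoc[of u k "rep ?W"] K W m assms by simp
  then have "k \<odot> u = ident C (src C (rep ?W))"
    by (rule monic_cancel[OF rep(1)[OF W]]) (use u K W m assms in simp_all)
  then have "f = f \<odot> (k \<odot> u)" using assms by simp
  also have "\<dots> = (f \<odot> k) \<odot> u" by (rule assoc[symmetric]) (use u K m assms in simp_all)
  also have "\<dots> = zero_mor C (src C f) (tgt C f)" using K u m assms by simp
  finally show ?thesis .
qed

lemma kernel_of_cokernel_inc:
  assumes "U \<in> L" "V \<in> L" "U \<preceq> V" "is_cokernel C (inc U V) c"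
  shows "is_kernel C c (inc U V)"
  by (rule monic_is_kernel_of_cokernel) (use assms in simp_all)

text \<open>The composite \<open>U \<rightarrow> U + V \<rightarrow> (U + V) / V\<close> is epic since \<open>U\<close> and \<open>V\<close> together generate, and its kernel
  is the part of \<open>U\<close> lying in \<open>V\<close>.  An epimorphism is the cokernel of its kernel, so the target
  of \<open>c\<close> serves literally as the quotient \<open>U / (U \<inter> V)\<close>, with no isomorphism to carry along.\<close>

lemma second_isomorphism:
  assumes UV: "U \<in> L" "V \<in> L" and c: "is_cokernel C (inc V (U \<curlyvee> V)) c"
  shows "is_cokernel C (inc (U \<curlywedge> V) U) (c \<odot> inc U (U \<curlyvee> V))"
proof -
  let ?W = "U \<curlyvee> V" and ?D = "U \<curlywedge> V"
  note K = cokernelD[OF c]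
  have W: "?W \<in> L" "?D \<in> L" "U \<preceq> ?W" "V \<preceq> ?W" "?D \<preceq> U" "?D \<preceq> V" using UV by simp_all
  have ck: "is_kernel C c (inc V ?W)" by (rule kernel_of_cokernel_inc) (use UV W c in simp_all)
  have sc: "src C c = src C (rep ?W)" using K W UV by simp
  have e: "c \<odot> inc U ?W \<in> Mor C" "src C (c \<odot> inc U ?W) = src C (rep U)" "tgt C (c \<odot> inc U ?W) = tgt C c"
    using K W UV sc by simp_all
  have DW: "?D \<preceq> ?W" using W UV le_trans by blast
  have "(c \<odot> inc U ?W) \<odot> inc ?D U = (c \<odot> inc V ?W) \<odot> inc ?D V"
    using assoc[of "inc ?D U" "inc U ?W" c] assoc[of "inc ?D V" "inc V ?W" c] K(2) sc W UV
    by (simp add: inc_inc)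
  then have z: "(c \<odot> inc U ?W) \<odot> inc ?D U = zero_mor C (src C (rep ?D)) (tgt C c)"
    using K W UV by simp
  have ker: "is_kernel C (c \<odot> inc U ?W) (inc ?D U)"
  proof (rule kernelI)
    fix h assume h: "h \<in> Mor C" "tgt C h = src C (c \<odot> inc U ?W)"
      "(c \<odot> inc U ?W) \<odot> h = zero_mor C (src C h) (tgt C (c \<odot> inc U ?W))"
    have "c \<odot> (inc U ?W \<odot> h) = zero_mor C (src C (inc U ?W \<odot> h)) (tgt C c)"
      using h e assoc[of h "inc U ?W" c] K(2) sc W UV by simp
    then obtain u where u: "u \<in> Mor C" "src C u = src C (inc U ?W \<odot> h)" "tgt C u = src C (inc V ?W)"
      "inc V ?W \<odot> u = inc U ?W \<odot> h"
      by (rule kernel_factor[OF ck, rotated 2]) (use h e K(2) sc W UV in simp_all)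
    have "rep V \<odot> u = rep ?W \<odot> (inc V ?W \<odot> u)"
      using assoc[of u "inc V ?W" "rep ?W"] u W UV by simp
    also have "\<dots> = rep U \<odot> h"
      using assoc[of h "inc U ?W" "rep ?W"] u(4) h e W UV by simp
    finally have "factors_through C (rep U \<odot> h) (rep V)"
      by (intro factors_throughI[of u]) (use u h e W UV in simp_all)
    moreover have "factors_through C (rep U \<odot> h) (rep U)"
      by (intro factors_throughI[of h]) (use h e UV in simp_all)
    ultimately have "factors_through C (rep U \<odot> h) (rep ?D)"
      using meet_factors(2)[OF UV, of "rep U \<odot> h"] h e UV by simp
    then obtain w where w: "w \<in> Mor C" "src C w = src C (rep U \<odot> h)" "tgt C w = src C (rep ?D)"
      "rep ?D \<odot> w = rep U \<odot> h" by (rule factors_throughE)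
    have "rep U \<odot> (inc ?D U \<odot> w) = rep U \<odot> h"
      using assoc[of w "inc ?D U" "rep U"] w h e W UV by simp
    then have "inc ?D U \<odot> w = h"
      by (rule monic_cancel[OF rep(1)[OF UV(1)]]) (use w h e W UV in simp_all)
    then show "factors_through C h (inc ?D U)"
      by (intro factors_throughI[of w]) (use w h e W UV in simp_all)
  qed (use W UV e z in simp_all)
  have "epic C (c \<odot> inc U ?W)"
  proof (rule epicI)
    fix g assume g: "g \<in> Mor C" "src C g = tgt C (c \<odot> inc U ?W)"
      "g \<odot> c \<odot> inc U ?W = zero_mor C (src C (c \<odot> inc U ?W)) (tgt C g)"
    have "g \<odot> c = zero_mor C (src C (g \<odot> c)) (tgt C (g \<odot> c))"
    proof (rule zero_on_join[OF UV])
      show "(g \<odot> c) \<odot> inc U ?W = zero_mor C (src C (rep U)) (tgt C (g \<odot> c))"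
        using g e assoc[of "inc U ?W" c g] K(2) sc W UV by simp
      show "(g \<odot> c) \<odot> inc V ?W = zero_mor C (src C (rep V)) (tgt C (g \<odot> c))"
        using g e assoc[of "inc V ?W" c g] K sc W UV by simp
    qed (use g e K sc in simp_all)
    then show "g = zero_mor C (tgt C (c \<odot> inc U ?W)) (tgt C g)"
      using epic_zero[OF K(5), of g] g e K by simp
  qed (use e in simp)
  then show ?thesis using ker by (rule epic_is_cokernel_of_kernel)
qed

text \<open>Both \<open>N / (N \<inter> V)\<close> and \<open>M / (M \<inter> V)\<close> are \<open>(M + V) / V\<close> by the second isomorphism theorem.  So \<open>M / N\<close>, being
  a quotient of \<open>M / (M \<inter> V)\<close> that vanishes on the image of \<open>N\<close>, is zero.\<close>

lemma eq_if_same_meet_join: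
  assumes L: "N \<in> L" "M \<in> L" "V \<in> L" and le: "N \<preceq> M" "N \<curlywedge> V = M \<curlywedge> V" "N \<curlyvee> V = M \<curlyvee> V"
  shows "N = M"
proof -
  let ?E = "M \<curlyvee> V" and ?D = "M \<curlywedge> V"
  have E: "?E \<in> L" "M \<preceq> ?E" "V \<preceq> ?E" "N \<preceq> ?E" "?D \<in> L" "?D \<preceq> M" "?D \<preceq> N"
    using L le le_join(1)[of N V] meet_le(1)[of N V] by simp_all
  obtain c where c: "is_cokernel C (inc V ?E) c" using ex_cokernel E L by fastforce
  have eM: "is_cokernel C (inc ?D M) (c \<odot> inc M ?E)" using second_isomorphism[of M V c] c L by simp
  have eN: "is_cokernel C (inc ?D N) (c \<odot> inc N ?E)"
    using second_isomorphism[of N V c] c L le by simp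
  note Kc = cokernelD[OF c] and KM = cokernelD[OF eM] and KN = cokernelD[OF eN]
  obtain d where d: "is_cokernel C (inc N M) d" using ex_cokernel L le by fastforce
  note Kd = cokernelD[OF d]
  have sd: "src C d = src C (rep M)" "src C c = src C (rep ?E)" using Kd Kc L le E by simp_all
  have "d \<odot> inc ?D M = (d \<odot> inc N M) \<odot> inc ?D N"
    using assoc[of "inc ?D N" "inc N M" d] Kd(2) sd L le E by (simp add: inc_inc)
  then have "d \<odot> inc ?D M = zero_mor C (src C (inc ?D M)) (tgt C d)"
    using Kd L le E by simp
  then obtain d' where d': "d' \<in> Mor C" "src C d' = tgt C (c \<odot> inc M ?E)" "tgt C d' = tgt C d"
    "d' \<odot> (c \<odot> inc M ?E) = d"
    by (rule cokernel_factor[OF eM, rotated 2]) (use Kd L le E in simp_all)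
  have td: "src C d' = tgt C c" using d' Kc sd E L by simp
  have "d' \<odot> (c \<odot> inc N ?E) = (d' \<odot> (c \<odot> inc M ?E)) \<odot> inc N M"
    using d'(1,3) td Kc(2) sd E L le by (simp add: assoc inc_inc)
  also have "\<dots> = zero_mor C (src C (rep N)) (tgt C d)" using d' Kd L le by simp
  finally have "d' \<odot> (c \<odot> inc N ?E) = zero_mor C (src C (c \<odot> inc N ?E)) (tgt C d')"
    using d' Kc(2) sd E L by simp
  then have "d' = zero_mor C (src C d') (tgt C d')"
    using epic_zero[OF KN(5), of d'] d' td Kc(2) sd E L by simp
  then have "d = zero_mor C (src C d) (tgt C d)"
    using d'(4) d'(2,3) KM(2) sd Kd(2) Kc(2) E L by (metis cmp_Mor(2) cmp_zero_left inc(1-3) src_tgt_Obj(2))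
  then have "epic C (inc N M)" by (rule epic_if_zero_cokernel[OF d])
  then show ?thesis using epic_inc_eq L le by blast
qed

text \<open>The two sides are comparable and have the same meet and the same join with \<open>V\<close>.\<close>

lemma modular:
  assumes L: "U \<in> L" "V \<in> L" "W \<in> L" and le: "U \<preceq> W"
  shows "U \<curlyvee> (V \<curlywedge> W) = (U \<curlyvee> V) \<curlywedge> W"
proof (rule eq_if_same_meet_join)
  let ?N = "U \<curlyvee> (V \<curlywedge> W)" and ?M = "(U \<curlyvee> V) \<curlywedge> W"
  show NM: "?N \<preceq> ?M"
    using L le le_trans[of "V \<curlywedge> W" V "U \<curlyvee> V"] by (simp add: join_le_iff le_meet_iff)
  have a: "?N \<preceq> W" "?M \<preceq> W" "?N \<preceq> U \<curlyvee> V" "?M \<preceq> U \<curlyvee> V" "V \<curlywedge> W \<preceq> ?N"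
    using L le NM le_trans[OF NM, of W] le_trans[OF NM, of "U \<curlyvee> V"] by simp_all
  have b: "V \<curlywedge> W \<preceq> ?M" using L a NM le_trans[OF a(5) NM] by simp
  have N: "?N \<in> L" "?M \<in> L" using L by simp_all
  have "?N \<curlywedge> V \<preceq> V \<curlywedge> W" "?M \<curlywedge> V \<preceq> V \<curlywedge> W" "V \<curlywedge> W \<preceq> ?N \<curlywedge> V" "V \<curlywedge> W \<preceq> ?M \<curlywedge> V"
    using L N a b le_trans[of "?N \<curlywedge> V" ?N W] le_trans[of "?M \<curlywedge> V" ?M W] by (simp_all add: le_meet_iff[of V W] le_meet_iff[of _ V])
  then have "?N \<curlywedge> V = V \<curlywedge> W" "?M \<curlywedge> V = V \<curlywedge> W"
    using L N by (simp_all add: le_antisym)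
  then show "?N \<curlywedge> V = ?M \<curlywedge> V" by simp
  have U: "U \<preceq> ?N" "U \<preceq> ?M" using L le by (simp_all add: le_meet_iff)
  have "?N \<curlyvee> V \<preceq> U \<curlyvee> V" "?M \<curlyvee> V \<preceq> U \<curlyvee> V" 
    using L N a by (simp_all add: join_le_iff)
  moreover have "U \<curlyvee> V \<preceq> ?N \<curlyvee> V" "U \<curlyvee> V \<preceq> ?M \<curlyvee> V"
    using L N U le_trans[OF U(1) le_join(1)[of ?N V]] le_trans[OF U(2) le_join(1)[of ?M V]]
    by (simp_all add: join_le_iff[of U V])
  ultimately have "?N \<curlyvee> V = U \<curlyvee> V" "?M \<curlyvee> V = U \<curlyvee> V"
    using L N by (simp_all add: le_antisym)
  then show "?N \<curlyvee> V = ?M \<curlyvee> V" by simp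
qed (use L in simp_all)

text \<open>A factor can be computed from the chosen representatives, as any other choice differs by
  isomorphisms \<open>a\<close>, \<open>b\<close> at the two ends of the inclusion.\<close>

lemma is_factor_iff:
  assumes L: "U \<in> L" "V \<in> L"
  shows "is_factor C U V Q \<longleftrightarrow> U \<preceq> V \<and> (\<exists>c. is_cokernel C (inc U V) c \<and> tgt C c = Q)"
proof
  assume "is_factor C U V Q"
  then obtain i j h p where ij: "i \<in> U" "j \<in> V" and hH: "h \<in> Hom C (src C i) (src C j)" and ih: "i = j \<odot> h"
    and p: "is_cokernel C h p" "tgt C p = Q" unfolding is_factor_def by blast
  have h: "h \<in> Mor C" "src C h = src C i" "tgt C h = src C j" using hH by (simp_all add: in_Hom)
  have "factors_through C i j" using h ih by (intro factors_throughI[of h]) simp_all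
  then have le: "U \<preceq> V" using sub_le_iff[OF L ij] by simp
  note i = subobjects_member[OF L(1) ij(1)] and j = subobjects_member[OF L(2) ij(2)]
  note fi = member_factors[OF L(1) ij(1)] and fj = member_factors[OF L(2) ij(2)]
  obtain a where a: "a \<in> Mor C" "src C a = src C (rep U)" "tgt C a = src C i" "i \<odot> a = rep U"
    using fi(2) by (rule factors_throughE)
  obtain b where b: "b \<in> Mor C" "src C b = src C (rep V)" "tgt C b = src C j" "j \<odot> b = rep V"
    using fj(2) by (rule factors_throughE)
  have ia: "is_iso C a" by (rule mutual_factor_iso[of "rep U" i]) (use fi L i a in simp_all)
  have ib: "is_iso C b" by (rule mutual_factor_iso[of "rep V" j]) (use fj L j b in simp_all)
  have "j \<odot> (b \<odot> inc U V) = (j \<odot> b) \<odot> inc U V" by (rule assoc[symmetric]) (use b j L le in simp_all)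
  also have "\<dots> = (j \<odot> h) \<odot> a" using b a ih L le by simp
  also have "\<dots> = j \<odot> (h \<odot> a)" by (rule assoc) (use a h j in simp_all)
  finally have "b \<odot> inc U V = h \<odot> a"
    by (rule monic_cancel[OF j(1)]) (use a b h L le in simp_all)
  then have "is_cokernel C (inc U V) (p \<odot> b)"
    by (intro cokernel_transport[OF p(1) ia _ _ ib]) (use a b h L le in simp_all)
  moreover have "tgt C (p \<odot> b) = Q" using p cokernelD[OF p(1)] h b by simp
  ultimately show "U \<preceq> V \<and> (\<exists>c. is_cokernel C (inc U V) c \<and> tgt C c = Q)"
    using le by blast
next
  assume as: "U \<preceq> V \<and> (\<exists>c. is_cokernel C (inc U V) c \<and> tgt C c = Q)"
  then have "inc U V \<in> Hom C (src C (rep U)) (src C (rep V))" "rep U = rep V \<odot> inc U V"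
    using L by (simp_all add: in_Hom)
  then show "is_factor C U V Q"
    unfolding is_factor_def using as rep_in[OF L(1)] rep_in[OF L(2)] by blast
qed

lemma ex_factor: "\<lbrakk>U \<in> L; V \<in> L; U \<preceq> V\<rbrakk> \<Longrightarrow> \<exists>Q. is_factor C U V Q"
  using ex_cokernel[of "inc U V"] by (auto simp: is_factor_iff)

lemma factors_isomorphic:
  assumes "U \<in> L" "V \<in> L" "is_factor C U V Q" "is_factor C U V Q'"
  shows "isomorphic C Q Q'"
proof -
  obtain c c' where "is_cokernel C (inc U V) c" "tgt C c = Q" "is_cokernel C (inc U V) c'" "tgt C c' = Q'"
    using assms by (auto simp: is_factor_iff)
  from cokernels_isomorphic[OF this(1,3)] obtain t
    where t: "t \<in> Mor C" "src C t = tgt C c" "tgt C t = tgt C c'" "is_iso C t" by metis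
  then have "t \<in> Hom C Q Q'" using \<open>tgt C c = Q\<close> \<open>tgt C c' = Q'\<close> by (simp add: in_Hom)
  then show ?thesis unfolding isomorphic_def using t by blast
qed

lemma factor_closed_iso:
  assumes "U \<in> L" "V \<in> L" "is_factor C U V Q" "isomorphic C Q Q'"
  shows "is_factor C U V Q'"
proof -
  obtain c where c: "is_cokernel C (inc U V) c" "tgt C c = Q" "U \<preceq> V"
    using assms by (auto simp: is_factor_iff)
  obtain t where t: "t \<in> Mor C" "src C t = Q" "tgt C t = Q'" "is_iso C t"
    using assms(4) unfolding isomorphic_def Bex_def in_Hom by blast
  have "is_cokernel C (inc U V) (t \<odot> c)" by (rule cokernel_cmp_iso) (use c t in simp_all)
  moreover have "tgt C (t \<odot> c) = Q'" using c t cokernelD(2)[OF c(1)] by simp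
  ultimately show ?thesis using c assms by (auto simp: is_factor_iff)
qed

lemma factor_transpose:
  assumes "U \<in> L" "V \<in> L"
  shows "is_factor C V (U \<curlyvee> V) Q \<longleftrightarrow> is_factor C (U \<curlywedge> V) U Q"
proof -
  have 1: "is_factor C (U \<curlywedge> V) U Q" if Q: "is_factor C V (U \<curlyvee> V) Q" for Q
  proof -
    obtain c where c: "is_cokernel C (inc V (U \<curlyvee> V)) c" "tgt C c = Q"
      using iffD1[OF is_factor_iff[OF assms(2) meet_join_closed(2)[OF assms]] Q] by blast
    note K = cokernelD[OF c(1)]
    have "tgt C (c \<odot> inc U (U \<curlyvee> V)) = Q" using c K assms by simp
    then have "\<exists>c'. is_cokernel C (inc (U \<curlywedge> V) U) c' \<and> tgt C c' = Q"
      using second_isomorphism[OF assms c(1)] by blast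
    then show ?thesis using assms by (simp add: is_factor_iff)
  qed
  show ?thesis
  proof
    assume Q: "is_factor C (U \<curlywedge> V) U Q"
    obtain Q' where Q': "is_factor C V (U \<curlyvee> V) Q'"
      using ex_factor[OF assms(2) meet_join_closed(2)[OF assms] le_join(2)[OF assms]] by blast
    have iso: "isomorphic C Q' Q" by (rule factors_isomorphic[OF _ _ 1[OF Q'] Q]) (use assms in simp_all)
    show "is_factor C V (U \<curlyvee> V) Q" by (rule factor_closed_iso[OF _ _ Q' iso]) (use assms in simp_all)
  qed (rule 1)
qed

text \<open>\<open>M / U\<close> is a subobject of the simple object \<open>V / U\<close>.  If it is zero then \<open>M \<le> U\<close>; if it is everything then
  \<open>V / M\<close>, a quotient of \<open>V / U\<close> vanishing on \<open>M / U\<close>, is zero.\<close>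

lemma simple_factor_no_between:
  assumes L: "U \<in> L" "V \<in> L" "M \<in> L" and Q: "is_factor C U V Q" "simple_object C Q"
    and le: "U \<preceq> M" "M \<preceq> V"
  shows "M = U \<or> M = V"
proof -
  obtain c where c: "is_cokernel C (inc U V) c" "tgt C c = Q" and UV: "U \<preceq> V"
    using Q L by (auto simp: is_factor_iff)
  note K = cokernelD[OF c(1)]
  have ck: "is_kernel C c (inc U V)" by (rule kernel_of_cokernel_inc[OF L(1,2) UV c(1)])
  have sc: "src C c = src C (rep V)" using K L UV by simp
  obtain b where b: "is_cokernel C (inc U M) b" using ex_cokernel L le by fastforce
  note B = cokernelD[OF b]
  have sb: "src C b = src C (rep M)" using B L le by simp
  have "(c \<odot> inc M V) \<odot> inc U M = c \<odot> inc U V"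
    using assoc[of "inc U M" "inc M V" c] K(2) sc L le UV by (simp add: inc_inc)
  then have z: "(c \<odot> inc M V) \<odot> inc U M = zero_mor C (src C (inc U M)) (tgt C (c \<odot> inc M V))"
    using K sc L le UV by simp
  then obtain m where m: "m \<in> Mor C" "src C m = tgt C b" "tgt C m = tgt C (c \<odot> inc M V)" "m \<odot> b = c \<odot> inc M V"
    by (rule cokernel_factor[OF b, rotated 2]) (use K sc L le UV in simp_all)
  have tm: "tgt C m = Q" using m K sc L le c by simp
  have "is_kernel C (m \<odot> b) (inc U M)"
    unfolding m(4)
  proof (rule kernelI)
    fix h assume h: "h \<in> Mor C" "tgt C h = src C (c \<odot> inc M V)"
      "(c \<odot> inc M V) \<odot> h = zero_mor C (src C h) (tgt C (c \<odot> inc M V))"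
    then have th: "tgt C h = src C (rep M)" using K sc L le by simp
    have "c \<odot> (inc M V \<odot> h) = zero_mor C (src C (inc M V \<odot> h)) (tgt C c)"
      using h th assoc[of h "inc M V" c] K(2) sc L le by simp
    then obtain u where u: "u \<in> Mor C" "src C u = src C (inc M V \<odot> h)" "tgt C u = src C (inc U V)"
      "inc U V \<odot> u = inc M V \<odot> h"
      by (rule kernel_factor[OF ck, rotated 2]) (use h th K(2) sc L le in simp_all)
    have "inc M V \<odot> (inc U M \<odot> u) = inc M V \<odot> h"
      using assoc[of u "inc U M" "inc M V"] u h th L le UV by (simp add: inc_inc)
    then have "inc U M \<odot> u = h"
      by (rule monic_cancel[OF inc(5)[OF L(3,2) le(2)]]) (use u h th L le UV in simp_all)
    then show "factors_through C h (inc U M)"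
      by (intro factors_throughI[of u]) (use u h th L le UV in simp_all)
  qed (use K sc L le z in simp_all)
  then have mm: "monic C m" by (rule coimage_monic[OF b m(1,2)])
  have "subobject C m \<in> subobjects C Q" using mm tm unfolding subobjects_def by blast
  then consider "zero_sub C (subobject C m)" | "subobject C m = full_sub C Q"
    using Q(2) unfolding simple_object_def by blast
  then show ?thesis
  proof cases
    case 1
    then obtain i where i: "i \<in> subobject C m" "zero_object C (src C i)" unfolding zero_sub_def by blast
    then have im: "factors_through C m i" "monic C i" "tgt C i = Q" using mem_subobject[OF mm] tm by auto
    then obtain u where u: "u \<in> Mor C" "src C u = src C m" "tgt C u = src C i" "i \<odot> u = m"
      by (meson factors_throughE)
    have "m = i \<odot> zero_mor C (src C m) (src C i)" using to_zero_object[OF i(2) u(1,3)] u by simp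
    also have "\<dots> = zero_mor C (src C m) Q" using im(2,3) m(1) by simp
    finally have "m = zero_mor C (src C m) Q" .
    then have "m \<odot> b = zero_mor C (src C b) Q" using m(1,2) B(2) Q(2) unfolding simple_object_def
      by (metis cmp_zero_left)
    then have "c \<odot> inc M V = zero_mor C (src C (inc M V)) (tgt C c)" using m(4) sb c(2) L le by simp
    then obtain u where u: "u \<in> Mor C" "src C u = src C (inc M V)" "tgt C u = src C (inc U V)"
      "inc U V \<odot> u = inc M V"
      by (rule kernel_factor[OF ck, rotated 2]) (use sc L le in simp_all)
    have "rep U \<odot> u = (rep V \<odot> inc U V) \<odot> u" using L UV by simp
    also have "\<dots> = rep V \<odot> (inc U V \<odot> u)" by (rule assoc) (use u L UV le in simp_all)
    also have "\<dots> = rep M" using u L le by simp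
    finally have "M \<preceq> U" by (intro le_if_factors[of M U u]) (use u L le UV in simp_all)
    then show ?thesis using le_antisym L le by blast
  next
    case 2
    have QO: "Q \<in> Obj C" using Q(2) unfolding simple_object_def by blast
    then have "ident C Q \<in> subobject C m"
      using 2 subobject_self[OF ident_monic[OF QO]] unfolding full_sub_def by simp
    then have "factors_through C (ident C Q) m"
      using mem_subobject[OF mm] by blast
    then obtain s where s: "s \<in> Mor C" "src C s = Q" "tgt C s = src C m" "m \<odot> s = ident C Q"
      using QO by (auto elim: factors_throughE)
    obtain d where d: "is_cokernel C (inc M V) d" using ex_cokernel L le by fastforce
    note D = cokernelD[OF d]
    have sd: "src C d = src C (rep V)" using D L le by simp
    have "d \<odot> inc U V = (d \<odot> inc M V) \<odot> inc U M"
      using assoc[of "inc U M" "inc M V" d] D(2) sd L le UV by (simp add: inc_inc)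
    then have "d \<odot> inc U V = zero_mor C (src C (inc U V)) (tgt C d)"
      using D L le UV by simp
    then obtain d' where d': "d' \<in> Mor C" "src C d' = tgt C c" "tgt C d' = tgt C d" "d' \<odot> c = d"
      by (rule cokernel_factor[OF c(1), rotated 2]) (use D sd L UV in simp_all)
    have "(d' \<odot> m) \<odot> b = d' \<odot> (c \<odot> inc M V)"
      unfolding m(4)[symmetric] by (rule assoc) (use d' m tm c B in simp_all)
    also have "\<dots> = d \<odot> inc M V" using assoc[of "inc M V" c d'] d' K(2) sc L le by simp
    also have "\<dots> = zero_mor C (src C b) (tgt C (d' \<odot> m))" using D d' m tm c sb L le by simp
    finally have "d' \<odot> m = zero_mor C (tgt C b) (tgt C (d' \<odot> m))"
      by (rule epic_zero[OF B(5)]) (use d' m tm c in simp_all)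
    then have "(d' \<odot> m) \<odot> s = zero_mor C Q (tgt C d)" using d' m(1,2) tm c s D(2) by simp
    then have "d' = zero_mor C Q (tgt C d)" using assoc[of s m d'] d' m(1,2) tm c s by simp
    then have "d = zero_mor C (src C d) (tgt C d)"
      using d' c K D(2) by (metis cmp_Mor(2) cmp_zero_left src_tgt_Obj(2))
    then have "epic C (inc M V)" by (rule epic_if_zero_cokernel[OF d])
    then show ?thesis using epic_inc_eq L le by blast
  qed
qed

text \<open>A subobject \<open>W\<close> of \<open>V / U\<close> is recovered from its preimage \<open>M\<close> in \<open>V\<close>, so if no subobject lies strictly
  between \<open>U\<close> and \<open>V\<close>, then \<open>W\<close> is zero or everything.  Below \<open>d\<close> is the quotient by \<open>W\<close>, and \<open>M\<close> is the
  kernel of \<open>V \<rightarrow> V / U \<rightarrow> (V / U) / W\<close>.\<close>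

lemma cover_factor_simple:
  assumes L: "U \<in> L" "V \<in> L" and ne: "U \<noteq> V" and Q: "is_factor C U V Q"
    and cov: "\<And>M. \<lbrakk>M \<in> L; U \<preceq> M; M \<preceq> V\<rbrakk> \<Longrightarrow> M = U \<or> M = V"
  shows "simple_object C Q"
  unfolding simple_object_def
proof (intro conjI ballI)
  obtain c where c: "is_cokernel C (inc U V) c" "tgt C c = Q" and UV: "U \<preceq> V"
    using Q L by (auto simp: is_factor_iff)
  note K = cokernelD[OF c(1)]
  have ck: "is_kernel C c (inc U V)" by (rule kernel_of_cokernel_inc[OF L UV c(1)])
  have sc: "src C c = src C (rep V)" using K L UV by simp
  show "Q \<in> Obj C" using c K by auto
  show "\<not> zero_object C Q"
  proof
    assume "zero_object C Q"
    then have "c = zero_mor C (src C c) (tgt C c)" using to_zero_object[of Q c] c(2) K(2) by simp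
    then have "epic C (inc U V)" by (rule epic_if_zero_cokernel[OF c(1)])
    then show False using epic_inc_eq L UV ne by blast
  qed
  fix W assume W: "W \<in> subobjects C Q"
  then obtain i where i: "monic C i" "tgt C i = Q" "W = subobject C i" unfolding subobjects_def by blast
  obtain d where d: "is_cokernel C i d" using ex_cokernel i by fastforce
  note D = cokernelD[OF d]
  have dc: "d \<odot> c \<in> Mor C" "src C (d \<odot> c) = src C (rep V)" "tgt C (d \<odot> c) = tgt C d"
    using D K sc i c by simp_all
  obtain k where k: "is_kernel C (d \<odot> c) k" using ex_kernel dc by blast
  note Kk = kernelD[OF k]
  have tk: "tgt C k = src C (rep V)" using Kk dc by simp
  have m: "monic C (rep V \<odot> k)" "tgt C (rep V \<odot> k) = X" "src C (rep V \<odot> k) = src C k"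
    using monic_cmp[of k "rep V"] Kk tk L by simp_all
  let ?M = "subobject C (rep V \<odot> k)"
  have M: "?M \<in> L" by (rule subobject_in_L[OF m(1,2)])
  have "(d \<odot> c) \<odot> inc U V = d \<odot> (c \<odot> inc U V)"
    by (rule assoc) (use D K sc i c L UV in simp_all)
  then have "(d \<odot> c) \<odot> inc U V = zero_mor C (src C (inc U V)) (tgt C (d \<odot> c))"
    using D K i c dc L UV by simp
  then obtain u where u: "u \<in> Mor C" "src C u = src C (inc U V)" "tgt C u = src C k" "k \<odot> u = inc U V"
    by (rule kernel_factor[OF k, rotated 2]) (use dc L UV in simp_all)
  have "(rep V \<odot> k) \<odot> u = rep U" using assoc[of u k "rep V"] u Kk tk L UV by simp
  then have "factors_through C (rep U) (rep V \<odot> k)"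
    by (intro factors_throughI[of u]) (use u m L UV in simp_all)
  then have UM: "U \<preceq> ?M" using rep_subobject[OF m(1,2)] L M by (simp add: le_iff)
  have "sub_le C ?M V"
    using sub_le_iff[OF M L(2) subobject_self[OF m(1)] rep_in[OF L(2)]]
      factors_throughI[of k "rep V \<odot> k" "rep V"] Kk tk m by simp
  from cov[OF M UM this] show "zero_sub C W \<or> W = full_sub C Q"
  proof
    assume "?M = V"
    then have "factors_through C (rep V) (rep V \<odot> k)"
      using rep_subobject[OF m(1,2), of "rep V"] factors_through_refl L by simp
    then obtain s where s: "s \<in> Mor C" "src C s = src C (rep V)" "tgt C s = src C (rep V \<odot> k)" "(rep V \<odot> k) \<odot> s = rep V"
      by (rule factors_throughE)
    have "rep V \<odot> (k \<odot> s) = rep V \<odot> ident C (src C (rep V))"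
      using assoc[of s k "rep V"] s m Kk tk L by simp
    then have ks: "k \<odot> s = ident C (src C (rep V))"
      by (rule monic_cancel[OF rep(1)[OF L(2)]]) (use s m Kk tk L in simp_all)
    have "d \<odot> c = (d \<odot> c) \<odot> (k \<odot> s)" using ks dc by simp
    also have "\<dots> = ((d \<odot> c) \<odot> k) \<odot> s" by (rule assoc[symmetric]) (use s m Kk dc in simp_all)
    also have "\<dots> = zero_mor C (src C c) (tgt C d)" using Kk s m dc sc D(2) by simp
    finally have "d = zero_mor C (src C d) (tgt C d)"
      using epic_zero[OF K(5), of d] D i c by simp
    then have "epic C i" by (rule epic_if_zero_cokernel[OF d])
    then have "is_iso C i" using i by (intro monic_epic_iso)
    then obtain g where g: "g \<in> Mor C" "src C g = tgt C i" "tgt C g = src C i" "i \<odot> g = ident C (tgt C i)"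
      by (rule isoE)
    have QO: "Q \<in> Obj C" using c K by auto
    have "subobject C i = subobject C (ident C Q)"
      by (subst subobject_eq_iff)
        (use i g QO in \<open>auto simp: ident_monic intro: factors_throughI[of i] factors_throughI[of g]\<close>)
    then show ?thesis using i unfolding full_sub_def by simp
  next
    assume eq: "?M = U"
    have "is_kernel C (d \<odot> c) (inc U V)"
    proof (rule kernelI)
      fix h assume h: "h \<in> Mor C" "tgt C h = src C (d \<odot> c)" "(d \<odot> c) \<odot> h = zero_mor C (src C h) (tgt C (d \<odot> c))"
      then obtain w where w: "w \<in> Mor C" "src C w = src C h" "tgt C w = src C k" "k \<odot> w = h"
        by (rule kernel_factor[OF k])
      have "(rep V \<odot> k) \<odot> w = rep V \<odot> h" using assoc[of w k "rep V"] w Kk tk L by simp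
      then have "factors_through C (rep V \<odot> h) (rep V \<odot> k)"
        by (intro factors_throughI[of w]) (use w h dc Kk tk m L in simp_all)
      then have "factors_through C (rep V \<odot> h) (rep U)"
        using rep_subobject[OF m(1,2)] eq by simp
      then obtain t where t: "t \<in> Mor C" "src C t = src C (rep V \<odot> h)" "tgt C t = src C (rep U)"
        "rep U \<odot> t = rep V \<odot> h" by (rule factors_throughE)
      have "rep V \<odot> (inc U V \<odot> t) = rep V \<odot> h"
        using assoc[of t "inc U V" "rep V"] t L UV by simp
      then have "inc U V \<odot> t = h"
        by (rule monic_cancel[OF rep(1)[OF L(2)]]) (use t h dc L UV in simp_all)
      then show "factors_through C h (inc U V)"
        by (intro factors_throughI[of t]) (use t h dc L UV in simp_all)
    qed (use dc L UV \<open>(d \<odot> c) \<odot> inc U V = zero_mor C (src C (inc U V)) (tgt C (d \<odot> c))\<close> in simp_all)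
    then have "monic C d" by (intro coimage_monic[OF c(1)]) (use D i c in simp_all)
    from monic_zero[OF this, of i] have "i = zero_mor C (src C i) (tgt C i)" using D i by simp
    then have "zero_object C (src C i)" by (rule monic_zero_object[OF i(1)])
    then show ?thesis unfolding zero_sub_def using i subobject_self by blast
  qed
qed

lemma full_sub_in_L [simp]: "full_sub C X \<in> L"
  unfolding full_sub_def by (rule subobject_in_L) (simp_all add: ident_monic)

lemma le_full [simp]: assumes "U \<in> L" shows "U \<preceq> full_sub C X"
proof -
  have "factors_through C (rep U) (ident C X)"
    by (rule factors_throughI[of "rep U"]) (use assms in simp_all)
  then show ?thesis
    using sub_le_iff[OF assms full_sub_in_L rep_in[OF assms], of "ident C X"] subobject_self[OF ident_monic[OF X_Obj]]
    by (simp add: full_sub_def)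
qed

lemma zero_sub_rep: assumes "U \<in> L" "zero_sub C U" shows "zero_object C (src C (rep U))"
proof -
  obtain i where i: "i \<in> U" "zero_object C (src C i)" using assms unfolding zero_sub_def by blast
  obtain h where h: "h \<in> Mor C" "src C h = src C (rep U)" "tgt C h = src C i" "i \<odot> h = rep U"
    using member_factors(2)[OF assms(1) i(1)] by (rule factors_throughE)
  have "rep U = i \<odot> zero_mor C (src C (rep U)) (src C i)"
    using to_zero_object[OF i(2) h(1,3)] h by simp
  then have "rep U = zero_mor C (src C (rep U)) (tgt C (rep U))"
    using subobjects_member[OF assms(1) i(1)] assms by (metis cmp_zero_right monic_Mor rep(2,3) src_tgt_Obj(1))
  then show ?thesis using assms by (intro monic_zero_object) simp_all
qed

lemma zero_sub_le: assumes "U \<in> L" "V \<in> L" "zero_sub C U" shows "U \<preceq> V"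
proof (rule le_if_factors)
  have z: "zero_object C (src C (rep U))" by (rule zero_sub_rep[OF assms(1,3)])
  show "rep V \<odot> zero_mor C (src C (rep U)) (src C (rep V)) = rep U"
    using from_zero_object[OF z rep(2)[OF assms(1)] refl] assms by simp
qed (use assms in simp_all)

lemma ex_zero_sub: "\<exists>U \<in> L. zero_sub C U"
proof -
  obtain Z where Z: "zero_object C Z" using ex_zero_object by blast
  let ?z = "zero_mor C Z X"
  have m: "monic C ?z" "tgt C ?z = X" "src C ?z = Z"
    using zero_object_monic[OF Z, of ?z] zero_object_Obj[OF Z] by simp_all
  then show ?thesis
    using Z subobject_in_L[OF m(1,2)] subobject_self[OF m(1)] unfolding zero_sub_def by metis
qed

definition bot :: "'m set" where "bot = (SOME U. U \<in> L \<and> zero_sub C U)"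

lemma bot [simp]: "bot \<in> L" "zero_sub C bot"
  using someI_ex[of "\<lambda>U. U \<in> L \<and> zero_sub C U"] ex_zero_sub unfolding bot_def by blast+

lemma bot_le [simp]: "U \<in> L \<Longrightarrow> bot \<preceq> U"
  by (simp add: zero_sub_le)

lemma zero_sub_eq_bot: "U \<in> L \<Longrightarrow> zero_sub C U \<longleftrightarrow> U = bot"
  by (rule iffI) (simp_all add: le_antisym zero_sub_le)

end

section \<open>Factors in a modular lattice\<close>

text \<open>What the rest of the argument uses about subobjects: a modular lattice with the ascending chain
  condition in which \<open>factor U V Q\<close> says that \<open>Q\<close> is a copy of \<open>V / U\<close>.\<close>

locale modular_factor_lattice =
  fixes L :: "'a set" and le :: "'a \<Rightarrow> 'a \<Rightarrow> bool" (infix \<open>\<preceq>\<close> 50)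
    and meet :: "'a \<Rightarrow> 'a \<Rightarrow> 'a" (infixl \<open>\<curlywedge>\<close> 70) and join :: "'a \<Rightarrow> 'a \<Rightarrow> 'a" (infixl \<open>\<curlyvee>\<close> 65)
    and bot :: 'a and top :: 'a
    and factor :: "'a \<Rightarrow> 'a \<Rightarrow> 'o \<Rightarrow> bool" and iso :: "'o \<Rightarrow> 'o \<Rightarrow> bool" and simple :: "'o \<Rightarrow> bool"
  assumes le_refl [simp]: "U \<in> L \<Longrightarrow> U \<preceq> U"
    and le_trans: "\<lbrakk>U \<preceq> V; V \<preceq> W; U \<in> L; V \<in> L; W \<in> L\<rbrakk> \<Longrightarrow> U \<preceq> W"
    and le_antisym: "\<lbrakk>U \<preceq> V; V \<preceq> U; U \<in> L; V \<in> L\<rbrakk> \<Longrightarrow> U = V"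
    and meet_closed [simp]: "\<lbrakk>U \<in> L; V \<in> L\<rbrakk> \<Longrightarrow> U \<curlywedge> V \<in> L"
    and le_meet_iff [simp]: "\<lbrakk>U \<in> L; V \<in> L; W \<in> L\<rbrakk> \<Longrightarrow> W \<preceq> U \<curlywedge> V \<longleftrightarrow> W \<preceq> U \<and> W \<preceq> V"
    and join_closed [simp]: "\<lbrakk>U \<in> L; V \<in> L\<rbrakk> \<Longrightarrow> U \<curlyvee> V \<in> L"
    and join_le_iff [simp]: "\<lbrakk>U \<in> L; V \<in> L; W \<in> L\<rbrakk> \<Longrightarrow> U \<curlyvee> V \<preceq> W \<longleftrightarrow> U \<preceq> W \<and> V \<preceq> W"
    and bot_closed [simp]: "bot \<in> L" and bot_le [simp]: "U \<in> L \<Longrightarrow> bot \<preceq> U"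
    and top_closed [simp]: "top \<in> L" and le_top [simp]: "U \<in> L \<Longrightarrow> U \<preceq> top"
    and modular: "\<lbrakk>U \<in> L; V \<in> L; W \<in> L; U \<preceq> W\<rbrakk> \<Longrightarrow> U \<curlyvee> (V \<curlywedge> W) = (U \<curlyvee> V) \<curlywedge> W"
    and iso_sym: "iso Q R \<Longrightarrow> iso R Q"
    and iso_trans: "\<lbrakk>iso P Q; iso Q R\<rbrakk> \<Longrightarrow> iso P R"
    and factor_le: "\<lbrakk>U \<in> L; V \<in> L; factor U V Q\<rbrakk> \<Longrightarrow> U \<preceq> V"
    and ex_factor: "\<lbrakk>U \<in> L; V \<in> L; U \<preceq> V\<rbrakk> \<Longrightarrow> \<exists>Q. factor U V Q"
    and factors_iso: "\<lbrakk>U \<in> L; V \<in> L; factor U V Q; factor U V R\<rbrakk> \<Longrightarrow> iso Q R"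
    and factor_closed_iso: "\<lbrakk>U \<in> L; V \<in> L; factor U V Q; iso Q R\<rbrakk> \<Longrightarrow> factor U V R"
    and factor_transpose: "\<lbrakk>U \<in> L; V \<in> L\<rbrakk> \<Longrightarrow> factor V (U \<curlyvee> V) Q \<longleftrightarrow> factor (U \<curlywedge> V) U Q"
    and self_factor_not_simple: "\<lbrakk>U \<in> L; factor U U Q\<rbrakk> \<Longrightarrow> \<not> simple Q"
    and simple_no_between: "\<lbrakk>U \<in> L; V \<in> L; M \<in> L; factor U V Q; simple Q; U \<preceq> M; M \<preceq> V\<rbrakk> \<Longrightarrow>
      M = U \<or> M = V"
    and cover_simple: "\<lbrakk>U \<in> L; V \<in> L; U \<noteq> V; factor U V Q;
      \<And>M. \<lbrakk>M \<in> L; U \<preceq> M; M \<preceq> V\<rbrakk> \<Longrightarrow> M = U \<or> M = V\<rbrakk> \<Longrightarrow> simple Q"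
    and ascending_chain: "(\<And>k. A k \<in> L) \<Longrightarrow> (\<And>k::nat. A k \<preceq> A (Suc k)) \<Longrightarrow>
      \<exists>N. \<forall>k\<ge>N. A k = A N"
begin

lemma meet_le [simp]: "\<lbrakk>U \<in> L; V \<in> L\<rbrakk> \<Longrightarrow> U \<curlywedge> V \<preceq> U" "\<lbrakk>U \<in> L; V \<in> L\<rbrakk> \<Longrightarrow> U \<curlywedge> V \<preceq> V"
  using le_meet_iff[of U V "U \<curlywedge> V"] by (simp_all del: le_meet_iff)

lemma le_join [simp]: "\<lbrakk>U \<in> L; V \<in> L\<rbrakk> \<Longrightarrow> U \<preceq> U \<curlyvee> V" "\<lbrakk>U \<in> L; V \<in> L\<rbrakk> \<Longrightarrow> V \<preceq> U \<curlyvee> V"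
  using join_le_iff[of U V "U \<curlyvee> V"] by (simp_all del: join_le_iff)

lemma le_meet_trans: "\<lbrakk>U \<in> L; V \<in> L; W \<in> L; U \<preceq> W \<or> V \<preceq> W\<rbrakk> \<Longrightarrow> U \<curlywedge> V \<preceq> W"
  using le_trans[of "U \<curlywedge> V" U W] le_trans[of "U \<curlywedge> V" V W] by auto

lemma le_join_trans: "\<lbrakk>U \<in> L; V \<in> L; W \<in> L; W \<preceq> U \<or> W \<preceq> V\<rbrakk> \<Longrightarrow> W \<preceq> U \<curlyvee> V"
  using le_trans[of W U "U \<curlyvee> V"] le_trans[of W V "U \<curlyvee> V"] by auto

lemma meet_commute: "\<lbrakk>U \<in> L; V \<in> L\<rbrakk> \<Longrightarrow> U \<curlywedge> V = V \<curlywedge> U"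
  by (rule le_antisym) simp_all

lemma join_commute: "\<lbrakk>U \<in> L; V \<in> L\<rbrakk> \<Longrightarrow> U \<curlyvee> V = V \<curlyvee> U"
  by (rule le_antisym) simp_all

lemma meet_absorb: "\<lbrakk>U \<in> L; V \<in> L; U \<preceq> V\<rbrakk> \<Longrightarrow> U \<curlywedge> V = U"
  by (rule le_antisym) simp_all

lemma join_absorb: "\<lbrakk>U \<in> L; V \<in> L; V \<preceq> U\<rbrakk> \<Longrightarrow> U \<curlyvee> V = U"
  by (rule le_antisym) simp_all

definition has_factor :: "'o \<Rightarrow> 'a \<Rightarrow> 'a \<Rightarrow> bool" where
  "has_factor K U V \<longleftrightarrow> (\<exists>P \<in> L. \<exists>Q \<in> L. U \<preceq> P \<and> Q \<preceq> V \<and> factor P Q K)"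

lemma has_factorI: "\<lbrakk>P \<in> L; Q \<in> L; U \<preceq> P; Q \<preceq> V; factor P Q K\<rbrakk> \<Longrightarrow> has_factor K U V"
  unfolding has_factor_def by blast

lemma has_factorE:
  assumes "has_factor K U V" "U \<in> L" "V \<in> L"
  obtains P Q where "P \<in> L" "Q \<in> L" "U \<preceq> P" "P \<preceq> Q" "Q \<preceq> V" "factor P Q K" "U \<preceq> Q" "P \<preceq> V"
proof -
  from assms(1) obtain P Q where PQ: "P \<in> L" "Q \<in> L" "U \<preceq> P" "Q \<preceq> V" "factor P Q K"
    unfolding has_factor_def by blast
  then have "P \<preceq> Q" using factor_le by blast
  then show thesis using that PQ assms le_trans by meson
qed

lemma has_factor_mono:
  assumes "has_factor K U V" "U' \<preceq> U" "V \<preceq> V'" "U \<in> L" "V \<in> L" "U' \<in> L" "V' \<in> L"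
  shows "has_factor K U' V'"
proof -
  from assms(1,4,5) obtain P Q where PQ: "P \<in> L" "Q \<in> L" "U \<preceq> P" "Q \<preceq> V" "factor P Q K"
    by (rule has_factorE)
  have "U' \<preceq> P" "Q \<preceq> V'"
    using le_trans[OF assms(2) PQ(3)] le_trans[OF PQ(4) assms(3)] PQ assms by simp_all
  then show ?thesis using PQ by (intro has_factorI)
qed

text \<open>The two shifts move an interval \<open>[P, Q]\<close> to a perspective one, with the same factor.  The modular
  law computes the one meet or join that must agree with \<open>P\<close> or \<open>Q\<close>.\<close>

lemma factor_shift_up:
  assumes L: "P \<in> L" "Q \<in> L" "V \<in> L" and PQ: "factor P Q K" "V \<curlywedge> Q \<preceq> P"
  shows "factor (P \<curlyvee> V) (Q \<curlyvee> (P \<curlyvee> V)) K"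
proof -
  have le: "P \<preceq> Q" using factor_le L PQ by blast
  have "Q \<curlywedge> (P \<curlyvee> V) = P \<curlyvee> (V \<curlywedge> Q)"
    using modular[of P V Q] L le meet_commute[of Q "P \<curlyvee> V"] by simp
  also have "\<dots> = P" by (rule join_absorb) (use L PQ in simp_all)
  finally show ?thesis using factor_transpose[of Q "P \<curlyvee> V" K] L PQ by simp
qed

lemma factor_shift_down:
  assumes L: "P \<in> L" "Q \<in> L" "V \<in> L" and PQ: "factor P Q K" "Q \<preceq> P \<curlyvee> V"
  shows "factor ((Q \<curlywedge> V) \<curlywedge> P) (Q \<curlywedge> V) K"
proof -
  have le: "P \<preceq> Q" using factor_le L PQ by blast
  have "(Q \<curlywedge> V) \<curlyvee> P = P \<curlyvee> (V \<curlywedge> Q)"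
    using L meet_commute[of Q V] join_commute[of "Q \<curlywedge> V" P] by simp
  also have "\<dots> = (P \<curlyvee> V) \<curlywedge> Q" by (rule modular) (use L le in simp_all)
  also have "\<dots> = Q" using meet_absorb[of Q "P \<curlyvee> V"] meet_commute[of Q "P \<curlyvee> V"] L PQ by simp
  finally show ?thesis using factor_transpose[of "Q \<curlywedge> V" P K] L PQ by simp
qed

text \<open>The Zassenhaus argument.  Nothing lies strictly between \<open>P\<close> and \<open>Q\<close>, so \<open>(P + V) \<inter> Q\<close> is one of them:
  if it is \<open>Q\<close>, the interval \<open>[P, Q]\<close> shifts down below \<open>V\<close>, and if it is \<open>P\<close>, it shifts up above \<open>V\<close>.\<close>

lemma has_factor_split:
  assumes K: "simple K" and L: "U \<in> L" "V \<in> L" "W \<in> L" and le: "U \<preceq> V" "V \<preceq> W"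
  shows "has_factor K U W \<longleftrightarrow> has_factor K U V \<or> has_factor K V W"
proof
  assume "has_factor K U W"
  then obtain P Q where PQ: "P \<in> L" "Q \<in> L" "U \<preceq> P" "P \<preceq> Q" "Q \<preceq> W" "factor P Q K" "U \<preceq> Q" "P \<preceq> W"
    using L by (elim has_factorE)
  have "(P \<curlyvee> V) \<curlywedge> Q = P \<or> (P \<curlyvee> V) \<curlywedge> Q = Q"
    by (rule simple_no_between[of P Q]) (use PQ L K in simp_all)
  then show "has_factor K U V \<or> has_factor K V W"
  proof
    assume "(P \<curlyvee> V) \<curlywedge> Q = Q"
    then have "Q \<preceq> P \<curlyvee> V" using meet_le(1)[of "P \<curlyvee> V" Q] PQ L by simp
    then have "factor ((Q \<curlywedge> V) \<curlywedge> P) (Q \<curlywedge> V) K" using factor_shift_down PQ L by blast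
    then have "has_factor K U V" by (rule has_factorI[rotated 4]) (use PQ L le in simp_all)
    then show ?thesis ..
  next
    assume "(P \<curlyvee> V) \<curlywedge> Q = P"
    then have "P \<curlyvee> (V \<curlywedge> Q) = P" using modular[of P V Q] PQ L by simp
    then have "V \<curlywedge> Q \<preceq> P" using le_join(2)[of P "V \<curlywedge> Q"] PQ L by simp
    then have "factor (P \<curlyvee> V) (Q \<curlyvee> (P \<curlyvee> V)) K" using factor_shift_up PQ L by blast
    then have "has_factor K V W" by (rule has_factorI[rotated 4]) (use PQ L le in simp_all)
    then show ?thesis ..
  qed
next
  assume "has_factor K U V \<or> has_factor K V W"
  then show "has_factor K U W" using has_factor_mono[of K U V U W] has_factor_mono[of K V W U W] L le by auto
qed

lemma has_factor_transpose:
  assumes L: "U \<in> L" "V \<in> L"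
  shows "has_factor K (U \<curlywedge> V) U \<longleftrightarrow> has_factor K V (U \<curlyvee> V)"
proof
  assume "has_factor K (U \<curlywedge> V) U"
  then obtain P Q where PQ: "P \<in> L" "Q \<in> L" "U \<curlywedge> V \<preceq> P" "P \<preceq> Q" "Q \<preceq> U" "factor P Q K" "P \<preceq> U"
    using L by (elim has_factorE) simp_all
  have "V \<curlywedge> Q \<preceq> U \<curlywedge> V" using PQ L by (simp add: le_meet_trans)
  then have "V \<curlywedge> Q \<preceq> P" using le_trans[of "V \<curlywedge> Q" "U \<curlywedge> V" P] PQ L by simp
  then have "factor (P \<curlyvee> V) (Q \<curlyvee> (P \<curlyvee> V)) K" using factor_shift_up PQ L by blast
  then show "has_factor K V (U \<curlyvee> V)"
    by (rule has_factorI[rotated 4]) (use PQ L in \<open>simp_all add: le_join_trans\<close>)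
next
  assume "has_factor K V (U \<curlyvee> V)"
  then obtain P Q where PQ: "P \<in> L" "Q \<in> L" "V \<preceq> P" "P \<preceq> Q" "Q \<preceq> U \<curlyvee> V" "factor P Q K" "V \<preceq> Q"
    using L by (elim has_factorE) simp_all
  have "U \<curlyvee> V \<preceq> P \<curlyvee> U" using PQ L by (simp add: le_join_trans)
  then have "Q \<preceq> P \<curlyvee> U" using le_trans[of Q "U \<curlyvee> V" "P \<curlyvee> U"] PQ L by simp
  then have "factor ((Q \<curlywedge> U) \<curlywedge> P) (Q \<curlywedge> U) K" using factor_shift_down PQ L by blast
  then show "has_factor K (U \<curlywedge> V) U"
    by (rule has_factorI[rotated 4]) (use PQ L in \<open>simp_all add: le_meet_trans\<close>)
qed

lemma has_factor_simple_step:
  assumes L: "U \<in> L" "V \<in> L" and UV: "factor U V K'" "simple K'" and K: "has_factor K U V" "simple K"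
  shows "iso K' K"
proof -
  from K(1) L obtain P Q where PQ: "P \<in> L" "Q \<in> L" "U \<preceq> P" "P \<preceq> Q" "Q \<preceq> V" "factor P Q K" "U \<preceq> Q" "P \<preceq> V"
    by (rule has_factorE)
  have "P = U \<or> P = V" "Q = U \<or> Q = V"
    using simple_no_between[OF L _ UV] PQ by blast+
  moreover have "P \<noteq> Q" using self_factor_not_simple PQ K by blast
  ultimately have "P = U" "Q = V" using PQ L le_antisym by blast+
  then show ?thesis using factors_iso[OF L UV(1)] PQ by blast
qed

lemma no_factor_self: "\<lbrakk>U \<in> L; simple K\<rbrakk> \<Longrightarrow> \<not> has_factor K U U"
  by (metis has_factorE le_antisym self_factor_not_simple)

text \<open>The ascending chain condition provides a maximal element among those above \<open>U\<close> and strictly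
  below \<open>V\<close>.\<close>

lemma ex_lower_cover:
  assumes L: "U \<in> L" "V \<in> L" and UV: "U \<preceq> V" "U \<noteq> V"
  obtains P K where "P \<in> L" "U \<preceq> P" "P \<preceq> V" "P \<noteq> V" "factor P V K" "simple K"
proof -
  let ?S = "{P \<in> L. U \<preceq> P \<and> P \<preceq> V \<and> P \<noteq> V}"
  have "\<exists>P \<in> ?S. \<forall>M \<in> ?S. P \<preceq> M \<longrightarrow> M = P"
  proof (rule ccontr)
    assume "\<not> ?thesis"
    then have step: "\<exists>M. M \<in> ?S \<and> P \<preceq> M \<and> M \<noteq> P" if "P \<in> ?S" for P using that by blast
    have "\<exists>f. \<forall>k. f k \<in> ?S \<and> (f k \<preceq> f (Suc k) \<and> f (Suc k) \<noteq> f k)"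
      by (rule dependent_nat_choice) (use UV L step in auto)
    then obtain f where f: "\<And>k. f k \<in> ?S" "\<And>k. f k \<preceq> f (Suc k)" "\<And>k. f (Suc k) \<noteq> f k" by blast
    then obtain N where "\<forall>k\<ge>N. f k = f N" using ascending_chain[of f] by blast
    then have "f (Suc N) = f N" by (meson le_SucI order_refl)
    then show False using f(3) by blast
  qed
  then obtain P where P: "P \<in> L" "U \<preceq> P" "P \<preceq> V" "P \<noteq> V"
    and max: "\<And>M. \<lbrakk>M \<in> L; U \<preceq> M; M \<preceq> V; M \<noteq> V; P \<preceq> M\<rbrakk> \<Longrightarrow> M = P" by blast
  obtain K where K: "factor P V K" using ex_factor P L by blast
  have "simple K"
    by (rule cover_simple[OF P(1) L(2) P(4) K]) (use max P L le_trans in blast)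
  then show thesis using that P K by blast
qed

definition series :: "'a \<Rightarrow> nat \<Rightarrow> (nat \<Rightarrow> 'a) \<Rightarrow> (nat \<Rightarrow> 'o) \<Rightarrow> bool" where
  "series U n B T \<longleftrightarrow> (\<forall>k\<le>n. B k \<in> L) \<and> B 0 = bot \<and> B n = U \<and>
    (\<forall>k<n. factor (B k) (B (Suc k)) (T (Suc k)) \<and> simple (T (Suc k)))"

lemma seriesD:
  assumes "series U n B T"
  shows "k \<le> n \<Longrightarrow> B k \<in> L" "B 0 = bot" "B n = U"
    "k < n \<Longrightarrow> factor (B k) (B (Suc k)) (T (Suc k))" "k < n \<Longrightarrow> simple (T (Suc k))"
    "k < n \<Longrightarrow> B k \<preceq> B (Suc k)"
  using assms factor_le unfolding series_def by auto

lemma series_extend: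
  assumes "series P n B T" "factor P V K" "simple K" "V \<in> L"
  shows "series V (Suc n) (B(Suc n := V)) (T(Suc n := K))"
  using assms unfolding series_def by (auto simp: less_Suc_eq le_Suc_eq)

lemma has_factor_series:
  assumes s: "series U n B T" and K: "simple K" and k: "k \<le> n" "has_factor K bot (B k)"
  shows "\<exists>l \<in> {1..k}. iso (T l) K"
  using k
proof (induction k)
  case 0
  then show ?case using no_factor_self[of bot K] seriesD(2)[OF s] K by simp
next
  case (Suc k)
  note B = seriesD[OF s]
  have "has_factor K bot (B k) \<or> has_factor K (B k) (B (Suc k))"
    using has_factor_split[OF K, of bot "B k" "B (Suc k)"] Suc.prems B(1)[of k] B(1)[of "Suc k"] B(6)[of k]
    by simp
  then show ?case
  proof
    assume "has_factor K bot (B k)"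
    then show ?case using Suc by fastforce
  next
    assume "has_factor K (B k) (B (Suc k))"
    then have "iso (T (Suc k)) K"
      using has_factor_simple_step[of "B k" "B (Suc k)" "T (Suc k)" K] B(1)[of k] B(1)[of "Suc k"] B(4,5)[of k] Suc.prems K
      by simp
    then show ?case by force
  qed
qed

end

section \<open>Subobjects as sets of simple factors\<close>

locale multiplicity_free_lattice = modular_factor_lattice L le meet join bot top factor iso simple
  for L :: "'a set" and le (infix \<open>\<preceq>\<close> 50) and meet (infixl \<open>\<curlywedge>\<close> 70) and join (infixl \<open>\<curlyvee>\<close> 65)
    and bot top and factor :: "'a \<Rightarrow> 'a \<Rightarrow> 'o \<Rightarrow> bool" and iso simple +
  fixes I :: "'i set" and S :: "'i \<Rightarrow> 'o" and n :: nat and A :: "nat \<Rightarrow> 'a" and T :: "nat \<Rightarrow> 'o"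
  assumes A_series: "series top n A T"
    and T_noniso: "\<And>k l. \<lbrakk>1 \<le> k; k < l; l \<le> n\<rbrakk> \<Longrightarrow> \<not> iso (T k) (T l)"
    and finite_I: "finite I" and S_image: "S ` I = T ` {1..n}"
    and card_I: "card I = n"
begin

lemma T_inj: "\<lbrakk>k \<in> {1..n}; l \<in> {1..n}; iso (T k) (T l)\<rbrakk> \<Longrightarrow> k = l"
  using T_noniso[of k l] T_noniso[of l k] iso_sym by (metis atLeastAtMost_iff linorder_neqE_nat)

lemma A_step:
  assumes "k \<in> {1..n}"
  shows "A (k - 1) \<in> L" "A k \<in> L" "factor (A (k - 1)) (A k) (T k)" "simple (T k)"
proof -
  obtain l where l: "k = Suc l" "l < n" using assms by (cases k) auto
  show "A (k - 1) \<in> L" "A k \<in> L" "factor (A (k - 1)) (A k) (T k)" "simple (T k)"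
    using seriesD(1)[OF A_series, of l] seriesD(1)[OF A_series, of k] seriesD(4,5)[OF A_series l(2)] l
    by simp_all
qed

lemma T_iso_refl: "k \<in> {1..n} \<Longrightarrow> iso (T k) (T k)"
  using A_step(1-3) factors_iso by blast

lemma S_simple: "i \<in> I \<Longrightarrow> simple (S i)"
  using S_image A_step(4) by (metis imageE imageI)

lemma S_inj: assumes "i \<in> I" "j \<in> I" "iso (S i) (S j)" shows "i = j"
proof -
  have "inj_on T {1..n}"
    by (rule inj_onI) (use T_inj T_iso_refl in metis)
  then have "card (S ` I) = card I" using S_image card_I by (simp add: card_image)
  then have inj: "inj_on S I" using finite_I eq_card_imp_inj_on by blast
  have "S i \<in> T ` {1..n}" "S j \<in> T ` {1..n}" unfolding S_image[symmetric] using assms(1,2) by blast+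
  then obtain k l where kl: "S i = T k" "S j = T l" "k \<in> {1..n}" "l \<in> {1..n}" by blast
  have "k = l" using T_inj[OF kl(3,4)] assms(3) kl(1,2) by simp
  then have "S i = S j" using kl(1,2) by simp
  then show ?thesis using inj assms by (meson inj_onD)
qed

lemma simple_factor_index:
  assumes K: "simple K" "factor P Q K" "P \<in> L" "Q \<in> L"
  shows "\<exists>i \<in> I. iso K (S i)"
proof -
  have "has_factor K bot (A n)"
    using K seriesD(3)[OF A_series] has_factorI[of P Q bot top K] by simp
  then obtain l where "l \<in> {1..n}" "iso (T l) K" using has_factor_series[OF A_series K(1)] by blast
  then show ?thesis using S_image iso_sym by (metis imageE imageI)
qed

definition facs :: "'a \<Rightarrow> 'a \<Rightarrow> 'i set" where
  "facs U V = {i \<in> I. has_factor (S i) U V}"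

lemma facs_split: "\<lbrakk>U \<in> L; V \<in> L; W \<in> L; U \<preceq> V; V \<preceq> W\<rbrakk> \<Longrightarrow> facs U W = facs U V \<union> facs V W"
  unfolding facs_def using has_factor_split S_simple by blast

lemma facs_transpose: "\<lbrakk>U \<in> L; V \<in> L\<rbrakk> \<Longrightarrow> facs (U \<curlywedge> V) U = facs V (U \<curlyvee> V)"
  unfolding facs_def using has_factor_transpose by blast

lemma facs_self [simp]: "U \<in> L \<Longrightarrow> facs U U = {}"
  unfolding facs_def using no_factor_self S_simple by blast

lemma facs_empty_iff:
  assumes "U \<in> L" "V \<in> L" "U \<preceq> V"
  shows "facs U V = {} \<longleftrightarrow> U = V"
proof
  assume e: "facs U V = {}"
  show "U = V"
  proof (rule ccontr)
    assume "U \<noteq> V"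
    from ex_lower_cover[OF assms this] obtain P K where
      P: "P \<in> L" "U \<preceq> P" "P \<preceq> V" "factor P V K" "simple K" by blast
    obtain i where i: "i \<in> I" "iso K (S i)" using simple_factor_index[OF P(5,4)] P assms by blast
    then have "factor P V (S i)" using factor_closed_iso P assms by blast
    then have "i \<in> facs U V" unfolding facs_def using i P assms by (auto intro: has_factorI)
    then show False using e by blast
  qed
qed (use assms in simp)

text \<open>No simple factor occurs both in \<open>V\<close> and in \<open>A k / V\<close>.  In the induction step a factor
  occurring in both is either the new one, \<open>T (Suc k)\<close>, which does not occur in \<open>A k\<close>, so that it would occur
  in both of \<open>[A k, V + A k]\<close> and \<open>[V + A k, A (Suc k)]\<close>, one of which is trivial; or it occurs already in both of
  \<open>[0, V \<inter> A k]\<close> and \<open>[V \<inter> A k, A k]\<close>, contrary to the induction hypothesis.\<close>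

lemma facs_series_disjoint:
  "k \<le> n \<Longrightarrow> V \<in> L \<Longrightarrow> V \<preceq> A k \<Longrightarrow> facs bot V \<inter> facs V (A k) = {}"
proof (induction k arbitrary: V)
  case 0
  then have "V = bot" using seriesD(2)[OF A_series] le_antisym by simp
  then show ?case using 0 by simp
next
  case (Suc k)
  note D = seriesD[OF A_series]
  let ?A = "A k" and ?B = "A (Suc k)"
  have A: "?A \<in> L" "?B \<in> L" "factor ?A ?B (T (Suc k))" "simple (T (Suc k))" "?A \<preceq> ?B"
    using D(1)[of k] D(1)[of "Suc k"] D(4-6)[of k] Suc.prems by simp_all
  note V = Suc.prems(2,3)
  have 1: "facs bot V = facs bot (V \<curlywedge> ?A) \<union> facs ?A (V \<curlyvee> ?A)"
    using facs_split[of bot "V \<curlywedge> ?A" V] facs_transpose[of V ?A] A V by simp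
  have 2: "facs V ?B = facs (V \<curlywedge> ?A) ?A \<union> facs (V \<curlyvee> ?A) ?B"
    using facs_split[of V "V \<curlyvee> ?A" ?B] facs_transpose[of ?A V] join_commute[of ?A V] meet_commute[of ?A V] A V
    by simp
  have 3: "facs bot ?A = facs bot (V \<curlywedge> ?A) \<union> facs (V \<curlywedge> ?A) ?A"
    using facs_split[of bot "V \<curlywedge> ?A" ?A] A V by simp
  have 4: "facs ?A ?B = facs ?A (V \<curlyvee> ?A) \<union> facs (V \<curlyvee> ?A) ?B"
    using facs_split[of ?A "V \<curlyvee> ?A" ?B] A V by simp
  have 5: "facs bot (V \<curlywedge> ?A) \<inter> facs (V \<curlywedge> ?A) ?A = {}"
    using Suc.IH[of "V \<curlywedge> ?A"] Suc.prems A by simp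
  have 6: "facs bot ?A \<inter> facs ?A ?B = {}"
  proof (rule equals0I)
    fix i assume i: "i \<in> facs bot ?A \<inter> facs ?A ?B"
    then have iI: "i \<in> I" "has_factor (S i) bot ?A" "has_factor (S i) ?A ?B" unfolding facs_def by auto
    then obtain l where l: "l \<in> {1..k}" "iso (T l) (S i)"
      using has_factor_series[OF A_series S_simple, of i k] Suc.prems by auto
    have "iso (T (Suc k)) (S i)"
      using has_factor_simple_step[OF A(1-4) iI(3)] S_simple iI by blast
    then have "iso (T l) (T (Suc k))" using l iso_sym iso_trans by blast
    then show False using T_noniso[of l "Suc k"] l Suc.prems by simp
  qed
  have "V \<curlyvee> ?A = ?A \<or> V \<curlyvee> ?A = ?B"
    by (rule simple_no_between[OF A(1,2) _ A(3,4)]) (use A V in simp_all)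
  then have "facs ?A (V \<curlyvee> ?A) = {} \<or> facs (V \<curlyvee> ?A) ?B = {}" using A by auto
  then show ?case using 1 2 3 4 5 6 by blast
qed

lemma facs_disjoint:
  assumes "U \<in> L" "V \<in> L" "W \<in> L" "U \<preceq> V" "V \<preceq> W"
  shows "facs U V \<inter> facs V W = {}"
proof -
  have "facs bot V = facs bot U \<union> facs U V" "facs V top = facs V W \<union> facs W top"
    using facs_split[of bot U V] facs_split[of V W top] assms by simp_all
  then show ?thesis using facs_series_disjoint[of n V] seriesD(3)[OF A_series] assms by auto
qed

definition F :: "'a \<Rightarrow> 'i set" where "F U = facs bot U"

lemma F_subset: "F U \<subseteq> I"
  unfolding F_def facs_def by blast

lemma finite_F [simp]: "finite (F U)"
  using F_subset finite_I finite_subset by blast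

lemma F_bot [simp]: "F bot = {}"
  unfolding F_def by simp

lemma F_top [simp]: "F top = I"
proof -
  have "i \<in> F top" if i: "i \<in> I" for i
  proof -
    obtain k where k: "k \<in> {1..n}" "S i = T k" using i S_image by (metis imageE imageI)
    note A = A_step[OF k(1)]
    have "has_factor (S i) bot top" using has_factorI[of "A (k - 1)" "A k" bot top "S i"] A k(2) by simp
    then show ?thesis unfolding F_def facs_def using i by simp
  qed
  then show ?thesis using F_subset by blast
qed

lemma F_split: "\<lbrakk>U \<in> L; V \<in> L; U \<preceq> V\<rbrakk> \<Longrightarrow> F V = F U \<union> facs U V"
  unfolding F_def using facs_split[of bot U V] by simp

lemma facs_eq: "\<lbrakk>U \<in> L; V \<in> L; U \<preceq> V\<rbrakk> \<Longrightarrow> facs U V = F V - F U"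
  using F_split[of U V] facs_disjoint[of bot U V] unfolding F_def by auto

lemma F_mono: "\<lbrakk>U \<in> L; V \<in> L; U \<preceq> V\<rbrakk> \<Longrightarrow> F U \<subseteq> F V"
  using F_split by blast

text \<open>Invariance under transposition gives \<open>F U - F (U \<inter> V) = F (U + V) - F V\<close>; together with monotonicity
  this set equation determines both sides.\<close>

lemma F_meet_join:
  assumes "U \<in> L" "V \<in> L"
  shows F_meet: "F (U \<curlywedge> V) = F U \<inter> F V" and F_join: "F (U \<curlyvee> V) = F U \<union> F V"
proof -
  have "F U - F (U \<curlywedge> V) = F (U \<curlyvee> V) - F V"
    using facs_eq[of "U \<curlywedge> V" U] facs_eq[of V "U \<curlyvee> V"] facs_transpose[of U V] assms by simp
  moreover have "F (U \<curlywedge> V) \<subseteq> F U" "F (U \<curlywedge> V) \<subseteq> F V" "F U \<subseteq> F (U \<curlyvee> V)" "F V \<subseteq> F (U \<curlyvee> V)"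
    using F_mono assms by simp_all
  ultimately show "F (U \<curlywedge> V) = F U \<inter> F V" "F (U \<curlyvee> V) = F U \<union> F V" by blast+
qed

text \<open>If \<open>F U \<subseteq> F V\<close> then \<open>U / (U \<inter> V)\<close> has no simple factor, hence is zero.\<close>

lemma F_le_iff:
  assumes "U \<in> L" "V \<in> L"
  shows "F U \<subseteq> F V \<longleftrightarrow> U \<preceq> V"
proof
  assume "F U \<subseteq> F V"
  then have "facs (U \<curlywedge> V) U = {}" using facs_eq[of "U \<curlywedge> V" U] F_meet assms by auto
  then have "U \<curlywedge> V = U" using facs_empty_iff assms by simp
  then show "U \<preceq> V" using meet_le(2)[of U V] assms by simp
qed (use F_mono assms in blast)

lemma F_inj: "\<lbrakk>U \<in> L; V \<in> L; F U = F V\<rbrakk> \<Longrightarrow> U = V"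
  using F_le_iff[of U V] F_le_iff[of V U] le_antisym by blast

abbreviation numbering :: "'i set \<Rightarrow> nat \<Rightarrow> (nat \<Rightarrow> 'o) \<Rightarrow> ('i \<Rightarrow> nat) \<Rightarrow> bool" where
  "numbering J m T' \<phi> \<equiv> bij_betw \<phi> J {1..m} \<and> (\<forall>i \<in> J. iso (S i) (T' (\<phi> i)))"

text \<open>Each step of a composition series adds exactly one element to the set of factors, and \<open>\<phi>\<close> numbers the
  elements by the step \<open>g\<close> at which they appear.\<close>

lemma series_numbering:
  assumes s: "series U m B T'"
  shows "\<exists>\<phi>. numbering (F U) m T' \<phi> \<and> (\<forall>k\<le>m. F (B k) = {i \<in> F U. \<phi> i \<le> k})"
proof -
  note D = seriesD[OF s]
  have step: "\<exists>g. F (B (Suc k)) = insert g (F (B k)) \<and> g \<notin> F (B k) \<and> iso (S g) (T' (Suc k))"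
    if k: "k < m" for k
  proof -
    have B: "B k \<in> L" "B (Suc k) \<in> L" "factor (B k) (B (Suc k)) (T' (Suc k))" "simple (T' (Suc k))"
      "B k \<preceq> B (Suc k)"
      using D(1)[of k] D(1)[of "Suc k"] D(4-6)[of k] k by simp_all
    have "B k \<noteq> B (Suc k)" using self_factor_not_simple B by metis
    then obtain g where g: "g \<in> facs (B k) (B (Suc k))" using facs_empty_iff B by blast
    have iso: "iso (T' (Suc k)) (S i)" "i \<in> I" if "i \<in> facs (B k) (B (Suc k))" for i
      using that has_factor_simple_step[OF B(1-4)] S_simple unfolding facs_def by blast+
    have "i = g" if i: "i \<in> facs (B k) (B (Suc k))" for i
      using S_inj[OF iso(2)[OF i] iso(2)[OF g] iso_trans[OF iso_sym[OF iso(1)[OF i]] iso(1)[OF g]]] .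
    then have "facs (B k) (B (Suc k)) = {g}" using g by blast
    then have "F (B (Suc k)) = insert g (F (B k))" using F_split[OF B(1,2,5)] by blast
    moreover have "g \<notin> F (B k)" using facs_eq[OF B(1,2,5)] g by blast
    moreover have "iso (S g) (T' (Suc k))" by (rule iso_sym[OF iso(1)[OF g]])
    ultimately show ?thesis by blast
  qed
  have "\<forall>k. \<exists>g. k < m \<longrightarrow>
    F (B (Suc k)) = insert g (F (B k)) \<and> g \<notin> F (B k) \<and> iso (S g) (T' (Suc k))"
    using step by blast
  from choice[OF this] obtain g where g: "\<And>k. k < m \<Longrightarrow> F (B (Suc k)) = insert (g k) (F (B k))"
    "\<And>k. k < m \<Longrightarrow> g k \<notin> F (B k)" "\<And>k. k < m \<Longrightarrow> iso (S (g k)) (T' (Suc k))" by blast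
  have img: "k \<le> m \<Longrightarrow> F (B k) = g ` {..<k} \<and> inj_on g {..<k}" for k
  proof (induction k)
    case 0 then show ?case using D(2) by simp
  next
    case (Suc k)
    then show ?case using g(1,2)[of k] by (auto simp: lessThan_Suc)
  qed
  have FU: "F U = g ` {..<m}" and inj: "inj_on g {..<m}" using img[of m] D(3) by auto
  define \<phi> where "\<phi> i = Suc (inv_into {..<m} g i)" for i
  have \<phi>: "\<phi> (g k) = Suc k" if "k < m" for k using inj that by (simp add: \<phi>_def)
  have "bij_betw \<phi> (F U) {1..m}"
  proof (rule bij_betwI[where g = "\<lambda>k. g (k - 1)"])
    show "\<phi> \<in> F U \<rightarrow> {1..m}" using \<phi> by (auto simp: FU)
    show "(\<lambda>k. g (k - 1)) \<in> {1..m} \<rightarrow> F U" by (auto simp: FU)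
  qed (use \<phi> in \<open>auto simp: FU\<close>)
  moreover have "\<forall>i \<in> F U. iso (S i) (T' (\<phi> i))" using g(3) \<phi> by (auto simp: FU)
  moreover have "\<forall>k\<le>m. F (B k) = {i \<in> F U. \<phi> i \<le> k}"
  proof (intro allI impI)
    fix k assume k: "k \<le> m"
    have "{i \<in> F U. \<phi> i \<le> k} = g ` {..<k}" using \<phi> k by (auto simp: FU)
    then show "F (B k) = {i \<in> F U. \<phi> i \<le> k}" using img[OF k] by simp
  qed
  ultimately show ?thesis by blast
qed

lemma numbering_unique:
  assumes s: "series U m B T'" and J: "J \<subseteq> I" and \<phi>: "numbering J m T' \<phi>"
  shows "J = F U" "k \<le> m \<Longrightarrow> F (B k) = {i \<in> F U. \<phi> i \<le> k}"
proof -
  obtain \<psi> where \<psi>: "numbering (F U) m T' \<psi>" "\<forall>k\<le>m. F (B k) = {i \<in> F U. \<psi> i \<le> k}"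
    using series_numbering[OF s] by blast
  have eq: "j \<in> F U \<and> \<psi> j = \<phi> j" if j: "j \<in> J" for j
  proof -
    have "\<phi> j \<in> {1..m}" using \<phi> j by (meson bij_betwE)
    moreover have "\<psi> ` F U = {1..m}" using \<psi>(1) unfolding bij_betw_def by blast
    ultimately have "\<phi> j \<in> \<psi> ` F U" by blast
    then obtain i where i: "i \<in> F U" "\<psi> i = \<phi> j" by (metis imageE)
    have "iso (S i) (T' (\<phi> j))" "iso (S j) (T' (\<phi> j))" using \<psi>(1) \<phi> i j by metis+
    then have "iso (S i) (S j)" using iso_sym iso_trans by blast
    then have "i = j" using S_inj i j J F_subset by blast
    then show ?thesis using i by simp
  qed
  have "card J = card (F U)" using bij_betw_same_card \<phi> \<psi>(1) by metis
  then show JF: "J = F U" using eq by (intro card_subset_eq) auto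
  show "k \<le> m \<Longrightarrow> F (B k) = {i \<in> F U. \<phi> i \<le> k}" using eq \<psi>(2) JF by auto
qed

text \<open>Descend from \<open>V\<close> through lower covers that stay above \<open>U\<close>; each of them loses a factor, so \<open>U\<close> is reached.\<close>

lemma ex_series_through:
  assumes s: "series U m B T'" and L: "U \<in> L" "V \<in> L" "U \<preceq> V"
  shows "\<exists>m' B' T''. m \<le> m' \<and> series V m' B' T'' \<and> B' m = U"
  using L(2,3)
proof (induction "card (facs U V)" arbitrary: V rule: less_induct)
  case less
  show ?case
  proof (cases "U = V")
    case True
    then show ?thesis using s seriesD(3)[OF s] by blast
  next
    case False
    from ex_lower_cover[OF L(1) less.prems False] obtain P K where
      P: "P \<in> L" "U \<preceq> P" "P \<preceq> V" "P \<noteq> V" "factor P V K" "simple K" by blast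
    have V: "V \<in> L" by (rule less.prems)
    have "facs U P \<subset> facs U V"
      using facs_split[of U P V] facs_disjoint[of U P V] facs_empty_iff[of P V] P V L by blast
    moreover have "finite (facs U V)" using finite_I unfolding facs_def by simp
    ultimately have "card (facs U P) < card (facs U V)" by (simp add: psubset_card_mono)
    from less.hyps[OF this P(1,2)] obtain m' B' T'' where
      *: "m \<le> m'" "series P m' B' T''" "B' m = U" by blast
    from series_extend[OF *(2) P(5,6) V] * show ?thesis
      by (intro exI[of _ "Suc m'"] exI[of _ "B'(Suc m' := V)"] exI[of _ "T''(Suc m' := K)"]) simp
  qed
qed

lemma ex_series: "U \<in> L \<Longrightarrow> \<exists>m B T'. series U m B T'"
  using ex_series_through[of bot 0 "\<lambda>_. bot" T U] by (auto simp: series_def)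

definition series_order :: "'i rel" where
  "series_order = {(i, j). i \<in> I \<and> j \<in> I \<and>
    (\<forall>m B T' \<phi>. series top m B T' \<and> numbering I m T' \<phi> \<longrightarrow> \<phi> i \<le> \<phi> j)}"

text \<open>The initial segments of the numbering of a composition series are the sets \<open>F (B k)\<close>, and every subobject
  occurs in some composition series.\<close>

lemma series_order_iff: "(i, j) \<in> series_order \<longleftrightarrow> i \<in> I \<and> j \<in> I \<and> (\<forall>U \<in> L. j \<in> F U \<longrightarrow> i \<in> F U)"
proof (intro iffI conjI ballI impI)
  assume ij: "(i, j) \<in> series_order"
  then show I: "i \<in> I" "j \<in> I" unfolding series_order_def by auto
  fix U assume U: "U \<in> L" "j \<in> F U"
  obtain m B T' where B: "series U m B T'" using ex_series U by blast
  obtain m' B' T'' where s: "m \<le> m'" "series top m' B' T''" "B' m = U"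
    using ex_series_through[OF B U(1), of top] U by auto
  obtain \<phi> where \<phi>: "numbering I m' T'' \<phi>" "\<forall>k\<le>m'. F (B' k) = {i \<in> I. \<phi> i \<le> k}"
    using series_numbering[OF s(2)] by auto
  have "\<phi> i \<le> \<phi> j" using ij s(2) \<phi>(1) unfolding series_order_def by blast
  moreover have "F U = {i \<in> I. \<phi> i \<le> m}" using \<phi>(2) s by auto
  ultimately show "i \<in> F U" using U I by simp
next
  assume as: "i \<in> I \<and> j \<in> I \<and> (\<forall>U \<in> L. j \<in> F U \<longrightarrow> i \<in> F U)"
  have "\<phi> i \<le> \<phi> j" if s: "series top m B T'" and \<phi>: "numbering I m T' \<phi>" for m B T' \<phi>
  proof -
    have k: "\<phi> j \<le> m" using \<phi> as by (meson atLeastAtMost_iff bij_betwE)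
    have "F (B (\<phi> j)) = {i \<in> I. \<phi> i \<le> \<phi> j}"
      using numbering_unique(2)[OF s _ \<phi> k] by simp
    moreover have "B (\<phi> j) \<in> L" by (rule seriesD(1)[OF s k])
    ultimately show ?thesis using as by auto
  qed
  then show "(i, j) \<in> series_order" using as unfolding series_order_def by blast
qed

lemma partial_order_series_order: "partial_order_on I series_order"
proof -
  obtain \<phi> where \<phi>: "numbering I n T \<phi>" "\<forall>k\<le>n. F (A k) = {i \<in> I. \<phi> i \<le> k}"
    using series_numbering[OF A_series] by auto
  have "antisym series_order"
  proof (rule antisymI)
    fix i j assume ij: "(i, j) \<in> series_order" "(j, i) \<in> series_order"
    then have "\<phi> i = \<phi> j" using A_series \<phi>(1) unfolding series_order_def by (auto intro: order.antisym)
    then show "i = j" using \<phi>(1) ij unfolding bij_betw_def inj_on_def series_order_def by blast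
  qed
  moreover have "trans series_order" unfolding trans_def series_order_iff by blast
  moreover have "refl_on I series_order" unfolding refl_on_def series_order_iff by blast
  moreover have "series_order \<subseteq> I \<times> I" unfolding series_order_def by blast
  ultimately show ?thesis unfolding partial_order_on_def preorder_on_def by (intro conjI)
qed

text \<open>The subobjects with \<open>j\<close> as a factor are closed under meets, so a member \<open>P\<close> with fewest factors is the least
  one.\<close>

lemma ex_principal:
  assumes j: "j \<in> I"
  shows "\<exists>P \<in> L. F P = {i. (i, j) \<in> series_order}"
proof -
  have "\<exists>P. (P \<in> L \<and> j \<in> F P) \<and> (\<forall>U. (U \<in> L \<and> j \<in> F U) \<longrightarrow> card (F P) \<le> card (F U))"
    by (rule ex_has_least_nat[of _ top]) (use j in simp)
  then obtain P where P: "P \<in> L" "j \<in> F P"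
    and min: "\<And>U. \<lbrakk>U \<in> L; j \<in> F U\<rbrakk> \<Longrightarrow> card (F P) \<le> card (F U)" by blast
  have "F P \<subseteq> F U" if U: "U \<in> L" "j \<in> F U" for U
  proof -
    have "F (P \<curlywedge> U) = F P \<inter> F U" using F_meet P U by blast
    moreover have "card (F P) \<le> card (F (P \<curlywedge> U))"
      by (rule min) (use P U F_meet in auto)
    ultimately have "F P \<inter> F U = F P" by (intro card_seteq) simp_all
    then show ?thesis by blast
  qed
  then have "F P = {i. (i, j) \<in> series_order}" using P F_subset[of P] j by (auto simp: series_order_iff)
  then show ?thesis using P by blast
qed

text \<open>Birkhoff's argument: an s-set is the union of the principal s-sets of its elements, each of which is
  some \<open>F P\<close>.  Instead of a finite join, the proof takes a subobject with the most factors among those whose factors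
  all lie in \<open>J\<close>.\<close>

lemma s_sets_eq: "s_sets I series_order = F ` L"
proof (rule equalityI; rule subsetI)
  fix J assume J: "J \<in> s_sets I series_order"
  then have JI: "J \<subseteq> I" and down: "\<And>i j. (i, j) \<in> series_order \<Longrightarrow> j \<in> J \<Longrightarrow> i \<in> J"
    unfolding s_sets_def series_order_iff by blast+
  have "\<exists>U. (U \<in> L \<and> F U \<subseteq> J) \<and> (\<forall>V. (V \<in> L \<and> F V \<subseteq> J) \<longrightarrow> card (F V) \<le> card (F U))"
    by (rule ex_has_greatest_nat[of _ bot _ "Suc (card I)"])
      (use finite_I F_subset in \<open>auto intro: card_mono simp: less_Suc_eq_le\<close>)
  then obtain U where U: "U \<in> L" "F U \<subseteq> J"
    and max: "\<And>V. \<lbrakk>V \<in> L; F V \<subseteq> J\<rbrakk> \<Longrightarrow> card (F V) \<le> card (F U)" by blast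
  have "j \<in> F U" if j: "j \<in> J" for j
  proof -
    obtain P where P: "P \<in> L" "F P = {i. (i, j) \<in> series_order}" using ex_principal j JI by blast
    have eq: "F (U \<curlyvee> P) = F U \<union> F P" using F_join U P by blast
    have "F (U \<curlyvee> P) \<subseteq> J" using eq U P down j by auto
    then have "card (F (U \<curlyvee> P)) \<le> card (F U)" using max U P by simp
    then have "F U = F (U \<curlyvee> P)" using eq by (intro card_seteq) auto
    moreover have "j \<in> F P" using P j JI by (auto simp: series_order_iff)
    ultimately show ?thesis using eq by blast
  qed
  then show "J \<in> F ` L" using U by blast
next
  fix J assume "J \<in> F ` L"
  then obtain U where U: "U \<in> L" "J = F U" by blast
  then have "\<forall>i \<in> I. \<forall>j \<in> J. (i, j) \<in> series_order \<longrightarrow> i \<in> J" unfolding series_order_iff by blast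
  then show "J \<in> s_sets I series_order" unfolding s_sets_def using U(2) F_subset[of U] by blast
qed

end

section \<open>S-sets, f-sets and their pairs\<close>

locale finite_poset =
  fixes I :: "'i set" and r :: "'i rel"
  assumes finite_I: "finite I" and po: "partial_order_on I r"
begin

definition down :: "'i set \<Rightarrow> 'i set" where "down J = {i \<in> I. \<exists>j \<in> J. (i, j) \<in> r}"

text \<open>The ways of writing \<open>J\<close> as a difference of s-sets: \<open>J\<close> consists of what remains of \<open>Q\<close> over the
  s-set \<open>Q - J\<close>.  The f-sets are the \<open>J\<close> for which such a \<open>Q\<close> exists, and the least \<open>Q\<close> is then \<open>down J\<close>.\<close>

definition top_layer :: "'i set \<Rightarrow> 'i set \<Rightarrow> bool" where
  "top_layer Q J \<longleftrightarrow> Q \<in> s_sets I r \<and> J \<subseteq> Q \<and> Q - J \<in> s_sets I r"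

lemma r_refl: "i \<in> I \<Longrightarrow> (i, i) \<in> r"
  using po unfolding partial_order_on_def preorder_on_def refl_on_def by blast

lemma r_trans: "(i, j) \<in> r \<Longrightarrow> (j, k) \<in> r \<Longrightarrow> (i, k) \<in> r"
  using po unfolding partial_order_on_def preorder_on_def trans_def by blast

lemma s_set_subset: "J \<in> s_sets I r \<Longrightarrow> J \<subseteq> I"
  unfolding s_sets_def by blast

lemma s_setD: "\<lbrakk>J \<in> s_sets I r; i \<in> I; j \<in> J; (i, j) \<in> r\<rbrakk> \<Longrightarrow> i \<in> J"
  unfolding s_sets_def by blast

lemma f_set_subset: "J \<in> f_sets I r \<Longrightarrow> J \<subseteq> I"
  unfolding f_sets_def by blast

lemma f_setD: "\<lbrakk>J \<in> f_sets I r; i \<in> I; h \<in> J; j \<in> J; (h, i) \<in> r; (i, j) \<in> r\<rbrakk> \<Longrightarrow> i \<in> J"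
  unfolding f_sets_def by blast

lemma s_set_f_set: "J \<in> s_sets I r \<Longrightarrow> J \<in> f_sets I r"
  unfolding s_sets_def f_sets_def by blast

lemma s_set_empty [simp]: "{} \<in> s_sets I r" and s_set_all [simp]: "I \<in> s_sets I r"
  unfolding s_sets_def by blast+

lemma f_set_all [simp]: "I \<in> f_sets I r" and f_set_empty [simp]: "{} \<in> f_sets I r"
  by (simp_all add: s_set_f_set)

lemma f_set_singleton: assumes "i \<in> I" shows "{i} \<in> f_sets I r"
proof -
  have "antisym r" using po unfolding partial_order_on_def by blast
  then show ?thesis unfolding f_sets_def antisym_def using assms by blast
qed

lemma subset_down: "J \<subseteq> I \<Longrightarrow> J \<subseteq> down J"
  unfolding down_def using r_refl by blast

lemma down_s_set: "down J \<in> s_sets I r"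
  unfolding down_def s_sets_def using r_trans by blast

lemma down_least: "Q \<in> s_sets I r \<Longrightarrow> J \<subseteq> Q \<Longrightarrow> down J \<subseteq> Q"
  unfolding down_def using s_setD by blast

lemma down_eq: "J \<in> s_sets I r \<Longrightarrow> down J = J"
  using down_least[of J J] subset_down[OF s_set_subset] by blast

lemma top_layer_down: assumes "J \<in> f_sets I r" shows "top_layer (down J) J"
proof -
  have "down J - J \<in> s_sets I r"
    unfolding s_sets_def
  proof (intro CollectI conjI ballI impI)
    show "down J - J \<subseteq> I" unfolding down_def by blast
    fix i l assume i: "i \<in> I" and l: "l \<in> down J - J" and il: "(i, l) \<in> r"
    have "i \<in> down J" using s_setD[OF down_s_set i _ il] l by blast
    moreover have "i \<notin> J"
    proof
      assume iJ: "i \<in> J"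
      obtain j where "j \<in> J" "(l, j) \<in> r" "l \<in> I" using l unfolding down_def by blast
      then show False using f_setD[OF assms _ iJ, of l j] il l by blast
    qed
    ultimately show "i \<in> down J - J" by blast
  qed
  then show ?thesis
    unfolding top_layer_def using down_s_set subset_down[OF f_set_subset[OF assms]] by blast
qed

lemma top_layerD:
  assumes "top_layer Q J"
  shows "Q \<in> s_sets I r" "J \<subseteq> Q" "Q - J \<in> s_sets I r" "down J \<subseteq> Q" "J \<in> f_sets I r"
proof -
  show Q: "Q \<in> s_sets I r" "J \<subseteq> Q" "Q - J \<in> s_sets I r" using assms unfolding top_layer_def by auto
  then show "down J \<subseteq> Q" using down_least by blast
  have "i \<in> J" if "i \<in> I" "h \<in> J" "j \<in> J" "(h, i) \<in> r" "(i, j) \<in> r" for h i j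
    using s_setD[OF Q(1) that(1) _ that(5)] s_setD[OF Q(3), of h i] that Q(2) s_set_subset[OF Q(1)] by blast
  then show "J \<in> f_sets I r" unfolding f_sets_def using Q(2) s_set_subset[OF Q(1)] by blast
qed

lemma G_pairD:
  assumes "(J, K) \<in> G_pairs I r"
  shows "J \<in> f_sets I r" "K \<in> f_sets I r" "J \<subseteq> K" "\<And>j k. \<lbrakk>j \<in> J; k \<in> K; (k, j) \<in> r\<rbrakk> \<Longrightarrow> k \<in> J"
  using assms unfolding G_pairs_def by auto

lemma H_pairD:
  assumes "(J, K) \<in> H_pairs I r"
  shows "J \<in> f_sets I r" "K \<in> f_sets I r" "K \<subseteq> J" "\<And>j k. \<lbrakk>j \<in> J; k \<in> K; (k, j) \<in> r\<rbrakk> \<Longrightarrow> j \<in> K"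
  using assms unfolding H_pairs_def by auto

lemma s_set_G_pair: "\<lbrakk>J \<in> s_sets I r; K \<in> f_sets I r; J \<subseteq> K\<rbrakk> \<Longrightarrow> (J, K) \<in> G_pairs I r"
  unfolding G_pairs_def s_sets_def f_sets_def by blast

lemma f_set_refl_pairs: "J \<in> f_sets I r \<Longrightarrow> (J, J) \<in> G_pairs I r" "J \<in> f_sets I r \<Longrightarrow> (J, J) \<in> H_pairs I r"
  unfolding G_pairs_def H_pairs_def by auto

lemma top_layer_pairs:
  assumes "top_layer Q J"
  shows "(Q - J, Q) \<in> G_pairs I r" "(Q, J) \<in> H_pairs I r"
proof -
  note Q = top_layerD[OF assms]
  show "(Q - J, Q) \<in> G_pairs I r" by (rule s_set_G_pair) (use Q s_set_f_set in auto)
  show "(Q, J) \<in> H_pairs I r"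
    unfolding H_pairs_def using Q s_set_f_set[OF Q(1)] s_setD[OF Q(3)] s_set_subset[OF Q(1)] by blast
qed

lemma G_pair_complement:
  assumes "(J, K) \<in> G_pairs I r"
  shows "(K, K - J) \<in> H_pairs I r"
proof -
  note G = G_pairD[OF assms]
  have "K - J \<in> f_sets I r"
    unfolding f_sets_def
  proof (intro CollectI conjI ballI impI)
    show "K - J \<subseteq> I" using f_set_subset[OF G(2)] by blast
    fix i h j assume "i \<in> I" "h \<in> K - J" "j \<in> K - J" "(h, i) \<in> r \<and> (i, j) \<in> r"
    then show "i \<in> K - J" using f_setD[OF G(2)] G(4)[of i h] by blast
  qed
  then show ?thesis unfolding H_pairs_def using G by blast
qed

lemma top_layer_G:
  assumes G: "(J, K) \<in> G_pairs I r" and Q: "top_layer Q K"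
  shows "top_layer ((Q - K) \<union> J) J"
proof -
  note G = G_pairD[OF G] and Q = top_layerD[OF Q]
  have "(Q - K) \<union> J \<in> s_sets I r"
    unfolding s_sets_def
  proof (intro CollectI conjI ballI impI)
    show "(Q - K) \<union> J \<subseteq> I" using Q G s_set_subset by blast
    fix i j assume i: "i \<in> I" and j: "j \<in> (Q - K) \<union> J" and ij: "(i, j) \<in> r"
    then have "i \<in> Q" using s_setD[OF Q(1)] Q(2) G(3) by blast
    then show "i \<in> (Q - K) \<union> J" using s_setD[OF Q(3) i _ ij] G(4) j ij by blast
  qed
  moreover have "((Q - K) \<union> J) - J = Q - K" using G by blast
  ultimately show ?thesis unfolding top_layer_def using Q by simp
qed

lemma top_layer_H:
  assumes H: "(J, K) \<in> H_pairs I r" and Q: "top_layer Q J"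
  shows "top_layer Q K"
proof -
  note H = H_pairD[OF H] and Q = top_layerD[OF Q]
  have "Q - K \<in> s_sets I r"
    unfolding s_sets_def
  proof (intro CollectI conjI ballI impI)
    show "Q - K \<subseteq> I" using s_set_subset[OF Q(1)] by blast
    fix i l assume i: "i \<in> I" and l: "l \<in> Q - K" and il: "(i, l) \<in> r"
    have "i \<in> Q" using s_setD[OF Q(1) i _ il] l by blast
    moreover have "i \<notin> K"
    proof
      assume iK: "i \<in> K"
      then have "l \<notin> J" using H(4) il l by blast
      then have "i \<in> Q - J" using s_setD[OF Q(3) i _ il] l by blast
      then show False using iK H(3) by blast
    qed
    ultimately show "i \<in> Q - K" by blast
  qed
  then show ?thesis unfolding top_layer_def using Q H by blast
qed

lemma GH_pairs:
  assumes "(J, K) \<in> G_pairs I r" "(K, L) \<in> H_pairs I r"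
  shows "(J \<inter> L, L) \<in> G_pairs I r" "(J, J \<inter> L) \<in> H_pairs I r"
proof -
  note G = G_pairD[OF assms(1)] and H = H_pairD[OF assms(2)]
  have "J \<inter> L \<in> f_sets I r" using G(1) H(2) unfolding f_sets_def by blast
  then show "(J \<inter> L, L) \<in> G_pairs I r" "(J, J \<inter> L) \<in> H_pairs I r"
    unfolding G_pairs_def H_pairs_def using G H by blast+
qed

end

section \<open>The configuration of a filtration by s-sets\<close>

text \<open>A map from s-sets to subobjects of \<open>X\<close> that preserves meets, joins and bounds is all that the
  construction of a configuration requires; simple factors do not occur in this part.\<close>

locale s_set_filtration = ambient_object C X + finite_poset I r
  for C :: "('o, 'm, 'x) preadd_data_scheme" (structure) and X and I :: "'i set" and r +
  fixes s :: "'i set \<Rightarrow> 'm set"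
  assumes s_L: "J \<in> s_sets I r \<Longrightarrow> s J \<in> subobjects C X"
    and s_mono: "\<lbrakk>J \<in> s_sets I r; K \<in> s_sets I r; J \<subseteq> K\<rbrakk> \<Longrightarrow> sub_le C (s J) (s K)"
    and s_Int: "\<lbrakk>J \<in> s_sets I r; K \<in> s_sets I r\<rbrakk> \<Longrightarrow> s (J \<inter> K) = meet (s J) (s K)"
    and s_Un: "\<lbrakk>J \<in> s_sets I r; K \<in> s_sets I r\<rbrakk> \<Longrightarrow> s (J \<union> K) = join (s J) (s K)"
    and s_empty: "s {} = bot" and s_all: "s I = full_sub C X"
begin

abbreviation "D Q \<equiv> src C (rep (s Q))"
abbreviation "e P Q \<equiv> inc (s P) (s Q)"
abbreviation "SS \<equiv> s_sets I r"

lemma e [simp]: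
  assumes "P \<in> SS" "Q \<in> SS" "P \<subseteq> Q"
  shows "e P Q \<in> Mor C" "src C (e P Q) = D P" "tgt C (e P Q) = D Q" "monic C (e P Q)"
    "rep (s Q) \<odot> e P Q = rep (s P)"
  using inc[OF s_L s_L s_mono] assms by simp_all

lemma D_Obj [simp]: "Q \<in> SS \<Longrightarrow> D Q \<in> Obj C"
  using s_L by simp

lemma e_e: "\<lbrakk>P \<in> SS; Q \<in> SS; R \<in> SS; P \<subseteq> Q; Q \<subseteq> R\<rbrakk> \<Longrightarrow> e Q R \<odot> e P Q = e P R"
  by (rule inc_inc) (use s_L s_mono in simp_all)

lemma e_self: "P \<in> SS \<Longrightarrow> e P P = ident C (D P)"
  by (rule inc_self) (simp add: s_L)

lemma second_iso_s:
  assumes "P \<in> SS" "R \<in> SS" "is_cokernel C (e R (P \<union> R)) c"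
  shows "is_cokernel C (e (P \<inter> R) P) (c \<odot> e P (P \<union> R))"
  using second_isomorphism[OF s_L[OF assms(1)] s_L[OF assms(2)], of c] assms s_Int s_Un by simp

lemma zero_from_empty:
  assumes "Q \<in> SS"
  shows "e {} Q = zero_mor C (D {}) (D Q)"
proof -
  have "zero_object C (D {})" using zero_sub_rep[of bot] s_empty by simp
  from from_zero_object[OF this, of "e {} Q"] show ?thesis using assms by simp
qed

lemma rep_all_iso: "is_iso C (rep (s I))"
proof -
  have L: "s I \<in> L" by (simp add: s_L)
  have "ident C X \<in> s I" unfolding s_all full_sub_def by (simp add: subobject_self ident_monic)
  then show ?thesis
    by (intro mutual_factor_iso[of "rep (s I)" "ident C X"] member_factors[OF L]) (use L ident_monic in simp_all)
qed

text \<open>The object at \<open>J\<close> is the target of this quotient map.  At \<open>I\<close> the cokernel is chosen so that its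
  target is \<open>X\<close> itself and not merely isomorphic to it.\<close>

definition quot :: "'i set \<Rightarrow> 'm" where
  "quot J = (if J = I then rep (s I) else SOME c. is_cokernel C (e (down J - J) (down J)) c)"

definition obj :: "'i set \<Rightarrow> 'o" where "obj J = tgt C (quot J)"

lemma cokernel_from_empty: "Q \<in> SS \<Longrightarrow> is_cokernel C (e {} Q) (ident C (D Q))"
  using cokernel_of_zero[of "D {}" "D Q"] zero_from_empty by simp

lemma quot_cokernel:
  assumes "J \<in> f_sets I r"
  shows "is_cokernel C (e (down J - J) (down J)) (quot J)"
proof (cases "J = I")
  case True
  have "is_cokernel C (e {} I) (rep (s I) \<odot> ident C (D I))"
    by (rule cokernel_cmp_iso[OF cokernel_from_empty rep_all_iso]) (use s_L in simp_all)
  then show ?thesis using True down_eq[of I] s_L unfolding quot_def by simp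
next
  case False
  have "\<exists>c. is_cokernel C (e (down J - J) (down J)) c"
    by (rule ex_cokernel) (use top_layerD[OF top_layer_down[OF assms]] in simp)
  then show ?thesis unfolding quot_def using False someI_ex by simp
qed

lemma quot:
  assumes "J \<in> f_sets I r"
  shows "quot J \<in> Mor C" "src C (quot J) = D (down J)" "tgt C (quot J) = obj J" "epic C (quot J)"
  using cokernelD[OF quot_cokernel[OF assms]] top_layerD[OF top_layer_down[OF assms]] 
  by (simp_all add: obj_def)

text \<open>As \<open>Q = down J \<union> (Q - J)\<close> and \<open>down J \<inter> (Q - J) = down J - J\<close>, the second isomorphism theorem identifies
  the quotient of \<open>s Q\<close> by \<open>s (Q - J)\<close> with that of \<open>s (down J)\<close> by \<open>s (down J - J)\<close>.\<close>

lemma ex_proj: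
  assumes "top_layer Q J"
  shows "\<exists>q. is_cokernel C (e (Q - J) Q) q \<and> tgt C q = obj J \<and> q \<odot> e (down J) Q = quot J"
proof -
  note Q = top_layerD[OF assms] and dn = top_layerD[OF top_layer_down[OF top_layerD(5)[OF assms]]]
  obtain c where c: "is_cokernel C (e (Q - J) Q) c" using ex_cokernel Q by force
  note K = cokernelD[OF c]
  have sc: "src C c = D Q" using K Q by simp
  have "down J \<union> (Q - J) = Q" "down J \<inter> (Q - J) = down J - J" using Q dn by blast+
  then have "is_cokernel C (e (down J - J) (down J)) (c \<odot> e (down J) Q)"
    using second_iso_s[OF dn(1) Q(3), of c] c by simp
  from cokernels_isomorphic[OF this quot_cokernel[OF Q(5)]]
  obtain t where t: "t \<in> Mor C" "src C t = tgt C (c \<odot> e (down J) Q)" "tgt C t = tgt C (quot J)"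
    "t \<odot> c \<odot> e (down J) Q = quot J" "is_iso C t" by blast
  have st: "src C t = tgt C c" using t(2) K(2) sc Q dn by simp
  have "is_cokernel C (e (Q - J) Q) (t \<odot> c)" by (rule cokernel_cmp_iso[OF c t(5) st])
  moreover have "(t \<odot> c) \<odot> e (down J) Q = quot J"
    using assoc[of "e (down J) Q" c t] t K(2) st sc Q dn by simp
  moreover have "tgt C (t \<odot> c) = obj J" using t K(2) st by (simp add: obj_def)
  ultimately show ?thesis by blast
qed

definition proj :: "'i set \<Rightarrow> 'i set \<Rightarrow> 'm" where
  "proj Q J = (SOME q. is_cokernel C (e (Q - J) Q) q \<and> tgt C q = obj J \<and> q \<odot> e (down J) Q = quot J)"

lemma proj_cokernel:
  assumes "top_layer Q J"
  shows "is_cokernel C (e (Q - J) Q) (proj Q J)" "tgt C (proj Q J) = obj J"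
    "proj Q J \<odot> e (down J) Q = quot J"
  using someI_ex[OF ex_proj[OF assms]] unfolding proj_def by simp_all

lemma proj [simp]:
  assumes "top_layer Q J"
  shows "proj Q J \<in> Mor C" "src C (proj Q J) = D Q" "tgt C (proj Q J) = obj J" "epic C (proj Q J)"
    "proj Q J \<odot> e (down J) Q = quot J"
    "proj Q J \<odot> e (Q - J) Q = zero_mor C (D (Q - J)) (obj J)"
  using cokernelD[OF proj_cokernel(1)[OF assms]] proj_cokernel(2,3)[OF assms] top_layerD[OF assms]
  by simp_all

lemma obj_Obj [simp]: "J \<in> f_sets I r \<Longrightarrow> obj J \<in> Obj C"
  using quot[of J] src_tgt_Obj(2)[of "quot J"] by simp

lemma proj_down: "J \<in> f_sets I r \<Longrightarrow> proj (down J) J = quot J"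
  using proj_cokernel(3)[OF top_layer_down, of J] proj[OF top_layer_down, of J] e_self[OF down_s_set]
  by (metis ident_cmp(2))

lemma descend:
  assumes "top_layer M J" "f \<in> Mor C" "src C f = D M" "f \<odot> e (M - J) M = zero_mor C (D (M - J)) (tgt C f)"
  obtains b where "b \<in> Mor C" "src C b = obj J" "tgt C b = tgt C f" "b \<odot> proj M J = f"
proof -
  note M = top_layerD[OF assms(1)]
  show thesis
    by (rule cokernel_factor[OF proj_cokernel(1)[OF assms(1)], of f])
      (use assms M proj_cokernel(2)[OF assms(1)] that in simp_all)
qed

lemma quot_cancel:
  "\<lbrakk>J \<in> f_sets I r; f \<odot> quot J = g \<odot> quot J; f \<in> Mor C; g \<in> Mor C; src C f = obj J; src C g = obj J;
    tgt C f = tgt C g\<rbrakk> \<Longrightarrow> f = g"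
  using epic_cancel[OF quot(4)] quot(3) by simp

text \<open>The restriction of \<open>proj Q J\<close> kills \<open>s (P - J)\<close>, so it descends to an endomorphism of the object at \<open>J\<close>.  This
  is the identity, because both maps restrict to \<open>quot J\<close> on \<open>s (down J)\<close>.\<close>

lemma proj_restrict:
  assumes "top_layer P J" "top_layer Q J" "P \<subseteq> Q"
  shows "proj Q J \<odot> e P Q = proj P J"
proof -
  note P = top_layerD[OF assms(1)] and Q = top_layerD[OF assms(2)]
  have sub: "P - J \<subseteq> Q - J" "P - J \<subseteq> P" "Q - J \<subseteq> Q" using assms(3) by blast+
  have f: "proj Q J \<odot> e P Q \<in> Mor C" "src C (proj Q J \<odot> e P Q) = D P" "tgt C (proj Q J \<odot> e P Q) = obj J"
    using assms P Q by simp_all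
  have "(proj Q J \<odot> e P Q) \<odot> e (P - J) P = (proj Q J \<odot> e (Q - J) Q) \<odot> e (P - J) (Q - J)"
    using assoc[of "e (P - J) P" "e P Q" "proj Q J"] assoc[of "e (P - J) (Q - J)" "e (Q - J) Q" "proj Q J"]
      e_e[of "P - J" P Q] e_e[of "P - J" "Q - J" Q] proj(1-3)[OF assms(2)] P Q sub assms(3) by simp
  then have "(proj Q J \<odot> e P Q) \<odot> e (P - J) P = zero_mor C (D (P - J)) (tgt C (proj Q J \<odot> e P Q))"
    using f assms P Q sub by simp
  then obtain b where b: "b \<in> Mor C" "src C b = obj J" "tgt C b = obj J" "b \<odot> proj P J = proj Q J \<odot> e P Q"
    using descend[OF assms(1) f(1,2)] f(3) by metis
  have "b \<odot> quot J = (b \<odot> proj P J) \<odot> e (down J) P"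
    using assoc[of "e (down J) P" "proj P J" b] assms(1) P b down_s_set by simp
  also have "\<dots> = proj Q J \<odot> e (down J) Q"
    using assoc[of "e (down J) P" "e P Q" "proj Q J"] b(4) e_e[of "down J" P Q] assms P Q down_s_set
      proj(1-3)[OF assms(2)] by simp
  also have "\<dots> = ident C (obj J) \<odot> quot J" using assms(2) quot[OF P(5)] by simp
  finally have "b = ident C (obj J)"
    by (rule quot_cancel[OF P(5)]) (use b P in simp_all)
  then show ?thesis using b(4) assms(1) by simp
qed

definition iota :: "'i set \<Rightarrow> 'i set \<Rightarrow> 'm" where
  "iota J K = (SOME b. b \<in> Mor C \<and> src C b = obj J \<and> tgt C b = obj K \<and>
    b \<odot> quot J = quot K \<odot> e (down J) (down K))"

definition pi :: "'i set \<Rightarrow> 'i set \<Rightarrow> 'm" where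
  "pi J K = (SOME b. b \<in> Mor C \<and> src C b = obj J \<and> tgt C b = obj K \<and>
    b \<odot> quot J = proj (down J) K)"

lemma down_mono: "J \<subseteq> K \<Longrightarrow> down J \<subseteq> down K"
  unfolding down_def by blast

text \<open>The inclusion of \<open>s M\<close> into \<open>s Q\<close> takes \<open>s (M - J)\<close> into \<open>s (Q - K)\<close> and so induces a morphism of quotients.  The
  last equation shows that it does not depend on the pair, since \<open>quot J\<close> is epic.\<close>

lemma ex_iota:
  assumes M: "top_layer M J" and Q: "top_layer Q K" and MQ: "M \<subseteq> Q" "M \<inter> K = J"
  obtains b where "b \<in> Mor C" "src C b = obj J" "tgt C b = obj K"
    "b \<odot> proj M J = proj Q K \<odot> e M Q" "b \<odot> quot J = quot K \<odot> e (down J) (down K)"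
proof -
  note cM = top_layerD[OF M] and cQ = top_layerD[OF Q]
  have sub: "M - J \<subseteq> Q - K" "M - J \<subseteq> M" "Q - K \<subseteq> Q" "J \<subseteq> K" using MQ by blast+
  have f: "proj Q K \<odot> e M Q \<in> Mor C" "src C (proj Q K \<odot> e M Q) = D M" "tgt C (proj Q K \<odot> e M Q) = obj K"
    using Q cM cQ MQ by simp_all
  have "(proj Q K \<odot> e M Q) \<odot> e (M - J) M = (proj Q K \<odot> e (Q - K) Q) \<odot> e (M - J) (Q - K)"
    using assoc[of "e (M - J) M" "e M Q" "proj Q K"] assoc[of "e (M - J) (Q - K)" "e (Q - K) Q" "proj Q K"]
      e_e[of "M - J" M Q] e_e[of "M - J" "Q - K" Q] proj(1-3)[OF Q] cM cQ sub MQ by simp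
  then have "(proj Q K \<odot> e M Q) \<odot> e (M - J) M = zero_mor C (D (M - J)) (tgt C (proj Q K \<odot> e M Q))"
    using f Q cM cQ sub by simp
  then obtain b where b: "b \<in> Mor C" "src C b = obj J" "tgt C b = obj K" "b \<odot> proj M J = proj Q K \<odot> e M Q"
    using descend[OF M f(1,2)] f(3) by metis
  have dJK: "down J \<subseteq> down K" by (rule down_mono[OF sub(4)])
  have "b \<odot> quot J = (b \<odot> proj M J) \<odot> e (down J) M"
    using assoc[of "e (down J) M" "proj M J" b] M cM b down_s_set by simp
  also have "\<dots> = proj Q K \<odot> (e (down K) Q \<odot> e (down J) (down K))"
    using assoc[of "e (down J) M" "e M Q" "proj Q K"] b(4) e_e[of "down J" M Q] 
      e_e[of "down J" "down K" Q] Q cM cQ down_s_set MQ dJK proj(1-3)[OF Q] by simp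
  also have "\<dots> = (proj Q K \<odot> e (down K) Q) \<odot> e (down J) (down K)"
    by (rule assoc[symmetric]) (use Q cQ down_s_set dJK in simp_all)
  also have "\<dots> = quot K \<odot> e (down J) (down K)" using Q by simp
  finally show thesis using that b by blast
qed

lemma G_down:
  assumes "(J, K) \<in> G_pairs I r"
  shows "down J \<inter> K = J"
proof -
  note G = G_pairD[OF assms]
  show ?thesis using subset_down[OF f_set_subset[OF G(1)]] G unfolding down_def by blast
qed

lemma iota:
  assumes "(J, K) \<in> G_pairs I r"
  shows "iota J K \<in> Mor C" "src C (iota J K) = obj J" "tgt C (iota J K) = obj K"
    "iota J K \<odot> quot J = quot K \<odot> e (down J) (down K)"
proof -
  note G = G_pairD[OF assms]
  obtain b where "b \<in> Mor C \<and> src C b = obj J \<and> tgt C b = obj K \<and> b \<odot> quot J = quot K \<odot> e (down J) (down K)"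
    using ex_iota[OF top_layer_down[OF G(1)] top_layer_down[OF G(2)] down_mono[OF G(3)] G_down[OF assms]]
    by blast
  from someI[of "\<lambda>b. b \<in> Mor C \<and> src C b = obj J \<and> tgt C b = obj K \<and> b \<odot> quot J = quot K \<odot> e (down J) (down K)", OF this]
  show "iota J K \<in> Mor C" "src C (iota J K) = obj J" "tgt C (iota J K) = obj K"
    "iota J K \<odot> quot J = quot K \<odot> e (down J) (down K)" unfolding iota_def by simp_all
qed

lemma iota_proj:
  assumes G: "(J, K) \<in> G_pairs I r"
    and M: "top_layer M J" and Q: "top_layer Q K" and MQ: "M \<subseteq> Q" "M \<inter> K = J"
  shows "iota J K \<odot> proj M J = proj Q K \<odot> e M Q"
proof -
  obtain b where b: "b \<in> Mor C" "src C b = obj J" "tgt C b = obj K"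
    "b \<odot> proj M J = proj Q K \<odot> e M Q" "b \<odot> quot J = quot K \<odot> e (down J) (down K)"
    by (rule ex_iota[OF M Q MQ])
  have "iota J K = b"
    by (rule quot_cancel[OF top_layerD(5)[OF M]]) (use b iota[OF G] in simp_all)
  then show ?thesis using b by simp
qed

lemma ex_pi:
  assumes H: "(J, K) \<in> H_pairs I r" and Q: "top_layer Q J"
  obtains b where "b \<in> Mor C" "src C b = obj J" "tgt C b = obj K"
    "b \<odot> proj Q J = proj Q K" "b \<odot> quot J = proj (down J) K"
proof -
  have K: "top_layer Q K" "top_layer (down J) K"
    using top_layer_H[OF H] Q top_layer_down top_layerD(5)[OF Q] by blast+
  note cQ = top_layerD[OF Q] and cK = top_layerD[OF K(1)]
  have sub: "Q - J \<subseteq> Q - K" "Q - J \<subseteq> Q" "Q - K \<subseteq> Q" using H_pairD(3)[OF H] by blast+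
  have "proj Q K \<odot> e (Q - J) Q = (proj Q K \<odot> e (Q - K) Q) \<odot> e (Q - J) (Q - K)"
    using assoc[of "e (Q - J) (Q - K)" "e (Q - K) Q" "proj Q K"] e_e[of "Q - J" "Q - K" Q]
      proj(1-3)[OF K(1)] cQ cK sub by simp
  then have "proj Q K \<odot> e (Q - J) Q = zero_mor C (D (Q - J)) (tgt C (proj Q K))"
    using K cQ cK sub by simp
  then obtain b where b: "b \<in> Mor C" "src C b = obj J" "tgt C b = obj K" "b \<odot> proj Q J = proj Q K"
    using descend[OF Q proj(1,2)[OF K(1)]] proj(3)[OF K(1)] by metis
  have "b \<odot> quot J = (b \<odot> proj Q J) \<odot> e (down J) Q"
    using assoc[of "e (down J) Q" "proj Q J" b] Q cQ b down_s_set by simp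
  also have "\<dots> = proj (down J) K"
    unfolding b(4) by (rule proj_restrict[OF K(2,1) cQ(4)])
  finally show thesis using that b by blast
qed

lemma pi:
  assumes "(J, K) \<in> H_pairs I r"
  shows "pi J K \<in> Mor C" "src C (pi J K) = obj J" "tgt C (pi J K) = obj K"
    "pi J K \<odot> quot J = proj (down J) K"
proof -
  obtain b where "b \<in> Mor C \<and> src C b = obj J \<and> tgt C b = obj K \<and> b \<odot> quot J = proj (down J) K"
    using ex_pi[OF assms top_layer_down[OF H_pairD(1)[OF assms]]] by blast
  from someI[of "\<lambda>b. b \<in> Mor C \<and> src C b = obj J \<and> tgt C b = obj K \<and> b \<odot> quot J = proj (down J) K", OF this]
  show "pi J K \<in> Mor C" "src C (pi J K) = obj J" "tgt C (pi J K) = obj K"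
    "pi J K \<odot> quot J = proj (down J) K" unfolding pi_def by simp_all
qed

lemma pi_proj:
  assumes H: "(J, K) \<in> H_pairs I r" and Q: "top_layer Q J"
  shows "pi J K \<odot> proj Q J = proj Q K"
proof -
  obtain b where b: "b \<in> Mor C" "src C b = obj J" "tgt C b = obj K"
    "b \<odot> proj Q J = proj Q K" "b \<odot> quot J = proj (down J) K" by (rule ex_pi[OF H Q])
  have "pi J K = b"
    by (rule quot_cancel[OF top_layerD(5)[OF Q]]) (use b pi[OF H] in simp_all)
  then show ?thesis using b by simp
qed

text \<open>For \<open>Q = down K\<close> and \<open>M = (Q - K) \<union> J\<close> the morphism is induced by the inclusion of \<open>s M\<close> into \<open>s Q\<close>,
  and it is monic because both quotients are formed by the same subobject, \<open>M - J = Q - K\<close>.\<close>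

lemma iota_monic:
  assumes G: "(J, K) \<in> G_pairs I r"
  shows "monic C (iota J K)"
proof -
  note Gd = G_pairD[OF G]
  let ?Q = "down K" let ?M = "(?Q - K) \<union> J"
  have Q: "top_layer ?Q K" by (rule top_layer_down[OF Gd(2)])
  have M: "top_layer ?M J" by (rule top_layer_G[OF G Q])
  note cM = top_layerD[OF M] and cQ = top_layerD[OF Q]
  have sub: "?M \<subseteq> ?Q" "?M \<inter> K = J" "?M - J = ?Q - K" "?Q - K \<subseteq> ?M" using Gd(3) cQ(2) by blast+
  have eq: "iota J K \<odot> proj ?M J = proj ?Q K \<odot> e ?M ?Q" by (rule iota_proj[OF G M Q sub(1,2)])
  have pk: "is_kernel C (proj ?Q K) (e (?Q - K) ?Q)"
    by (rule monic_is_kernel_of_cokernel[OF _ proj_cokernel(1)[OF Q]]) (use cQ in simp)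
  have "is_kernel C (proj ?Q K \<odot> e ?M ?Q) (e (?M - J) ?M)"
  proof (rule kernelI)
    have "(proj ?Q K \<odot> e ?M ?Q) \<odot> e (?M - J) ?M = proj ?Q K \<odot> e (?Q - K) ?Q"
      unfolding sub(3)
      using assoc[of "e (?Q - K) ?M" "e ?M ?Q" "proj ?Q K"] e_e[of "?Q - K" ?M ?Q] proj(1-3)[OF Q] cM cQ sub(1,4)
      by simp
    then show "(proj ?Q K \<odot> e ?M ?Q) \<odot> e (?M - J) ?M =
        zero_mor C (src C (e (?M - J) ?M)) (tgt C (proj ?Q K \<odot> e ?M ?Q))"
      unfolding sub(3) using Q cM cQ sub(1,4) by simp
  next
    fix h assume h: "h \<in> Mor C" "tgt C h = src C (proj ?Q K \<odot> e ?M ?Q)"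
      "(proj ?Q K \<odot> e ?M ?Q) \<odot> h = zero_mor C (src C h) (tgt C (proj ?Q K \<odot> e ?M ?Q))"
    then have th: "tgt C h = D ?M" using Q cM cQ sub(1) by simp
    have "proj ?Q K \<odot> (e ?M ?Q \<odot> h) = zero_mor C (src C (e ?M ?Q \<odot> h)) (tgt C (proj ?Q K))"
      using h(1,3) th assoc[of h "e ?M ?Q" "proj ?Q K"] proj(1-3)[OF Q] cM cQ sub(1) by simp
    then obtain u where u: "u \<in> Mor C" "src C u = src C (e ?M ?Q \<odot> h)" "tgt C u = src C (e (?Q - K) ?Q)"
      "e (?Q - K) ?Q \<odot> u = e ?M ?Q \<odot> h"
      by (rule kernel_factor[OF pk, rotated 2]) (use h(1) th Q cM cQ sub(1) in simp_all)
    have "e ?M ?Q \<odot> (e (?Q - K) ?M \<odot> u) = e ?M ?Q \<odot> h"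
      using assoc[of u "e (?Q - K) ?M" "e ?M ?Q"] e_e[of "?Q - K" ?M ?Q] u h(1) th cM cQ sub(1,4) by simp
    then have "e (?Q - K) ?M \<odot> u = h"
      by (rule monic_cancel[rotated]) (use u h(1) th cM cQ sub(1,4) in simp_all)
    then show "factors_through C h (e (?M - J) ?M)"
      unfolding sub(3) by (intro factors_throughI[of u]) (use u h(1) th cM cQ sub(1,4) in simp_all)
  qed (use Q cM cQ sub in simp_all)
  then have "is_kernel C (iota J K \<odot> proj ?M J) (e (?M - J) ?M)" unfolding eq .
  then show ?thesis
    by (rule coimage_monic[OF proj_cokernel(1)[OF M], rotated 2]) (use iota[OF G] M in simp_all)
qed

lemma pi_epic:
  assumes H: "(J, K) \<in> H_pairs I r"
  shows "epic C (pi J K)"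
proof (rule epic_cmp_cancel)
  note Hd = H_pairD[OF H]
  have "top_layer (down J) K" by (rule top_layer_H[OF H top_layer_down[OF Hd(1)]])
  then show "epic C (pi J K \<odot> quot J)" using pi(4)[OF H] by simp
qed (use pi[OF H] quot[OF H_pairD(1)[OF H]] in simp_all)

text \<open>For the same \<open>Q\<close> and \<open>M\<close>, this is the third isomorphism theorem: the target of \<open>pi K (K - J)\<close> is the
  quotient of \<open>s Q\<close> by \<open>s M\<close>, as \<open>Q - (K - J) = M\<close>, and \<open>s M\<close> is mapped onto the source of \<open>iota J K\<close>.\<close>

lemma pi_cokernel_iota:
  assumes G: "(J, K) \<in> G_pairs I r"
  shows "is_cokernel C (iota J K) (pi K (K - J))"
proof (rule cokernelI)
  note Gd = G_pairD[OF G]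
  have H: "(K, K - J) \<in> H_pairs I r" by (rule G_pair_complement[OF G])
  note i = iota[OF G] and p = pi[OF H]
  let ?Q = "down K" let ?M = "(?Q - K) \<union> J"
  have Q: "top_layer ?Q K" by (rule top_layer_down[OF Gd(2)])
  have M: "top_layer ?M J" by (rule top_layer_G[OF G Q])
  have QL: "top_layer ?Q (K - J)" by (rule top_layer_H[OF H Q])
  note cM = top_layerD[OF M] and cQ = top_layerD[OF Q]
  have sub: "?M \<subseteq> ?Q" "?M \<inter> K = J" "?Q - (K - J) = ?M" using Gd(3) cQ(2) by blast+
  have eq: "iota J K \<odot> proj ?M J = proj ?Q K \<odot> e ?M ?Q" by (rule iota_proj[OF G M Q sub(1,2)])
  show "iota J K \<in> Mor C" "epic C (pi K (K - J))" "src C (pi K (K - J)) = tgt C (iota J K)"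
    using i p pi_epic[OF H] by simp_all
  have "(pi K (K - J) \<odot> iota J K) \<odot> proj ?M J = (pi K (K - J) \<odot> proj ?Q K) \<odot> e ?M ?Q"
    using assoc[of "proj ?M J" "iota J K" "pi K (K - J)"] assoc[of "e ?M ?Q" "proj ?Q K" "pi K (K - J)"]
      eq i(1-3) p(1-3) M Q cM cQ sub(1) by simp
  also have "\<dots> = zero_mor C (D ?M) (obj (K - J))"
    using pi_proj[OF H Q] proj(6)[OF QL] sub(3) by simp
  finally have "pi K (K - J) \<odot> iota J K = zero_mor C (tgt C (proj ?M J)) (tgt C (pi K (K - J) \<odot> iota J K))"
    by (intro epic_zero[OF proj(4)[OF M]]) (use i(1-3) p(1-3) M in simp_all)
  then show "pi K (K - J) \<odot> iota J K = zero_mor C (src C (iota J K)) (tgt C (pi K (K - J)))"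
    using i(1-3) p(1-3) M by simp
  fix h assume h: "h \<in> Mor C" "src C h = tgt C (iota J K)" "h \<odot> iota J K = zero_mor C (src C (iota J K)) (tgt C h)"
  have sh: "src C h = obj K" using h i by simp
  have "(h \<odot> proj ?Q K) \<odot> e ?M ?Q = (h \<odot> iota J K) \<odot> proj ?M J"
    using assoc[of "proj ?M J" "iota J K" h] assoc[of "e ?M ?Q" "proj ?Q K" h]
      eq i(1-3) h(1) sh M Q cM cQ sub(1) by simp
  also have "\<dots> = zero_mor C (D ?M) (tgt C (h \<odot> proj ?Q K))"
    using h i(1-3) M Q sh by simp
  finally have z: "(h \<odot> proj ?Q K) \<odot> e (?Q - (K - J)) ?Q = zero_mor C (D (?Q - (K - J))) (tgt C (h \<odot> proj ?Q K))"
    unfolding sub(3) .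
  obtain u where u: "u \<in> Mor C" "src C u = obj (K - J)" "tgt C u = tgt C (h \<odot> proj ?Q K)" "u \<odot> proj ?Q (K - J) = h \<odot> proj ?Q K"
    by (rule descend[OF QL _ _ z]) (use h sh Q in simp_all)
  have "(u \<odot> pi K (K - J)) \<odot> proj ?Q K = u \<odot> (pi K (K - J) \<odot> proj ?Q K)"
    by (rule assoc) (use u p Q in simp_all)
  also have "\<dots> = h \<odot> proj ?Q K" using pi_proj[OF H Q] u by simp
  finally have "u \<odot> pi K (K - J) = h"
    by (rule epic_cancel[OF proj(4)[OF Q]]) (use u p h sh Q in simp_all)
  then show "\<exists>u \<in> Mor C. src C u = tgt C (pi K (K - J)) \<and> tgt C u = tgt C h \<and> u \<odot> pi K (K - J) = h"
    using u p h sh Q by (intro bexI[of _ u]) simp_all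
qed

lemma iota_iota:
  assumes "(J, K) \<in> G_pairs I r" "(K, M) \<in> G_pairs I r"
  shows "(J, M) \<in> G_pairs I r" "iota J M = iota K M \<odot> iota J K"
proof -
  note G = G_pairD[OF assms(1)] and G' = G_pairD[OF assms(2)]
  show JM: "(J, M) \<in> G_pairs I r" unfolding G_pairs_def using G G' by blast
  note a = iota[OF assms(1)] and b = iota[OF assms(2)] and c = iota[OF JM]
  note q = quot[OF G(1)] quot[OF G(2)] quot[OF G'(2)]
  note d = down_s_set[of J] down_s_set[of K] down_s_set[of M] down_mono[OF G(3)] down_mono[OF G'(3)]
  have "(iota K M \<odot> iota J K) \<odot> quot J = (iota K M \<odot> quot K) \<odot> e (down J) (down K)"
    using assoc[of "quot J" "iota J K" "iota K M"] assoc[of "e (down J) (down K)" "quot K" "iota K M"] a b(1-3) q d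
    by simp
  also have "\<dots> = quot M \<odot> (e (down K) (down M) \<odot> e (down J) (down K))"
    unfolding b(4) by (rule assoc) (use q d in simp_all)
  also have "\<dots> = iota J M \<odot> quot J" using e_e[OF d] c(4) by simp
  finally have "iota K M \<odot> iota J K = iota J M"
    by (rule quot_cancel[OF G(1)]) (use a b c in simp_all)
  then show "iota J M = iota K M \<odot> iota J K" by simp
qed

lemma pi_pi:
  assumes "(J, K) \<in> H_pairs I r" "(K, M) \<in> H_pairs I r"
  shows "pi J M = pi K M \<odot> pi J K"
proof -
  note H = H_pairD[OF assms(1)] and H' = H_pairD[OF assms(2)]
  have JM: "(J, M) \<in> H_pairs I r" unfolding H_pairs_def using H H' by blast
  note a = pi[OF assms(1)] and b = pi[OF assms(2)] and c = pi[OF JM]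
  have K: "top_layer (down J) K" by (rule top_layer_H[OF assms(1) top_layer_down[OF H(1)]])
  have "(pi K M \<odot> pi J K) \<odot> quot J = pi K M \<odot> (pi J K \<odot> quot J)"
    by (rule assoc) (use a b quot[OF H(1)] in simp_all)
  also have "\<dots> = pi J M \<odot> quot J" using pi_proj[OF assms(2) K] a(4) c(4) by simp
  finally have "pi K M \<odot> pi J K = pi J M"
    by (rule quot_cancel[OF H(1)]) (use a b c in simp_all)
  then show ?thesis by simp
qed

text \<open>On \<open>s (down J)\<close> both composites are the inclusion into \<open>s (down K)\<close> followed by the projection to
  the object at \<open>M\<close>.\<close>

lemma pi_iota:
  assumes "(J, K) \<in> G_pairs I r" "(K, M) \<in> H_pairs I r"
  shows "pi K M \<odot> iota J K = iota (J \<inter> M) M \<odot> pi J (J \<inter> M)"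
proof -
  note G = G_pairD[OF assms(1)] and H = H_pairD[OF assms(2)]
  note GH = GH_pairs[OF assms]
  note a = iota[OF assms(1)] and b = pi[OF assms(2)] and c = iota[OF GH(1)] and d = pi[OF GH(2)]
  note q = quot[OF G(1)] quot[OF G(2)]
  note dn = down_s_set[of J] down_s_set[of K] down_mono[OF G(3)]
  have KM: "top_layer (down K) M" by (rule top_layer_H[OF assms(2) top_layer_down[OF G(2)]])
  have JM: "top_layer (down J) (J \<inter> M)" by (rule top_layer_H[OF GH(2) top_layer_down[OF G(1)]])
  have int: "down J \<inter> M = J \<inter> M" using G_down[OF assms(1)] H(3) by blast
  have "(pi K M \<odot> iota J K) \<odot> quot J = (pi K M \<odot> quot K) \<odot> e (down J) (down K)"
    using assoc[of "quot J" "iota J K" "pi K M"] assoc[of "e (down J) (down K)" "quot K" "pi K M"] a b(1-3) q dn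
    by simp
  also have "\<dots> = iota (J \<inter> M) M \<odot> proj (down J) (J \<inter> M)"
    using iota_proj[OF GH(1) JM KM dn(3) int] b(4) by simp
  also have "\<dots> = (iota (J \<inter> M) M \<odot> pi J (J \<inter> M)) \<odot> quot J"
    using assoc[of "quot J" "pi J (J \<inter> M)" "iota (J \<inter> M) M"] c d q by simp
  finally show ?thesis
    by (rule quot_cancel[OF G(1)]) (use a b c d in simp_all)
qed

lemma iota_self: assumes "J \<in> f_sets I r" shows "iota J J = ident C (obj J)"
proof (rule quot_cancel[OF assms])
  have J: "(J, J) \<in> G_pairs I r" using f_set_refl_pairs assms by blast
  show "iota J J \<odot> quot J = ident C (obj J) \<odot> quot J"
    using iota[OF J] quot[OF assms] e_self[OF down_s_set] by simp
qed (use iota[OF f_set_refl_pairs(1)[OF assms]] assms in simp_all)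

lemma pi_self: assumes "J \<in> f_sets I r" shows "pi J J = ident C (obj J)"
proof (rule quot_cancel[OF assms])
  have J: "(J, J) \<in> H_pairs I r" using f_set_refl_pairs assms by blast
  show "pi J J \<odot> quot J = ident C (obj J) \<odot> quot J"
    using pi[OF J] quot[OF assms] proj_down[OF assms] by simp
qed (use pi[OF f_set_refl_pairs(2)[OF assms]] assms in simp_all)

lemma s_set_quot_iso:
  assumes "Q \<in> SS"
  shows "is_iso C (quot Q)" "src C (quot Q) = D Q" "quot Q \<in> Mor C"
proof -
  have d: "down Q = Q" by (rule down_eq[OF assms])
  have Q: "is_cokernel C (e {} Q) (quot Q)"
    using quot_cokernel[OF s_set_f_set[OF assms]] d by simp
  from cokernels_isomorphic[OF cokernel_from_empty[OF assms] this]
  obtain t where t: "t \<in> Mor C" "src C t = tgt C (ident C (D Q))" "t \<odot> ident C (D Q) = quot Q" "is_iso C t"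
    by blast
  have "t = quot Q" using t assms by simp
  then show "is_iso C (quot Q)" using t by simp
  show "src C (quot Q) = D Q" "quot Q \<in> Mor C" using quot[OF s_set_f_set[OF assms]] d by simp_all
qed

lemma obj_all: "obj I = X"
  unfolding obj_def quot_def using s_L by simp

lemma obj_empty: "zero_object C (obj {})"
proof (rule zero_objectI)
  note q = s_set_quot_iso[OF s_set_empty]
  have z: "zero_object C (D {})" using zero_sub_rep[of bot] s_empty by simp
  have tq: "tgt C (quot {}) = obj {}" by (simp add: obj_def)
  show O: "obj {} \<in> Obj C" by simp
  have "quot {} = zero_mor C (D {}) (obj {})" using from_zero_object[OF z q(3,2)] tq by simp
  then have "ident C (obj {}) \<odot> quot {} = zero_mor C (src C (quot {})) (tgt C (ident C (obj {})))"
    using q tq O by simp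
  from epic_zero[OF iso_epic[OF q(1)] this] show "ident C (obj {}) = zero_mor C (obj {}) (obj {})"
    using tq O by simp
qed

theorem configuration_exists: "configuration C I r obj iota pi"
  unfolding configuration_def
proof (intro conjI)
  show "finite I" "partial_order_on I r" by (rule finite_I, rule po)
  show "\<forall>J \<in> f_sets I r. obj J \<in> Obj C" by simp
  show "zero_object C (obj {})" by (rule obj_empty)
  show "\<forall>(J, K) \<in> G_pairs I r. iota J K \<in> Hom C (obj J) (obj K) \<and> monic C (iota J K)"
    using iota iota_monic by (auto simp: in_Hom)
  show "\<forall>(J, K) \<in> H_pairs I r. pi J K \<in> Hom C (obj J) (obj K) \<and> epic C (pi J K)"
    using pi pi_epic by (auto simp: in_Hom)
  show "\<forall>J \<in> f_sets I r. iota J J = ident C (obj J)" "\<forall>J \<in> f_sets I r. pi J J = ident C (obj J)"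
    using iota_self pi_self by blast+
  show "\<forall>(J, K) \<in> G_pairs I r. short_exact C (iota J K) (pi K (K - J))"
    using short_exactI iota_monic pi_cokernel_iota by blast
  show "\<forall>J K L. (J, K) \<in> G_pairs I r \<and> (K, L) \<in> G_pairs I r \<longrightarrow> iota J L = iota K L \<odot> iota J K"
    using iota_iota(2) by blast
  show "\<forall>J K L. (J, K) \<in> H_pairs I r \<and> (K, L) \<in> H_pairs I r \<longrightarrow> pi J L = pi K L \<odot> pi J K"
    using pi_pi by blast
  show "\<forall>J K L. (J, K) \<in> G_pairs I r \<and> (K, L) \<in> H_pairs I r \<longrightarrow>
      pi K L \<odot> iota J K = iota (J \<inter> L) L \<odot> pi J (J \<inter> L)"
    using pi_iota by blast
qed

lemma iota_represents:
  assumes J: "J \<in> SS"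
  shows "subobject C (iota J I) = s J"
proof -
  have G: "(J, I) \<in> G_pairs I r" by (rule s_set_G_pair[OF J]) (use s_set_subset[OF J] in simp_all)
  note i = iota[OF G] and q = s_set_quot_iso[OF J]
  have d: "down J = J" "down I = I" using down_eq J by simp_all
  have JI: "J \<subseteq> I" by (rule s_set_subset[OF J])
  have eq: "iota J I \<odot> quot J = rep (s J)"
    using i(4) d JI J unfolding quot_def[of I] by simp
  have tq: "tgt C (quot J) = obj J" by (simp add: obj_def)
  obtain g where g: "g \<in> Mor C" "src C g = tgt C (quot J)" "tgt C g = src C (quot J)"
    "quot J \<odot> g = ident C (tgt C (quot J))" using q(1) by (rule isoE)
  have "rep (s J) \<odot> g = iota J I \<odot> quot J \<odot> g"
    unfolding eq[symmetric] by (rule assoc) (use g q tq i in simp_all)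
  then have eq': "rep (s J) \<odot> g = iota J I" using g tq i by simp
  have "subobject C (iota J I) = subobject C (rep (s J))"
  proof (subst subobject_eq_iff)
    show "factors_through C (iota J I) (rep (s J)) \<and> factors_through C (rep (s J)) (iota J I)"
      using factors_throughI[of g "iota J I" "rep (s J)"] factors_throughI[of "quot J" "rep (s J)" "iota J I"]
        g q tq i eq eq' by simp
  qed (use iota_monic[OF G] i s_L[OF J] obj_all in simp_all)
  then show ?thesis using subobjects_member(3)[OF s_L[OF J] rep_in[OF s_L[OF J]]] by simp
qed

lemma obj_factor:
  assumes "J \<in> f_sets I r"
  shows "is_factor C (s (down J - J)) (s (down J)) (obj J)"
proof -
  note c = top_layerD[OF top_layer_down[OF assms]]
  have "s (down J - J) \<in> L" "s (down J) \<in> L" "s (down J - J) \<preceq> s (down J)"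
    using c s_L s_mono by simp_all
  moreover have "\<exists>c. is_cokernel C (e (down J - J) (down J)) c \<and> tgt C c = obj J"
    using quot_cokernel[OF assms] by (auto simp: obj_def)
  ultimately show ?thesis by (simp add: is_factor_iff)
qed

end

section \<open>Uniqueness of configurations\<close>

locale configuration_data = abelian_category C + finite_poset I r
  for C :: "('o, 'm, 'x) preadd_data_scheme" (structure) and I :: "'i set" and r +
  fixes \<sigma> :: "'i set \<Rightarrow> 'o" and \<iota> \<pi> :: "'i set \<Rightarrow> 'i set \<Rightarrow> 'm"
  assumes configuration: "configuration C I r \<sigma> \<iota> \<pi>"
begin

lemma \<sigma>_Obj [simp]: "J \<in> f_sets I r \<Longrightarrow> \<sigma> J \<in> Obj C"
  using configuration unfolding configuration_def by blast

lemma \<iota> [simp]: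
  assumes "(J, K) \<in> G_pairs I r"
  shows "\<iota> J K \<in> Mor C" "src C (\<iota> J K) = \<sigma> J" "tgt C (\<iota> J K) = \<sigma> K" "monic C (\<iota> J K)"
proof -
  have "\<forall>(J, K) \<in> G_pairs I r. \<iota> J K \<in> Hom C (\<sigma> J) (\<sigma> K) \<and> monic C (\<iota> J K)"
    using configuration unfolding configuration_def by blast
  with assms have "\<iota> J K \<in> Hom C (\<sigma> J) (\<sigma> K) \<and> monic C (\<iota> J K)" by blast
  then show "\<iota> J K \<in> Mor C" "src C (\<iota> J K) = \<sigma> J" "tgt C (\<iota> J K) = \<sigma> K" "monic C (\<iota> J K)"
    by (simp_all add: in_Hom)
qed

lemma \<pi> [simp]:
  assumes "(J, K) \<in> H_pairs I r"
  shows "\<pi> J K \<in> Mor C" "src C (\<pi> J K) = \<sigma> J" "tgt C (\<pi> J K) = \<sigma> K" "epic C (\<pi> J K)"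
proof -
  have "\<forall>(J, K) \<in> H_pairs I r. \<pi> J K \<in> Hom C (\<sigma> J) (\<sigma> K) \<and> epic C (\<pi> J K)"
    using configuration unfolding configuration_def by blast
  with assms have "\<pi> J K \<in> Hom C (\<sigma> J) (\<sigma> K) \<and> epic C (\<pi> J K)" by blast
  then show "\<pi> J K \<in> Mor C" "src C (\<pi> J K) = \<sigma> J" "tgt C (\<pi> J K) = \<sigma> K" "epic C (\<pi> J K)"
    by (simp_all add: in_Hom)
qed

lemma \<iota>_self: "J \<in> f_sets I r \<Longrightarrow> \<iota> J J = ident C (\<sigma> J)"
  using configuration unfolding configuration_def by blast

lemma \<pi>_self: "J \<in> f_sets I r \<Longrightarrow> \<pi> J J = ident C (\<sigma> J)"
  using configuration unfolding configuration_def by blast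

lemma \<iota>_\<iota>:
  assumes "(J, K) \<in> G_pairs I r" "(K, M) \<in> G_pairs I r"
  shows "\<iota> K M \<odot> \<iota> J K = \<iota> J M"
proof -
  have "\<iota> J M = \<iota> K M \<odot> \<iota> J K"
    using configuration assms unfolding configuration_def by blast
  then show ?thesis by simp
qed

lemma \<pi>_\<pi>:
  assumes "(J, K) \<in> H_pairs I r" "(K, M) \<in> H_pairs I r"
  shows "\<pi> K M \<odot> \<pi> J K = \<pi> J M"
proof -
  have "\<pi> J M = \<pi> K M \<odot> \<pi> J K"
    using configuration assms unfolding configuration_def by blast
  then show ?thesis by simp
qed

lemma \<pi>_\<iota>: "\<lbrakk>(J, K) \<in> G_pairs I r; (K, M) \<in> H_pairs I r\<rbrakk> \<Longrightarrow>
    \<pi> K M \<odot> \<iota> J K = \<iota> (J \<inter> M) M \<odot> \<pi> J (J \<inter> M)"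
  using configuration unfolding configuration_def by blast

lemma \<pi>_cokernel:
  assumes "top_layer Q J"
  shows "is_cokernel C (\<iota> (Q - J) Q) (\<pi> Q J)"
proof -
  note p = top_layer_pairs[OF assms]
  have "Q - (Q - J) = J" using top_layerD(2)[OF assms] by blast
  moreover have "\<forall>(J, K) \<in> G_pairs I r. short_exact C (\<iota> J K) (\<pi> K (K - J))"
    using configuration unfolding configuration_def by blast
  ultimately have "short_exact C (\<iota> (Q - J) Q) (\<pi> Q J)" using p(1) by fastforce
  then show ?thesis by (rule short_exact_cokernel) (use p in simp)
qed

lemma \<pi>_restrict:
  assumes "top_layer P J" "top_layer Q J" "P \<subseteq> Q"
  shows "\<pi> Q J \<odot> \<iota> P Q = \<pi> P J"
proof -
  note P = top_layerD[OF assms(1)]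
  have "(P, Q) \<in> G_pairs I r"
    by (rule s_set_G_pair[OF P(1) s_set_f_set[OF top_layerD(1)[OF assms(2)]] assms(3)])
  moreover have "P \<inter> J = J" using P(2) by blast
  ultimately show ?thesis
    using \<pi>_\<iota>[of P Q J] top_layer_pairs(2)[OF assms(2)] top_layer_pairs(2)[OF assms(1)] \<iota>_self[OF P(5)]
    by simp
qed

end

locale configuration_pair =
  c1: configuration_data C I r \<sigma> \<iota> \<pi> + c2: configuration_data C I r \<sigma>' \<iota>' \<pi>'
  for C :: "('o, 'm, 'x) preadd_data_scheme" (structure) and I :: "'i set" and r
    and \<sigma> \<iota> \<pi> \<sigma>' \<iota>' \<pi>' +
  fixes X
  assumes \<sigma>_all: "\<sigma> I = X" and \<sigma>'_all: "\<sigma>' I = X"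
    and same_subobject: "J \<in> s_sets I r \<Longrightarrow> subobject C (\<iota> J I) = subobject C (\<iota>' J I)"
begin

abbreviation "SS \<equiv> s_sets I r"

lemma s_pair: "J \<in> SS \<Longrightarrow> (J, I) \<in> G_pairs I r"
  by (rule c1.s_set_G_pair) (use c1.s_set_subset in simp_all)

lemma s_pairs: "\<lbrakk>J \<in> SS; K \<in> SS; J \<subseteq> K\<rbrakk> \<Longrightarrow> (J, K) \<in> G_pairs I r"
  by (rule c1.s_set_G_pair) (use c1.s_set_f_set in simp_all)

definition compare :: "'i set \<Rightarrow> 'm" where
  "compare J = (SOME h. h \<in> Mor C \<and> src C h = \<sigma> J \<and> tgt C h = \<sigma>' J \<and> \<iota>' J I \<odot> h = \<iota> J I)"

lemma compare:
  assumes "J \<in> SS"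
  shows "compare J \<in> Mor C" "src C (compare J) = \<sigma> J" "tgt C (compare J) = \<sigma>' J" "\<iota>' J I \<odot> compare J = \<iota> J I"
    "is_iso C (compare J)"
proof -
  note p = s_pair[OF assms]
  have m: "monic C (\<iota> J I)" "monic C (\<iota>' J I)" "tgt C (\<iota> J I) = tgt C (\<iota>' J I)"
    using p \<sigma>_all \<sigma>'_all by simp_all
  have f: "factors_through C (\<iota> J I) (\<iota>' J I)" "factors_through C (\<iota>' J I) (\<iota> J I)"
    using c1.subobject_eq_iff[OF m] same_subobject[OF assms] by simp_all
  from f(1) have "\<exists>h. h \<in> Mor C \<and> src C h = \<sigma> J \<and> tgt C h = \<sigma>' J \<and> \<iota>' J I \<odot> h = \<iota> J I"
    by (rule c1.factors_throughE) (use p in auto)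
  from someI_ex[OF this]
  show c: "compare J \<in> Mor C" "src C (compare J) = \<sigma> J" "tgt C (compare J) = \<sigma>' J" "\<iota>' J I \<odot> compare J = \<iota> J I"
    unfolding compare_def by simp_all
  show "is_iso C (compare J)"
    by (rule c1.mutual_factor_iso[OF m(1,2) f(2)]) (use c p in simp_all)
qed

lemma compare_natural:
  assumes "J \<in> SS" "K \<in> SS" "J \<subseteq> K"
  shows "compare K \<odot> \<iota> J K = \<iota>' J K \<odot> compare J"
proof -
  note p = s_pairs[OF assms] s_pair[OF assms(1)] s_pair[OF assms(2)]
  note cJ = compare[OF assms(1)] and cK = compare[OF assms(2)]
  have "\<iota>' K I \<odot> (compare K \<odot> \<iota> J K) = (\<iota>' K I \<odot> compare K) \<odot> \<iota> J K"
    by (rule c1.assoc[symmetric]) (use cK p in simp_all)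
  also have "\<dots> = \<iota>' J I \<odot> compare J" using c1.\<iota>_\<iota>[OF p(1,3)] cK(4) cJ(4) by simp
  also have "\<dots> = (\<iota>' K I \<odot> \<iota>' J K) \<odot> compare J" using c2.\<iota>_\<iota>[OF p(1,3)] by simp
  also have "\<dots> = \<iota>' K I \<odot> (\<iota>' J K \<odot> compare J)"
    by (rule c1.assoc) (use cJ p in simp_all)
  finally show ?thesis
    by (rule c1.monic_cancel[OF c2.\<iota>(4)[OF p(3)]]) (use cJ cK p in simp_all)
qed

text \<open>\<open>compare\<close> is an isomorphism from the inclusion \<open>\<iota> (M - J) M\<close> to \<open>\<iota>' (M - J) M\<close>, hence induces an isomorphism
  of their cokernels.\<close>

lemma ex_descent:
  assumes "c1.top_layer M J"
  shows "\<exists>b. b \<in> Mor C \<and> src C b = \<sigma> J \<and> tgt C b = \<sigma>' J \<and> b \<odot> \<pi> M J = \<pi>' M J \<odot> compare M \<and> is_iso C b"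
proof -
  note M = c1.top_layerD[OF assms] and p = c1.top_layer_pairs[OF assms]
  note cM = compare[OF M(1)] and cN = compare[OF M(3)]
  have "is_cokernel C (\<iota> (M - J) M) (\<pi>' M J \<odot> compare M)"
    by (rule c1.cokernel_transport[OF c2.\<pi>_cokernel[OF assms] cN(5) _ _ cM(5)])
      (use cM cN p compare_natural[OF M(3,1)] in auto)
  from c1.cokernels_isomorphic[OF c1.\<pi>_cokernel[OF assms] this]
  obtain t where "t \<in> Mor C" "src C t = tgt C (\<pi> M J)" "tgt C t = tgt C (\<pi>' M J \<odot> compare M)"
    "t \<odot> \<pi> M J = \<pi>' M J \<odot> compare M" "is_iso C t" by blast
  then show ?thesis using p cM by (intro exI[of _ t]) simp
qed

definition descent :: "'i set \<Rightarrow> 'm" where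
  "descent J = (SOME b. b \<in> Mor C \<and> src C b = \<sigma> J \<and> tgt C b = \<sigma>' J \<and>
    b \<odot> \<pi> (c1.down J) J = \<pi>' (c1.down J) J \<odot> compare (c1.down J) \<and> is_iso C b)"

lemma descent:
  assumes "J \<in> f_sets I r"
  shows "descent J \<in> Mor C" "src C (descent J) = \<sigma> J" "tgt C (descent J) = \<sigma>' J" "is_iso C (descent J)"
    "descent J \<odot> \<pi> (c1.down J) J = \<pi>' (c1.down J) J \<odot> compare (c1.down J)"
  using someI_ex[OF ex_descent[OF c1.top_layer_down[OF assms]]] unfolding descent_def by simp_all

text \<open>The isomorphism induced by means of \<open>M\<close> agrees with the one induced by means of \<open>down J\<close>: restrict
  both to \<open>\<sigma> (down J)\<close>.\<close>

lemma descent_\<pi>: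
  assumes M: "c1.top_layer M J"
  shows "descent J \<odot> \<pi> M J = \<pi>' M J \<odot> compare M"
proof -
  note cM = c1.top_layerD[OF M]
  let ?D = "c1.down J"
  have D: "c1.top_layer ?D J" by (rule c1.top_layer_down[OF cM(5)])
  note cD = c1.top_layerD[OF D] and pM = c1.top_layer_pairs[OF M] and pD = c1.top_layer_pairs[OF D]
  have DM: "(?D, M) \<in> G_pairs I r" by (rule s_pairs[OF cD(1) cM(1,4)])
  obtain b where b: "b \<in> Mor C" "src C b = \<sigma> J" "tgt C b = \<sigma>' J" "b \<odot> \<pi> M J = \<pi>' M J \<odot> compare M"
    using ex_descent[OF M] by blast
  have "b \<odot> \<pi> ?D J = (b \<odot> \<pi> M J) \<odot> \<iota> ?D M"
    using c1.\<pi>_restrict[OF D M cM(4)] c1.assoc[of "\<iota> ?D M" "\<pi> M J" b] b DM pM by simp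
  also have "\<dots> = \<pi>' M J \<odot> (\<iota>' ?D M \<odot> compare ?D)"
    unfolding b(4) compare_natural[OF cD(1) cM(1,4), symmetric]
    by (rule c1.assoc) (use compare[OF cM(1)] DM pM in simp_all)
  also have "\<dots> = (\<pi>' M J \<odot> \<iota>' ?D M) \<odot> compare ?D"
    by (rule c1.assoc[symmetric]) (use compare[OF cD(1)] DM pM in simp_all)
  also have "\<dots> = descent J \<odot> \<pi> ?D J"
    using c2.\<pi>_restrict[OF D M cM(4)] descent(5)[OF cM(5)] by simp
  finally have "b = descent J"
    by (rule c1.epic_cancel[OF c1.\<pi>(4)[OF pD(2)]]) (use b descent[OF cM(5)] pD in simp_all)
  then show ?thesis using b by simp
qed

text \<open>Every \<open>\<iota> J K\<close> is induced by some \<open>\<iota> M Q\<close> between s-sets, with which \<open>compare\<close> is compatible.\<close>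

lemma descent_natural_\<iota>:
  assumes G: "(J, K) \<in> G_pairs I r"
  shows "descent K \<odot> \<iota> J K = \<iota>' J K \<odot> descent J"
proof -
  note Gd = c1.G_pairD[OF G]
  let ?Q = "c1.down K" let ?M = "(?Q - K) \<union> J"
  have Q: "c1.top_layer ?Q K" by (rule c1.top_layer_down[OF Gd(2)])
  have M: "c1.top_layer ?M J" by (rule c1.top_layer_G[OF G Q])
  note cM = c1.top_layerD[OF M] and cQ = c1.top_layerD[OF Q]
  note pM = c1.top_layer_pairs[OF M] and pQ = c1.top_layer_pairs[OF Q]
  have sub: "?M \<subseteq> ?Q" "?M \<inter> K = J" using Gd(3) cQ(2) by blast+
  have MQ: "(?M, ?Q) \<in> G_pairs I r" by (rule s_pairs[OF cM(1) cQ(1) sub(1)])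
  note dJ = descent[OF Gd(1)] and dK = descent[OF Gd(2)] and kM = compare[OF cM(1)] and kQ = compare[OF cQ(1)]
  have eq: "\<pi> ?Q K \<odot> \<iota> ?M ?Q = \<iota> J K \<odot> \<pi> ?M J" "\<pi>' ?Q K \<odot> \<iota>' ?M ?Q = \<iota>' J K \<odot> \<pi>' ?M J"
    using c1.\<pi>_\<iota>[OF MQ pQ(2)] c2.\<pi>_\<iota>[OF MQ pQ(2)] unfolding sub(2) by simp_all
  have "(descent K \<odot> \<iota> J K) \<odot> \<pi> ?M J = descent K \<odot> (\<pi> ?Q K \<odot> \<iota> ?M ?Q)"
    unfolding eq(1) by (rule c1.assoc) (use dK G pM in simp_all)
  also have "\<dots> = (descent K \<odot> \<pi> ?Q K) \<odot> \<iota> ?M ?Q"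
    by (rule c1.assoc[symmetric]) (use dK MQ pQ in simp_all)
  also have "\<dots> = \<pi>' ?Q K \<odot> (compare ?Q \<odot> \<iota> ?M ?Q)"
    unfolding descent_\<pi>[OF Q] by (rule c1.assoc) (use kQ MQ pQ in simp_all)
  also have "\<dots> = (\<pi>' ?Q K \<odot> \<iota>' ?M ?Q) \<odot> compare ?M"
    unfolding compare_natural[OF cM(1) cQ(1) sub(1)]
    by (rule c1.assoc[symmetric]) (use kM MQ pQ in simp_all)
  also have "\<dots> = \<iota>' J K \<odot> (descent J \<odot> \<pi> ?M J)"
    unfolding eq(2) descent_\<pi>[OF M] by (rule c1.assoc) (use kM G pM in simp_all)
  also have "\<dots> = (\<iota>' J K \<odot> descent J) \<odot> \<pi> ?M J"
    by (rule c1.assoc[symmetric]) (use dJ G pM in simp_all)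
  finally show ?thesis
    by (rule c1.epic_cancel[OF c1.\<pi>(4)[OF pM(2)]]) (use dJ dK G pM in simp_all)
qed

lemma descent_natural_\<pi>:
  assumes H: "(J, K) \<in> H_pairs I r"
  shows "descent K \<odot> \<pi> J K = \<pi>' J K \<odot> descent J"
proof -
  note Hd = c1.H_pairD[OF H]
  let ?Q = "c1.down J"
  have Q: "c1.top_layer ?Q J" by (rule c1.top_layer_down[OF Hd(1)])
  have K: "c1.top_layer ?Q K" by (rule c1.top_layer_H[OF H Q])
  note cQ = c1.top_layerD[OF Q]
  note pK = c1.top_layer_pairs[OF K] and pQ = c1.top_layer_pairs[OF Q]
  note dJ = descent[OF Hd(1)] and dK = descent[OF Hd(2)] and kQ = compare[OF cQ(1)]
  have "(descent K \<odot> \<pi> J K) \<odot> \<pi> ?Q J = descent K \<odot> (\<pi> J K \<odot> \<pi> ?Q J)"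
    by (rule c1.assoc) (use dK H pQ in simp_all)
  also have "\<dots> = (\<pi>' J K \<odot> \<pi>' ?Q J) \<odot> compare ?Q"
    unfolding c1.\<pi>_\<pi>[OF pQ(2) H] c2.\<pi>_\<pi>[OF pQ(2) H] by (rule descent_\<pi>[OF K])
  also have "\<dots> = \<pi>' J K \<odot> (descent J \<odot> \<pi> ?Q J)"
    unfolding descent_\<pi>[OF Q] by (rule c1.assoc) (use kQ H pQ in simp_all)
  also have "\<dots> = (\<pi>' J K \<odot> descent J) \<odot> \<pi> ?Q J"
    by (rule c1.assoc[symmetric]) (use dJ H pQ in simp_all)
  finally show ?thesis
    by (rule c1.epic_cancel[OF c1.\<pi>(4)[OF pQ(2)]]) (use dJ dK H pQ in simp_all)
qed

lemma descent_all: "descent I = ident C X"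
proof -
  have p: "(I, I) \<in> G_pairs I r" by (rule s_pair) simp
  note d = descent[OF c1.f_set_all] and k = compare[OF c1.s_set_all]
  have XO: "X \<in> Obj C" using c1.\<sigma>_Obj[OF c1.f_set_all] \<sigma>_all by simp
  have "compare I = ident C X"
    using k c1.\<iota>_self[OF c1.f_set_all] c2.\<iota>_self[OF c1.f_set_all] \<sigma>_all \<sigma>'_all by simp
  then show ?thesis
    using d c1.\<pi>_self[OF c1.f_set_all] c2.\<pi>_self[OF c1.f_set_all] \<sigma>_all \<sigma>'_all XO c1.down_eq[OF c1.s_set_all]
    by simp
qed

text \<open>On s-sets the values are forced by the monomorphisms \<open>\<iota>' Q I\<close>, on the remaining f-sets by the
  epimorphisms \<open>\<pi> (down J) J\<close>.\<close>

lemma morphism_determined: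
  assumes \<alpha>: "configuration_morphism C I r \<sigma> \<iota> \<pi> \<sigma>' \<iota>' \<pi>' \<alpha>" "\<alpha> I = ident C X" and J: "J \<in> f_sets I r"
  shows "\<alpha> J = descent J"
proof -
  have H: "\<alpha> K \<in> Mor C" "src C (\<alpha> K) = \<sigma> K" "tgt C (\<alpha> K) = \<sigma>' K" if "K \<in> f_sets I r" for K
    using \<alpha>(1) that unfolding configuration_morphism_def by (simp_all add: c1.in_Hom)
  have ni: "\<alpha> K \<odot> \<iota> J K = \<iota>' J K \<odot> \<alpha> J" if "(J, K) \<in> G_pairs I r" for J K
    using \<alpha>(1) that unfolding configuration_morphism_def by blast
  have np: "\<alpha> K \<odot> \<pi> J K = \<pi>' J K \<odot> \<alpha> J" if "(J, K) \<in> H_pairs I r" for J K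
    using \<alpha>(1) that unfolding configuration_morphism_def by blast
  have s: "\<alpha> Q = compare Q" if Q: "Q \<in> SS" for Q
  proof -
    note p = s_pair[OF Q]
    have "\<iota>' Q I \<odot> \<alpha> Q = \<iota>' Q I \<odot> compare Q"
      using ni[OF p] \<alpha>(2) compare(4)[OF Q] p \<sigma>_all by simp
    then show ?thesis
      by (rule c1.monic_cancel[OF c2.\<iota>(4)[OF p]]) (use compare[OF Q] H[OF c1.s_set_f_set[OF Q]] p in simp_all)
  qed
  note D = c1.top_layer_down[OF J]
  note p = c1.top_layer_pairs[OF D]
  have "\<alpha> J \<odot> \<pi> (c1.down J) J = descent J \<odot> \<pi> (c1.down J) J"
    using np[OF p(2)] descent(5)[OF J] s[OF c1.down_s_set] by simp
  then show ?thesis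
    by (rule c1.epic_cancel[OF c1.\<pi>(4)[OF p(2)]]) (use descent[OF J] H[OF J] p in simp_all)
qed

theorem configuration_unique:
  "\<exists>!\<alpha>. \<alpha> \<in> extensional (f_sets I r) \<and>
    configuration_isomorphism C I r \<sigma> \<iota> \<pi> \<sigma>' \<iota>' \<pi>' \<alpha> \<and> \<alpha> I = ident C X"
proof (rule ex1I)
  let ?\<alpha> = "restrict descent (f_sets I r)"
  have "configuration_morphism C I r \<sigma> \<iota> \<pi> \<sigma>' \<iota>' \<pi>' ?\<alpha>"
    unfolding configuration_morphism_def
  proof (intro conjI ballI)
    fix J assume "J \<in> f_sets I r"
    then show "?\<alpha> J \<in> Hom C (\<sigma> J) (\<sigma>' J)" using descent by (simp add: c1.in_Hom)
  next
    fix p assume "p \<in> G_pairs I r"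
    moreover obtain J K where "p = (J, K)" by fastforce
    ultimately show "case p of (J, K) \<Rightarrow> ?\<alpha> K \<odot> \<iota> J K = \<iota>' J K \<odot> ?\<alpha> J"
      using descent_natural_\<iota>[of J K] c1.G_pairD(1,2)[of J K] by simp
  next
    fix p assume "p \<in> H_pairs I r"
    moreover obtain J K where "p = (J, K)" by fastforce
    ultimately show "case p of (J, K) \<Rightarrow> ?\<alpha> K \<odot> \<pi> J K = \<pi>' J K \<odot> ?\<alpha> J"
      using descent_natural_\<pi>[of J K] c1.H_pairD(1,2)[of J K] by simp
  qed
  then show "?\<alpha> \<in> extensional (f_sets I r) \<and>
      configuration_isomorphism C I r \<sigma> \<iota> \<pi> \<sigma>' \<iota>' \<pi>' ?\<alpha> \<and> ?\<alpha> I = ident C X"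
    unfolding configuration_isomorphism_def using descent(4) descent_all by simp
next
  fix \<alpha> assume a: "\<alpha> \<in> extensional (f_sets I r) \<and>
    configuration_isomorphism C I r \<sigma> \<iota> \<pi> \<sigma>' \<iota>' \<pi>' \<alpha> \<and> \<alpha> I = ident C X"
  show "\<alpha> = restrict descent (f_sets I r)"
  proof (rule extensionalityI)
    show "\<alpha> \<in> extensional (f_sets I r)" using a by blast
    fix J assume "J \<in> f_sets I r"
    then show "\<alpha> J = restrict descent (f_sets I r) J"
      using morphism_determined a unfolding configuration_isomorphism_def by simp
  qed simp
qed

end

section \<open>Composition series and the configuration of simple factors\<close>

locale noetherian_object = ambient_object C X
  for C :: "('o, 'm, 'x) preadd_data_scheme" (structure) and X +
  assumes noetherian: "noetherian C"
begin

lemma self_factor_not_simple: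
  assumes U: "U \<in> L" and Q: "is_factor C U U Q"
  shows "\<not> simple_object C Q"
proof -
  obtain c where c: "is_cokernel C (inc U U) c" "tgt C c = Q" using Q U by (auto simp: is_factor_iff)
  note K = cokernelD[OF c(1)]
  have sc: "src C c = src C (rep U)" using K U by simp
  have QO: "Q \<in> Obj C" using K c by auto
  have "c = zero_mor C (src C c) Q" using K(2,4) sc c(2) U inc_self[OF U] by simp
  then have "ident C Q \<odot> c = zero_mor C (src C c) (tgt C (ident C Q))"
    using K c QO by simp
  from epic_zero[OF K(5) this] have "ident C Q = zero_mor C Q Q" using K c QO by simp
  then have "zero_object C Q" using zero_objectI QO by blast
  then show ?thesis unfolding simple_object_def by blast
qed

sublocale lat: modular_factor_lattice "subobjects C X" "sub_le C" meet join bot "full_sub C X"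
  "is_factor C" "isomorphic C" "simple_object C"
proof
  show "U \<in> L \<Longrightarrow> V \<in> L \<Longrightarrow> is_factor C U V Q \<Longrightarrow> U \<preceq> V" for U V Q
    by (simp add: is_factor_iff)
  show "\<exists>N. \<forall>k\<ge>N. A k = A N" if "\<And>k. A k \<in> L" "\<And>k::nat. A k \<preceq> A (Suc k)" for A
    using noetherian that X_Obj unfolding noetherian_def by blast
  show "U \<preceq> V \<Longrightarrow> V \<preceq> W \<Longrightarrow> U \<in> L \<Longrightarrow> V \<in> L \<Longrightarrow> W \<in> L \<Longrightarrow> U \<preceq> W" for U V W
    by (rule le_trans)
  show "isomorphic C P Q \<Longrightarrow> isomorphic C Q R \<Longrightarrow> isomorphic C P R" for P Q R
    by (rule isomorphic_trans)
  show "M = U \<or> M = V"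
    if "U \<in> L" "V \<in> L" "M \<in> L" "is_factor C U V Q" "simple_object C Q" "U \<preceq> M" "M \<preceq> V" for U V M Q
    using simple_factor_no_between that by blast
  show "simple_object C Q"
    if "U \<in> L" "V \<in> L" "U \<noteq> V" "is_factor C U V Q"
      and "\<And>M. \<lbrakk>M \<in> L; U \<preceq> M; M \<preceq> V\<rbrakk> \<Longrightarrow> M = U \<or> M = V" for U V Q
    using cover_factor_simple that by blast
qed ((rule le_refl le_antisym meet_join_closed le_meet_iff join_le_iff bot bot_le full_sub_in_L le_full modular
    isomorphic_sym ex_factor factors_isomorphic factor_closed_iso factor_transpose self_factor_not_simple;
    assumption)+)

lemma series_full: "lat.series (full_sub C X) n B T \<longleftrightarrow> composition_series C X n B T"
  unfolding lat.series_def composition_series_def by (auto simp: zero_sub_eq_bot)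

text \<open>Composition with \<open>u\<close> carries subobjects of the source of \<open>u\<close> to subobjects of \<open>X\<close> below \<open>U\<close>, with
  the same factor objects.\<close>

lemma series_of_composition_series:
  assumes U: "U \<in> L" "u \<in> U" and A: "composition_series C (src C u) n A T"
  shows "\<exists>B. lat.series U n B T"
proof -
  note u = subobjects_member[OF U]
  \<comment> \<open>the class of \<open>u \<odot> i\<close> is the same for all \<open>i \<in> W\<close>\<close>
  define P where "P W = subobject C (u \<odot> (SOME i. i \<in> W))" for W
  have mem: "u \<odot> i \<in> P W \<and> P W \<in> L" if W: "W \<in> subobjects C (src C u)" "i \<in> W" for W i
  proof -
    define j where "j = (SOME i. i \<in> W)"
    have jW: "j \<in> W" using W(2) unfolding j_def by (rule someI)
    note i = subobjects_member[OF W] and j = subobjects_member[OF W(1) jW]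
    have ft: "factors_through C (u \<odot> a) (u \<odot> b)"
      if ab: "factors_through C a b" "monic C a" "monic C b" "tgt C a = src C u" "tgt C b = src C u" for a b
    proof -
      obtain h where h: "h \<in> Mor C" "src C h = src C a" "tgt C h = src C b" "b \<odot> h = a"
        using ab(1) by (rule factors_throughE)
      then have "(u \<odot> b) \<odot> h = u \<odot> a" using assoc[of h b u] ab u by simp
      then show ?thesis by (intro factors_throughI[of h]) (use h ab u in simp_all)
    qed
    have fij: "factors_through C i j" "factors_through C j i"
      using mem_subobject[OF i(1), of j] i jW by simp_all
    have mon: "monic C (u \<odot> i)" "monic C (u \<odot> j)" "tgt C (u \<odot> i) = X" "tgt C (u \<odot> j) = X"
      using monic_cmp[of i u] monic_cmp[of j u] u i j by simp_all
    have "u \<odot> i \<in> P W"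
      unfolding P_def j_def[symmetric] mem_subobject[OF mon(2)]
      using mon ft fij i j by simp
    then show ?thesis using mon subobject_in_L unfolding P_def j_def by blast
  qed
  have ne: "\<exists>i. i \<in> W" if "W \<in> subobjects C (src C u)" for W
    using that subobject_self unfolding subobjects_def by blast
  have su: "src C u \<in> Obj C" using u by simp
  have "lat.series U n (\<lambda>k. P (A k)) T"
    unfolding lat.series_def
  proof (intro conjI allI impI)
    show "P (A k) \<in> L" if "k \<le> n" for k
      using A that mem ne unfolding composition_series_def by meson
    have A0: "A 0 \<in> subobjects C (src C u)" "zero_sub C (A 0)" "A n \<in> subobjects C (src C u)"
      "A n = full_sub C (src C u)" using A unfolding composition_series_def by blast+
    then obtain i where i: "i \<in> A 0" "zero_object C (src C i)" unfolding zero_sub_def by blast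
    have "src C (u \<odot> i) = src C i" using u subobjects_member[OF A0(1) i(1)] by simp
    then have "zero_sub C (P (A 0))" using i mem[OF A0(1) i(1)] unfolding zero_sub_def by metis
    then show "P (A 0) = bot" using mem[OF A0(1) i(1)] zero_sub_eq_bot by blast
    have "ident C (src C u) \<in> A n"
      unfolding A0(4) full_sub_def using subobject_self ident_monic su by blast
    from mem[OF A0(3) this] have "u \<in> P (A n)" "P (A n) \<in> L" using u by simp_all
    then show "P (A n) = U" using subobjects_member(3) u(3) by metis
    fix k assume k: "k < n"
    have Ak: "A k \<in> subobjects C (src C u)" "A (Suc k) \<in> subobjects C (src C u)"
      "is_factor C (A k) (A (Suc k)) (T (Suc k))" and s: "simple_object C (T (Suc k))"
      using A k unfolding composition_series_def by auto
    from s show "simple_object C (T (Suc k))" .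
    from Ak(3) obtain i j h p where ij: "i \<in> A k" "j \<in> A (Suc k)" and h: "h \<in> Hom C (src C i) (src C j)"
      "i = j \<odot> h" and p: "is_cokernel C h p" "tgt C p = T (Suc k)" unfolding is_factor_def by blast
    note i = subobjects_member[OF Ak(1) ij(1)] and j = subobjects_member[OF Ak(2) ij(2)]
    have "u \<odot> i = (u \<odot> j) \<odot> h" using assoc[of h j u] h u j by (simp add: in_Hom)
    moreover have "h \<in> Hom C (src C (u \<odot> i)) (src C (u \<odot> j))" using h(1) u i j by simp
    ultimately show "is_factor C (P (A k)) (P (A (Suc k))) (T (Suc k))"
      unfolding is_factor_def using mem[OF Ak(1) ij(1)] mem[OF Ak(2) ij(2)] p by blast
  qed
  then show ?thesis by blast
qed

lemma composition_series_of_series: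
  assumes U: "U \<in> L" and B: "lat.series U n B T"
  shows "\<exists>A. composition_series C (src C (rep U)) n A T"
proof -
  have BL: "B k \<in> L" if "k \<le> n" for k using B that unfolding lat.series_def by blast
  have step: "is_factor C (B k) (B (Suc k)) (T (Suc k))" "simple_object C (T (Suc k))" if "k < n" for k
    using B that unfolding lat.series_def by auto
  have le1: "B k \<preceq> B (Suc k)" if "k < n" for k
    using step(1)[OF that] is_factor_iff BL that by simp
  have leU: "B k \<preceq> U" if "k \<le> n" for k
    using that
  proof (induction rule: inc_induct)
    case base then show ?case using B U unfolding lat.series_def by simp
  next
    case (step k) then show ?case using le_trans[OF le1[of k], of U] BL U by simp
  qed
  have m: "monic C (inc (B k) U)" "src C (inc (B k) U) = src C (rep (B k))" "tgt C (inc (B k) U) = src C (rep U)"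
    if "k \<le> n" for k using that BL leU U by simp_all
  have "composition_series C (src C (rep U)) n (\<lambda>k. subobject C (inc (B k) U)) T"
    unfolding composition_series_def
  proof (intro conjI allI impI)
    show "subobject C (inc (B k) U) \<in> subobjects C (src C (rep U))" if "k \<le> n" for k
      using m[OF that] unfolding subobjects_def by blast
    have "zero_object C (src C (inc (B 0) U))"
      using m(2)[of 0] B zero_sub_rep[of bot] unfolding lat.series_def by simp
    then show "zero_sub C (subobject C (inc (B 0) U))"
      unfolding zero_sub_def using subobject_self[OF m(1)[of 0]] by blast
    show "subobject C (inc (B n) U) = full_sub C (src C (rep U))"
      using B U inc_self unfolding lat.series_def full_sub_def by simp
    fix k assume k: "k < n"
    show "simple_object C (T (Suc k))" using step k by blast
    have eq: "inc (B k) U = inc (B (Suc k)) U \<odot> inc (B k) (B (Suc k))"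
      using k BL U le1 leU by (simp add: inc_inc)
    obtain p where p: "is_cokernel C (inc (B k) (B (Suc k))) p" "tgt C p = T (Suc k)"
      using step(1)[OF k] is_factor_iff BL k by auto
    have hm: "inc (B k) (B (Suc k)) \<in> Hom C (src C (inc (B k) U)) (src C (inc (B (Suc k)) U))"
      using k BL U le1 leU by (simp add: in_Hom)
    have "inc (B k) U \<in> subobject C (inc (B k) U)" "inc (B (Suc k)) U \<in> subobject C (inc (B (Suc k)) U)"
      using subobject_self m k by simp_all
    then show "is_factor C (subobject C (inc (B k) U)) (subobject C (inc (B (Suc k)) U)) (T (Suc k))"
      unfolding is_factor_def using eq hm p by blast
  qed
  then show ?thesis by blast
qed

end

locale nonisomorphic_factors_object = noetherian_object C X
  for C :: "('o, 'm, 'x) preadd_data_scheme" (structure) and X +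
  fixes I :: "'i set" and S :: "'i \<Rightarrow> 'o" and n A T
  assumes A_series: "composition_series C X n A T"
    and T_noniso: "\<And>k l. \<lbrakk>1 \<le> k; k < l; l \<le> n\<rbrakk> \<Longrightarrow> \<not> isomorphic C (T k) (T l)"
    and finite_I: "finite I" and card_I: "card I = n" and S_image: "S ` I = T ` {1..n}"
begin

sublocale mf: multiplicity_free_lattice "subobjects C X" "sub_le C" meet join bot "full_sub C X"
  "is_factor C" "isomorphic C" "simple_object C" I S n A T
  by unfold_locales (simp_all only: series_full A_series T_noniso finite_I card_I S_image not_False_eq_True)

lemma factor_order_eq: "factor_order C X I S = mf.series_order"
  unfolding factor_order_def mf.series_order_def factor_bij_def series_full by blast

text \<open>The left hand side quantifies over all composition series of \<open>U\<close> and would hold vacuously if there were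
  none; for the forward direction a series is exhibited.\<close>

lemma has_simple_factors_iff:
  assumes U: "U \<in> L" and J: "J \<subseteq> I"
  shows "has_simple_factors C J S U \<longleftrightarrow> mf.F U = J"
proof
  assume h: "has_simple_factors C J S U"
  obtain m B T' where s: "lat.series U m B T'" using mf.ex_series U by blast
  obtain A' where "composition_series C (src C (rep U)) m A' T'"
    using composition_series_of_series[OF U s] by blast
  then obtain \<phi> where "factor_bij C J S m T' \<phi>" using h rep_in[OF U] unfolding has_simple_factors_def by blast
  then show "mf.F U = J" using mf.numbering_unique(1)[OF s J, of \<phi>] unfolding factor_bij_def by blast
next
  assume F: "mf.F U = J"
  show "has_simple_factors C J S U"
    unfolding has_simple_factors_def factor_bij_def
  proof (intro ballI allI impI)
    fix u m A' T' assume u: "u \<in> U" and "composition_series C (src C u) m A' T'"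
    then obtain B where "lat.series U m B T'" using series_of_composition_series[OF U u] by blast
    from mf.series_numbering[OF this] F
    show "\<exists>\<phi>. bij_betw \<phi> J {1..m} \<and> (\<forall>i\<in>J. isomorphic C (S i) (T' (\<phi> i)))" by blast
  qed
qed

definition sub_of :: "'i set \<Rightarrow> 'm set" where
  "sub_of J = (THE U. U \<in> L \<and> mf.F U = J)"

lemma sub_of:
  assumes "J \<in> s_sets I mf.series_order"
  shows "sub_of J \<in> L" "mf.F (sub_of J) = J"
proof -
  obtain U where U: "U \<in> L" "mf.F U = J" using assms unfolding mf.s_sets_eq by blast
  then have "sub_of J = U" unfolding sub_of_def using mf.F_inj by (intro the_equality) blast+
  then show "sub_of J \<in> L" "mf.F (sub_of J) = J" using U by simp_all
qed

lemma sub_of_eq: "U \<in> L \<Longrightarrow> sub_of (mf.F U) = U"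
  using sub_of[of "mf.F U"] mf.F_inj unfolding mf.s_sets_eq by blast

sublocale fil: s_set_filtration C X I mf.series_order sub_of
proof (unfold_locales)
  show "finite I" by (rule finite_I)
  show "partial_order_on I mf.series_order" by (rule mf.partial_order_series_order)
  show "J \<in> s_sets I mf.series_order \<Longrightarrow> sub_of J \<in> L" for J by (rule sub_of(1))
  show "J \<in> s_sets I mf.series_order \<Longrightarrow> K \<in> s_sets I mf.series_order \<Longrightarrow> J \<subseteq> K \<Longrightarrow> sub_of J \<preceq> sub_of K" for J K
    using mf.F_le_iff[of "sub_of J" "sub_of K"] sub_of by simp
  show "sub_of (J \<inter> K) = meet (sub_of J) (sub_of K)" if "J \<in> s_sets I mf.series_order" "K \<in> s_sets I mf.series_order" for J K
    using sub_of_eq[of "meet (sub_of J) (sub_of K)"] sub_of[OF that(1)] sub_of[OF that(2)]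
    by (simp add: mf.F_meet)
  show "sub_of (J \<union> K) = join (sub_of J) (sub_of K)" if "J \<in> s_sets I mf.series_order" "K \<in> s_sets I mf.series_order" for J K
    using sub_of_eq[of "join (sub_of J) (sub_of K)"] sub_of[OF that(1)] sub_of[OF that(2)]
    by (simp add: mf.F_join)
  show "sub_of {} = bot" using sub_of_eq[of bot] by simp
  show "sub_of I = full_sub C X" using sub_of_eq[of "full_sub C X"] by simp
qed

text \<open>The two s-sets \<open>down {i}\<close> and \<open>down {i} - {i}\<close> differ in one element, so the subquotient of their
  difference that is isomorphic to \<open>S i\<close> must be all of it.\<close>

lemma simple_sub_factor:
  assumes i: "i \<in> I"
  shows "isomorphic C (fil.obj {i}) (S i)"
proof -
  have f: "{i} \<in> f_sets I mf.series_order" by (rule fil.f_set_singleton[OF i])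
  note c = fil.top_layerD[OF fil.top_layer_down[OF f]]
  let ?U = "sub_of (fil.down {i} - {i})" and ?V = "sub_of (fil.down {i})"
  note U = sub_of[OF c(3)] and V = sub_of[OF c(1)]
  have le: "?U \<preceq> ?V" by (rule fil.s_mono[OF c(3,1)]) blast
  have "mf.facs ?U ?V = {i}" using mf.facs_eq[OF U(1) V(1) le] U(2) V(2) c(2) by blast
  then have "lat.has_factor (S i) ?U ?V" unfolding mf.facs_def by blast
  then obtain P Q where PQ: "P \<in> L" "Q \<in> L" "?U \<preceq> P" "P \<preceq> Q" "Q \<preceq> ?V" "is_factor C P Q (S i)" "?U \<preceq> Q" "P \<preceq> ?V"
    using U(1) V(1) by (rule lat.has_factorE)
  have ne: "mf.F P \<noteq> mf.F Q"
    using mf.F_inj[OF PQ(1,2)] self_factor_not_simple mf.S_simple[OF i] PQ by metis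
  have "mf.F ?U \<subseteq> mf.F P" "mf.F P \<subseteq> mf.F Q" "mf.F Q \<subseteq> mf.F ?V"
    using mf.F_mono PQ U(1) V(1) by blast+
  moreover have "A = D - {i} \<and> B = D" if "D - {i} \<subseteq> A" "A \<subseteq> B" "B \<subseteq> D" "A \<noteq> B" for A B D :: "'i set"
    using that by blast
  ultimately have "mf.F P = mf.F ?U" "mf.F Q = mf.F ?V" using ne U(2) V(2) by simp_all
  then have "P = ?U" "Q = ?V" using mf.F_inj PQ U(1) V(1) by blast+
  then show ?thesis using factors_isomorphic[OF U(1) V(1) fil.obj_factor[OF f]] PQ by blast
qed

theorem factor_configuration_exists: "factor_configuration C X I S fil.obj fil.iota fil.pi"
  unfolding factor_configuration_def factor_order_eq
proof (intro conjI ballI)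
  show "configuration C I mf.series_order fil.obj fil.iota fil.pi" by (rule fil.configuration_exists)
  show "fil.obj I = X" by (rule fil.obj_all)
  show "i \<in> I \<Longrightarrow> isomorphic C (fil.obj {i}) (S i)" for i by (rule simple_sub_factor)
  fix J assume J: "J \<in> s_sets I mf.series_order"
  have "has_simple_factors C J S U \<longleftrightarrow> U = sub_of J" if "U \<in> L" for U
    using has_simple_factors_iff[OF that fil.s_set_subset[OF J]] sub_of[OF J] sub_of_eq[OF that] by metis
  then show "{U \<in> L. has_simple_factors C J S U} = {subobject C (fil.iota J I)}"
    using fil.iota_represents[OF J] sub_of(1)[OF J] by auto
qed

theorem factor_configuration_unique:
  assumes c: "factor_configuration C X I S \<sigma> \<iota> \<pi>" "factor_configuration C X I S \<sigma>' \<iota>' \<pi>'"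
  shows "\<exists>!\<alpha>. \<alpha> \<in> extensional (f_sets I (factor_order C X I S)) \<and>
    configuration_isomorphism C I (factor_order C X I S) \<sigma> \<iota> \<pi> \<sigma>' \<iota>' \<pi>' \<alpha> \<and> \<alpha> I = ident C X"
proof -
  interpret configuration_pair C I mf.series_order \<sigma> \<iota> \<pi> \<sigma>' \<iota>' \<pi>' X
  proof (unfold_locales)
    show "configuration C I mf.series_order \<sigma> \<iota> \<pi>" "configuration C I mf.series_order \<sigma>' \<iota>' \<pi>'" "\<sigma> I = X" "\<sigma>' I = X"
      using c unfolding factor_configuration_def factor_order_eq by blast+
    fix J assume "J \<in> s_sets I mf.series_order"
    then have "{U \<in> L. has_simple_factors C J S U} = {subobject C (\<iota> J I)}"
      "{U \<in> L. has_simple_factors C J S U} = {subobject C (\<iota>' J I)}"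
      using c unfolding factor_configuration_def factor_order_eq by simp_all
    then show "subobject C (\<iota> J I) = subobject C (\<iota>' J I)" by blast
  qed
  show ?thesis unfolding factor_order_eq by (rule configuration_unique)
qed

end

theorem corollary4p3:
  fixes C :: "('o, 'm, 'x) preadd_data_scheme"
    and X :: 'o and I :: "'i set" and S :: "'i \<Rightarrow> 'o"
  assumes "abelian_category C" and "finite_length C"
    and "X \<in> Obj C" and "nonisomorphic_simple_factors C X I S"
  shows "(\<exists>\<sigma> \<iota> \<pi>. factor_configuration C X I S \<sigma> \<iota> \<pi>) \<and>
    (\<forall>\<sigma> \<iota> \<pi> \<sigma>' \<iota>' \<pi>'.
      factor_configuration C X I S \<sigma> \<iota> \<pi> \<and> factor_configuration C X I S \<sigma>' \<iota>' \<pi>' \<longrightarrow>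
      (\<exists>!\<alpha>. \<alpha> \<in> extensional (f_sets I (factor_order C X I S)) \<and>
        configuration_isomorphism C I (factor_order C X I S) \<sigma> \<iota> \<pi> \<sigma>' \<iota>' \<pi>' \<alpha> \<and>
        \<alpha> I = ident C X))"
proof -
  obtain n A T where *: "composition_series C X n A T"
    "\<forall>k l. 1 \<le> k \<and> k < l \<and> l \<le> n \<longrightarrow> \<not> isomorphic C (T k) (T l)"
    "finite I" "card I = n" "T ` {1..n} = S ` I"
    using assms(4) unfolding nonisomorphic_simple_factors_def by (elim exE conjE) (rule that)
  interpret abelian_category C by (rule assms(1))
  interpret nonisomorphic_factors_object C X I S n A T
  proof unfold_locales
    show "X \<in> Obj C" by (rule assms(3))
    show "noetherian C" using assms(2) unfolding finite_length_def by (rule conjunct2)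
    show "composition_series C X n A T" "finite I" "card I = n" by (rule *)+
    show "S ` I = T ` {1..n}" by (rule *(5)[symmetric])
    show "\<not> isomorphic C (T k) (T l)" if "1 \<le> k" "k < l" "l \<le> n" for k l
      using *(2) that by simp
  qed
  show ?thesis
  proof (rule conjI)
    show "\<exists>\<sigma> \<iota> \<pi>. factor_configuration C X I S \<sigma> \<iota> \<pi>"
      by (intro exI) (rule factor_configuration_exists)
  qed (intro allI impI, elim conjE, rule factor_configuration_unique)
qed

end
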